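(* Let $\Omega\subset\mathbb{R}^n$ ($n=2$ or $n=3$) be a bounded Lipschitz polytopal domain, let $\mathcal{T}_h$ be a conforming simplicial triangulation of $\Omega$ with set of interior faces $\mathcal{F}_h^i$, and let $V_h$ be the finite element space over $\mathcal{T}_h$ defined in the context (with polynomial degree $k\ge 3$ if $n=2$, $k\ge 5$ if $n=3$). Then for every $v_h\in V_h$, $$\sum_{K\in\mathcal{T}_h}\|\Delta v_h\|_{L^2(K)}^2=\sum_{K\in\mathcal{T}_h}\|D^2v_h\|_{L^2(K)}^2+2\sum_{F\in\mathcal{F}_h^i}\langle\llbracket\nabla v_h\rrbracket,\Delta_T v_h\rangle_F .$$
   Context: Triangulation: $\mathcal{T}_h$ is a conforming triangulation of $\Omega$ into (closed) simplices $K$. A face is an $(n-1)$-dimensional subsimplex of some $K\in\mathcal{T}_h$; $\mathcal{F}_h^i$ denotes the set of faces not contained in $\partial\Omega$, each being shared by exactly two elements, $F=\partial K^+\cap\partial K^-$. Finite element space: $\mathcal{P}_k(K)$ denotes polynomials of total degree at most $k$ on $K$. - For $n=2$, $k\ge3$: $V_h=\{v\in H_0^1(\Omega): v|_K\in\mathcal{P}_k(K)\ \forall K\in\mathcal{T}_h,\ v\text{ is }C^1\text{ at all vertices}\}$. - For $n=3$, $k\ge5$: $V_h=\{v\in H_0^1(\Omega): v|_K\in\mathcal{P}_k(K)\ \forall K\in\mathcal{T}_h,\ v\text{ is }C^1\text{ on all edges},\ v\text{ is }C^2\text{ at all vertices}\}$. Here "$C^1$ at a vertex / on an edge" means that the values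 of $v$ and $\nabla v$ at that vertex / along that edge, computed from all elements containing it, coincide; "$C^2$ at a vertex" means that in addition the values of $D^2v$ there coincide. Jump: for $F=\partial K^+\cap\partial K^-$ and a piecewise smooth vector field $\bm{w}$, $\llbracket\bm{w}\rrbracket|_F=\bm{w}^+\cdot\bm{n}^+|_F+\bm{w}^-\cdot\bm{n}^-|_F$, where $\bm{w}^\pm=\bm{w}|_{K^\pm}$ and $\bm{n}^\pm$ is the outward unit normal of $K^\pm$. Tangential Laplacian: on a (flat) face $F$ with orthonormal tangential coordinate directions $\bm{t}_1,\dots,\bm{t}_{n-1}$, $\Delta_T w=\sum_{i=1}^{n-1}\partial^2 w/\partial\bm{t}_i^2$ (for $v_h\in V_h$ this is single-valued on $F$ because $v_h$ is continuous across $F$). $\langle\cdot,\cdot\rangle_F$ is the $L^2(F)$ inner product; $D^2v$ is the Hessian, with $\|D^2 v\|_{L^2(K)}^2=\int_K|D^2v|^2\,dx$ and $|\cdot|$ the Frobenius norm. *)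

theory Defs
  imports "HOL-Analysis.Analysis"
begin

section \<open>Classical differential operators\<close>

definition dir_deriv :: "'a::real_normed_vector \<Rightarrow> ('a \<Rightarrow> real) \<Rightarrow> 'a \<Rightarrow> real" where
  "dir_deriv t f x = frechet_derivative f (at x) t"

definition grad :: "(real^'n \<Rightarrow> real) \<Rightarrow> real^'n \<Rightarrow> real^'n" where
  "grad f x = (\<chi> i. dir_deriv (axis i 1) f x)"

text \<open>The norm of the type \<open>real^'n^'n\<close> is the Frobenius norm.\<close>

definition hessian :: "(real^'n \<Rightarrow> real) \<Rightarrow> real^'n \<Rightarrow> real^'n^'n" where
  "hessian f x = (\<chi> i j. dir_deriv (axis j 1) (dir_deriv (axis i 1) f) x)"

definition laplacian :: "(real^'n \<Rightarrow> real) \<Rightarrow> real^'n \<Rightarrow> real" where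
  "laplacian f x = (\<Sum>i\<in>UNIV. dir_deriv (axis i 1) (dir_deriv (axis i 1) f) x)"


section \<open>Domains\<close>

text \<open>Near each boundary point, in suitably rotated coordinates (with \<open>e\<close> as last axis),
  the set lies strictly above the graph of a Lipschitz function of the remaining coordinates.\<close>

definition lipschitz_boundary :: "(real^'n) set \<Rightarrow> bool" where
  "lipschitz_boundary \<Omega> \<longleftrightarrow>
     (\<forall>x\<in>frontier \<Omega>. \<exists>r>0. \<exists>e L \<gamma>. norm e = 1 \<and> L-lipschitz_on {y. y \<bullet> e = 0} \<gamma> \<and>
        \<Omega> \<inter> ball x r = {y \<in> ball x r. \<gamma> (y - (y \<bullet> e) *\<^sub>R e) < y \<bullet> e})"

text \<open>The library notion \<open>polytope\<close> is convex; a polytopal domain need not be.\<close>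

definition lipschitz_polytopal_domain :: "(real^'n) set \<Rightarrow> bool" where
  "lipschitz_polytopal_domain \<Omega> \<longleftrightarrow>
     open \<Omega> \<and> connected \<Omega> \<and> \<Omega> \<noteq> {} \<and> bounded \<Omega> \<and> lipschitz_boundary \<Omega> \<and>
     (\<exists>\<P>. finite \<P> \<and> (\<forall>P\<in>\<P>. polytope P) \<and> closure \<Omega> = \<Union>\<P>)"


section \<open>Sobolev spaces\<close>

fun C_k :: "nat \<Rightarrow> (real^'n \<Rightarrow> real) \<Rightarrow> bool" where
  "C_k 0 f \<longleftrightarrow> continuous_on UNIV f"
| "C_k (Suc m) f \<longleftrightarrow> f differentiable_on UNIV \<and> (\<forall>i. C_k m (dir_deriv (axis i 1) f))"

text \<open>The space of smooth functions with compact support in \<open>\<Omega>\<close>.\<close>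

definition test_functions :: "(real^'n) set \<Rightarrow> (real^'n \<Rightarrow> real) set" where
  "test_functions \<Omega> =
     {\<phi>. (\<forall>m. C_k m \<phi>) \<and> compact (closure {x. \<phi> x \<noteq> 0}) \<and> closure {x. \<phi> x \<noteq> 0} \<subseteq> \<Omega>}"

definition square_integrable_on :: "(real^'n) set \<Rightarrow> (real^'n \<Rightarrow> 'b::euclidean_space) \<Rightarrow> bool" where
  "square_integrable_on S f \<longleftrightarrow>
     f \<in> borel_measurable (lebesgue_on S) \<and> integrable (lebesgue_on S) (\<lambda>x. (norm (f x))\<^sup>2)"

definition norm_L2 :: "(real^'n) set \<Rightarrow> (real^'n \<Rightarrow> 'b::euclidean_space) \<Rightarrow> real" where
  "norm_L2 S f = sqrt (LINT x|lebesgue_on S. (norm (f x))\<^sup>2)"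

definition weak_gradient ::
  "(real^'n) set \<Rightarrow> (real^'n \<Rightarrow> real) \<Rightarrow> (real^'n \<Rightarrow> real^'n) \<Rightarrow> bool" where
  "weak_gradient \<Omega> v g \<longleftrightarrow>
     (\<forall>\<phi>\<in>test_functions \<Omega>. \<forall>i.
        (LINT x|lebesgue_on \<Omega>. v x * dir_deriv (axis i 1) \<phi> x)
          = - (LINT x|lebesgue_on \<Omega>. g x $ i * \<phi> x))"

text \<open>The closure of the test functions in the Sobolev space of order one.  The elements are
  functions, not equivalence classes, and membership only depends on the values almost
  everywhere in \<open>\<Omega>\<close>.\<close>

definition H1_0 :: "(real^'n) set \<Rightarrow> (real^'n \<Rightarrow> real) set" where
  "H1_0 \<Omega> =
     {v. square_integrable_on \<Omega> v \<and>
        (\<exists>g. square_integrable_on \<Omega> g \<and> weak_gradient \<Omega> v g \<and>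
           (\<exists>\<phi>. (\<forall>m::nat. \<phi> m \<in> test_functions \<Omega>) \<and>
              (\<lambda>m. norm_L2 \<Omega> (\<lambda>x. \<phi> m x - v x)) \<longlonglongrightarrow> 0 \<and>
              (\<lambda>m. norm_L2 \<Omega> (\<lambda>x. grad (\<phi> m) x - g x)) \<longlonglongrightarrow> 0))}"


section \<open>Triangulations and finite element spaces\<close>

definition conforming_triangulation :: "(real^'n) set \<Rightarrow> (real^'n) set set \<Rightarrow> bool" where
  "conforming_triangulation \<Omega> \<T> \<longleftrightarrow>
     triangulation \<T> \<and> (\<forall>K\<in>\<T>. int CARD('n) simplex K) \<and> \<Union>\<T> = closure \<Omega>"

definition interior_faces :: "(real^'n) set \<Rightarrow> (real^'n) set set \<Rightarrow> (real^'n) set set" where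
  "interior_faces \<Omega> \<T> = {F. (\<exists>K\<in>\<T>. F facet_of K) \<and> \<not> F \<subseteq> frontier \<Omega>}"

definition mesh_vertices :: "(real^'n) set set \<Rightarrow> (real^'n) set" where
  "mesh_vertices \<T> = {z. \<exists>K\<in>\<T>. {z} face_of K}"

definition mesh_edges :: "(real^'n) set set \<Rightarrow> (real^'n) set set" where
  "mesh_edges \<T> = {e. \<exists>K\<in>\<T>. e edge_of K}"

definition polys :: "nat \<Rightarrow> (real^'n \<Rightarrow> real) set" where
  "polys k = {p. \<exists>c. p = (\<lambda>x. \<Sum>\<alpha> | (\<Sum>i\<in>UNIV. \<alpha> i) \<le> k. c \<alpha> * (\<Prod>i\<in>UNIV. x $ i ^ \<alpha> i))}"

text \<open>The polynomial that represents \<open>v\<close> on the element \<open>K\<close>; it is unique because \<open>K\<close> has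
  nonempty interior.  Being defined everywhere, it gives the one-sided values and derivatives of
  \<open>v\<close>, taken from \<open>K\<close>, on the boundary of \<open>K\<close>.\<close>

definition elem_poly :: "(real^'n \<Rightarrow> real) \<Rightarrow> (real^'n) set \<Rightarrow> real^'n \<Rightarrow> real" where
  "elem_poly v K = (THE p. (\<exists>k. p \<in> polys k) \<and> (AE x in lebesgue_on K. v x = p x))"

definition C1_at :: "(real^'n) set set \<Rightarrow> (real^'n \<Rightarrow> real) \<Rightarrow> real^'n \<Rightarrow> bool" where
  "C1_at \<T> v z \<longleftrightarrow>
     (\<forall>K\<in>\<T>. \<forall>K'\<in>\<T>. z \<in> K \<and> z \<in> K' \<longrightarrow>
        elem_poly v K z = elem_poly v K' z \<and>
        grad (elem_poly v K) z = grad (elem_poly v K') z)"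

definition C2_at :: "(real^'n) set set \<Rightarrow> (real^'n \<Rightarrow> real) \<Rightarrow> real^'n \<Rightarrow> bool" where
  "C2_at \<T> v z \<longleftrightarrow>
     C1_at \<T> v z \<and>
     (\<forall>K\<in>\<T>. \<forall>K'\<in>\<T>. z \<in> K \<and> z \<in> K' \<longrightarrow>
        hessian (elem_poly v K) z = hessian (elem_poly v K') z)"

text \<open>On an edge \<open>e\<close>, the coincidence is required of all elements that contain \<open>e\<close>, not of
  those which merely touch it in a vertex.\<close>

definition C1_on_edge :: "(real^'n) set set \<Rightarrow> (real^'n \<Rightarrow> real) \<Rightarrow> (real^'n) set \<Rightarrow> bool" where
  "C1_on_edge \<T> v e \<longleftrightarrow>
     (\<forall>K\<in>\<T>. \<forall>K'\<in>\<T>. e \<subseteq> K \<and> e \<subseteq> K' \<longrightarrow>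
        (\<forall>z\<in>e. elem_poly v K z = elem_poly v K' z \<and>
                grad (elem_poly v K) z = grad (elem_poly v K') z))"

text \<open>Only meaningful in dimensions 2 and 3.\<close>

definition fe_space ::
  "(real^'n) set \<Rightarrow> (real^'n) set set \<Rightarrow> nat \<Rightarrow> (real^'n \<Rightarrow> real) set" where
  "fe_space \<Omega> \<T> k =
     {v \<in> H1_0 \<Omega>.
        (\<forall>K\<in>\<T>. \<exists>p\<in>polys k. AE x in lebesgue_on K. v x = p x) \<and>
        (CARD('n) = 2 \<longrightarrow> (\<forall>z\<in>mesh_vertices \<T>. C1_at \<T> v z)) \<and>
        (CARD('n) = 3 \<longrightarrow>
           (\<forall>e\<in>mesh_edges \<T>. C1_on_edge \<T> v e) \<and> (\<forall>z\<in>mesh_vertices \<T>. C2_at \<T> v z))}"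


section \<open>Faces: normals, jumps, surface integrals, tangential Laplacian\<close>

definition outward_normal :: "(real^'n) set \<Rightarrow> (real^'n) set \<Rightarrow> real^'n" where
  "outward_normal K F =
     (THE \<nu>. norm \<nu> = 1 \<and> (\<forall>x\<in>F. \<forall>y\<in>F. (y - x) \<bullet> \<nu> = 0) \<and>
           (\<forall>x\<in>F. \<forall>y\<in>K. (y - x) \<bullet> \<nu> \<le> 0))"

text \<open>A piecewise smooth vector field is a family \<open>w\<close> indexed by the elements.  For an interior
  face, the sum has exactly two terms, one for each of the two elements sharing \<open>F\<close>.\<close>

definition jump ::
  "(real^'n) set set \<Rightarrow> ((real^'n) set \<Rightarrow> real^'n \<Rightarrow> real^'n) \<Rightarrow> (real^'n) set \<Rightarrow> real^'n \<Rightarrow> real" where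
  "jump \<T> w F x = (\<Sum>K | K \<in> \<T> \<and> F facet_of K. w K x \<bullet> outward_normal K F)"

definition orthonormal_frame_of :: "(real^'n) set \<Rightarrow> (real^'n) set \<Rightarrow> bool" where
  "orthonormal_frame_of F T \<longleftrightarrow>
     pairwise orthogonal T \<and> (\<forall>t\<in>T. norm t = 1) \<and> span T = span {x - y | x y. x \<in> F \<and> y \<in> F}"

lemma orthonormal_frame_of_exists: "\<exists>T. orthonormal_frame_of F T"
proof -
  let ?S = "span {x - y | x y. x \<in> F \<and> y \<in> F}"
  obtain T where "T \<subseteq> ?S" "pairwise orthogonal T" "\<And>t. t \<in> T \<Longrightarrow> norm t = 1"
      "independent T" "card T = dim ?S" "span T = ?S"
    by (rule orthonormal_basis_subspace[of ?S]) simp_all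
  then have "orthonormal_frame_of F T"
    by (simp add: orthonormal_frame_of_def)
  then show ?thesis ..
qed

definition tangent_frame :: "(real^'n) set \<Rightarrow> (real^'n) set" where
  "tangent_frame F = (SOME T. orthonormal_frame_of F T)"

text \<open>Lebesgue measure on the affine hull of a flat face, in the Cartesian coordinates given by
  the frame and by some origin in \<open>F\<close>; it does not depend on these choices.  Compare
  \<open>lborel_eq\<close>.\<close>

definition surface_measure :: "(real^'n) set \<Rightarrow> (real^'n) measure" where
  "surface_measure F =
     distr (\<Pi>\<^sub>M t\<in>tangent_frame F. lborel) borel
       (\<lambda>y. (SOME a. a \<in> F) + (\<Sum>t\<in>tangent_frame F. y t *\<^sub>R t))"

definition inner_L2_face ::
  "(real^'n) set \<Rightarrow> (real^'n \<Rightarrow> real) \<Rightarrow> (real^'n \<Rightarrow> real) \<Rightarrow> real" where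
  "inner_L2_face F f g = (LINT x:F|surface_measure F. f x * g x)"

definition tangential_laplacian :: "(real^'n) set \<Rightarrow> (real^'n \<Rightarrow> real) \<Rightarrow> real^'n \<Rightarrow> real" where
  "tangential_laplacian F w x = (\<Sum>t\<in>tangent_frame F. dir_deriv t (dir_deriv t w) x)"

text \<open>The common value, for \<open>x\<close> on \<open>F\<close>, of the tangential Laplacians taken from the elements
  sharing \<open>F\<close>.\<close>

definition face_laplacian ::
  "(real^'n) set set \<Rightarrow> (real^'n \<Rightarrow> real) \<Rightarrow> (real^'n) set \<Rightarrow> real^'n \<Rightarrow> real" where
  "face_laplacian \<T> v F x =
     (THE d. \<forall>K\<in>\<T>. F facet_of K \<longrightarrow> tangential_laplacian F (elem_poly v K) x = d)"

end

theory Submission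
  imports Defs
begin

text \<open>
  On one element \<open>K\<close> with polynomial \<open>p\<close> the difference of the two squared norms is the integral of
  the divergence of \<open>\<Delta>p \<nabla>p - D\<^sup>2p \<nabla>p\<close>, so it is a sum of integrals over the facets of \<open>K\<close>.  In an
  orthonormal frame of a facet \<open>F\<close>, consisting of the outward normal \<open>n\<close> and of tangents \<open>t\<close>, the
  second normal derivatives cancel and the normal component of this field is
  \<open>2 \<Delta>\<^sub>T p \<partial>\<^sub>n p - \<Sum>\<^sub>t \<partial>\<^sub>t(\<partial>\<^sub>t p \<partial>\<^sub>n p)\<close>
  (\<open>divergence_boundary_field\<close>, \<open>boundary_field_normal\<close>, \<open>element_identity\<close>).

  Summing over the elements, group the terms by facets.  On a facet shared by \<open>K\<close> and \<open>K'\<close> the normals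
  are opposite.  The first summands give the jump term of the claim, because \<open>p\<close> and \<open>p'\<close>, hence also
  their tangential Laplacians, agree on \<open>F\<close>.  The second summands are the tangential divergence of
  \<open>\<partial>\<^sub>t p \<partial>\<^sub>n p + \<partial>\<^sub>t p' \<partial>\<^sub>n\<^sub>' p'\<close>.  The gradients of \<open>p\<close> and \<open>p'\<close> agree on the relative boundary of \<open>F\<close>, which
  consists of vertices in dimension two and of edges in dimension three; so these fields vanish there
  and the integral of their tangential divergence is zero (\<open>interior_facet_identity\<close>).  On a facet in
  the boundary of the domain \<open>p\<close> vanishes, and so does every term (\<open>boundary_facet_zero\<close>).

  Two ingredients carry most of the work.  The divergence theorem on a simplex (\<open>divergence_simplex\<close>)
  follows from Fubini along the direction of an edge from \<open>j\<close> to \<open>i\<close>: every line in that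
  direction that meets the simplex enters through the facet opposite to \<open>i\<close> and leaves through
  the facet opposite to \<open>j\<close>, and the surface measure of a facet is related to the measure on the
  orthogonal complement of the edge by an oblique projection.  Edge directions span the space, and
  both sides are linear in the direction.  The trace statements, \<open>p = p'\<close> on shared facets and \<open>p = 0\<close> on
  boundary facets, come from the approximating test functions \<open>\<phi>\<^sub>m\<close>: tested against polynomials that
  vanish on the other facets, the integrals of \<open>\<phi>\<^sub>m\<close> over \<open>F\<close> converge to those of \<open>p\<close>
  (\<open>trace_limit\<close>), whichever of the adjacent elements is used.
\<close>

section \<open>Lebesgue measure in orthonormal frames\<close>

lemma nn_integral_lborel_shift:
  fixes c :: "'a::euclidean_space"
  assumes [measurable]: "g \<in> borel_measurable borel"
  shows "(\<integral>\<^sup>+x. g (x + c) \<partial>lborel) = (\<integral>\<^sup>+x. g x \<partial>lborel)"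
proof -
  have "(\<integral>\<^sup>+x. g (x + c) \<partial>lborel) = (\<integral>\<^sup>+x. g x \<partial>distr lborel borel ((+) c))"
    by (subst nn_integral_distr) (simp_all add: add.commute)
  then show ?thesis by (simp add: lborel_distr_plus)
qed

text \<open>The image measure is translation invariant, and it agrees with Lebesgue measure on the unit ball.
  The usual uniqueness argument for Haar measure then applies: the measure of \<open>A\<close> times the volume of
  the ball is a double integral, in which a shift in each variable exchanges the two measures.\<close>

lemma lborel_orthogonal_invariant:
  fixes U :: "'a::euclidean_space \<Rightarrow> 'a"
  assumes U: "orthogonal_transformation U"
  shows "distr lborel borel U = lborel"
proof -
  let ?\<mu> = "distr lborel borel U"
  let ?B = "ball (0::'a) 1"
  have lin: "linear U" using U by (rule orthogonal_transformation_linear)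
  have [measurable]: "U \<in> borel_measurable borel"
    using lin by (intro borel_measurable_continuous_onI linear_continuous_on) (simp add: linear_conv_bounded_linear)
  obtain V where UV: "\<And>x. U (V x) = x"
    using orthogonal_transformation_surj[OF U] unfolding surj_def by metis
  have sh: "(\<integral>\<^sup>+x. f (x + c) \<partial>?\<mu>) = (\<integral>\<^sup>+x. f x \<partial>?\<mu>)" if [measurable]: "f \<in> borel_measurable borel" for f and c :: 'a
  proof -
    have "(\<integral>\<^sup>+x. f (x + c) \<partial>?\<mu>) = (\<integral>\<^sup>+x. f (U (V c + x)) \<partial>lborel)"
      by (simp add: nn_integral_distr linear_add[OF lin] UV add.commute)
    also have "\<dots> = (\<integral>\<^sup>+x. f (U x) \<partial>distr lborel borel ((+) (V c)))"
      by (subst nn_integral_distr) simp_all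
    also have "\<dots> = (\<integral>\<^sup>+x. f x \<partial>?\<mu>)"
      by (simp add: lborel_distr_plus nn_integral_distr)
    finally show ?thesis .
  qed
  have vB: "U -` ?B = ?B"
    using orthogonal_transformation_norm[OF U] by (auto simp: dist_norm)
  have \<mu>B: "emeasure ?\<mu> ?B = emeasure lborel ?B"
    by (simp add: emeasure_distr vB)
  have B0: "emeasure lborel ?B \<noteq> 0" "emeasure lborel ?B \<noteq> \<infinity>"
    using emeasure_lborel_ball_finite[of "0::'a" 1] content_ball_pos[of 1 "0::'a"]
    by (auto simp: measure_def)
  have sf: "sigma_finite_measure ?\<mu>"
  proof (rule sigma_finite_measure.intro, intro exI conjI)
    let ?A = "range (\<lambda>n::nat. ball (0::'a) (real n))"
    show "countable ?A" "?A \<subseteq> sets ?\<mu>" by auto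
    show "\<Union>?A = space ?\<mu>" by (auto simp: dist_norm reals_Archimedean2)
    have "U -` ball 0 r = ball 0 r" for r
      using orthogonal_transformation_norm[OF U] by (auto simp: dist_norm)
    then show "\<forall>a\<in>?A. emeasure ?\<mu> a \<noteq> \<infinity>"
      using emeasure_lborel_ball_finite[of "0::'a"] by (auto simp: emeasure_distr less_top[symmetric])
  qed
  interpret P: pair_sigma_finite ?\<mu> lborel
    using sf by (simp add: pair_sigma_finite_def lborel.sigma_finite_measure_axioms)
  show ?thesis
  proof (rule measure_eqI)
    fix A assume "A \<in> sets ?\<mu>"
    then have A[measurable]: "A \<in> sets borel" by simp
    define \<phi> where "\<phi> = (indicator A :: 'a \<Rightarrow> ennreal)"
    have [measurable]: "\<phi> \<in> borel_measurable borel" unfolding \<phi>_def by simp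
    define \<psi> where "\<psi> = (indicator ?B :: 'a \<Rightarrow> ennreal)"
    have [measurable]: "\<psi> \<in> borel_measurable borel" unfolding \<psi>_def by (intro borel_measurable_indicator borel_open open_ball)
    have m: "(\<lambda>(x, y). \<phi> (x + y) * \<psi> y) \<in> borel_measurable (?\<mu> \<Otimes>\<^sub>M lborel)"
      unfolding split_beta' by measurable
    have "emeasure ?\<mu> A * emeasure lborel ?B = (\<integral>\<^sup>+y. (\<integral>\<^sup>+x. \<phi> x * \<psi> y \<partial>?\<mu>) \<partial>lborel)"
      by (simp add: nn_integral_multc nn_integral_cmult_indicator \<phi>_def \<psi>_def)
    also have "\<dots> = (\<integral>\<^sup>+y. (\<integral>\<^sup>+x. \<phi> (x + y) * \<psi> y \<partial>?\<mu>) \<partial>lborel)"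
      by (intro nn_integral_cong sh[symmetric]) simp
    also have "\<dots> = (\<integral>\<^sup>+x. (\<integral>\<^sup>+y. \<phi> (x + y) * \<psi> y \<partial>lborel) \<partial>?\<mu>)"
      using m by (rule P.Fubini')
    also have "\<dots> = (\<integral>\<^sup>+x. (\<integral>\<^sup>+y. \<phi> y * \<psi> (y - x) \<partial>lborel) \<partial>?\<mu>)"
    proof (rule nn_integral_cong)
      fix x
      show "(\<integral>\<^sup>+y. \<phi> (x + y) * \<psi> y \<partial>lborel) = (\<integral>\<^sup>+y. \<phi> y * \<psi> (y - x) \<partial>lborel)"
        using nn_integral_lborel_shift[of "\<lambda>y. \<phi> y * \<psi> (y - x)" x] by (simp add: add.commute)
    qed
    also have "\<dots> = (\<integral>\<^sup>+y. (\<integral>\<^sup>+x. \<phi> y * \<psi> (y - x) \<partial>?\<mu>) \<partial>lborel)"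
      by (rule P.Fubini'[symmetric]) (simp add: split_beta')
    also have "\<dots> = (\<integral>\<^sup>+y. (\<integral>\<^sup>+x. \<phi> y * \<psi> x \<partial>?\<mu>) \<partial>lborel)"
    proof (rule nn_integral_cong)
      fix y
      have "\<psi> (y - x) = (\<psi> (x + - y)::ennreal)" for x
        by (simp add: \<psi>_def indicator_def norm_minus_commute dist_norm)
      then show "(\<integral>\<^sup>+x. \<phi> y * \<psi> (y - x) \<partial>?\<mu>) = (\<integral>\<^sup>+x. \<phi> y * \<psi> x \<partial>?\<mu>)"
        using sh[of "\<lambda>x. \<phi> y * \<psi> x" "- y"] by simp
    qed
    also have "\<dots> = emeasure lborel A * emeasure ?\<mu> ?B"
      by (simp add: nn_integral_multc nn_integral_cmult) (simp add: \<phi>_def \<psi>_def)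
    finally have "emeasure ?\<mu> A * emeasure lborel ?B = emeasure lborel A * emeasure lborel ?B"
      using \<mu>B by simp
    then show "emeasure ?\<mu> A = emeasure lborel A"
      using B0 by (metis ennreal_mult_cancel_left infinity_ennreal_def mult.commute)
  qed simp
qed

definition orthonormal_basis :: "'a::euclidean_space set \<Rightarrow> bool" where
  "orthonormal_basis B \<longleftrightarrow> pairwise orthogonal B \<and> (\<forall>b\<in>B. norm b = 1) \<and> span B = UNIV"

text \<open>Besides the surface measures of facets, \<open>T\<close> will also be an orthonormal basis of the whole space, or
  of the complement of a direction along which Fubini is applied.\<close>

definition flat_measure :: "'a::euclidean_space \<Rightarrow> 'a set \<Rightarrow> 'a measure" where
  "flat_measure a T = distr (\<Pi>\<^sub>M t\<in>T. lborel) borel (\<lambda>y. a + (\<Sum>t\<in>T. y t *\<^sub>R t))"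

lemma orthonormal_independent:
  fixes B :: "'a::euclidean_space set"
  assumes "pairwise orthogonal B" "\<forall>b\<in>B. norm b = 1"
  shows "independent B" "finite B"
proof -
  show "independent B" using assms
    by (intro pairwise_orthogonal_independent) auto
  then show "finite B" by (rule independent_imp_finite)
qed

lemma orthonormal_inner:
  assumes "pairwise orthogonal B" "\<forall>b\<in>B. norm b = 1" "b \<in> B" "c \<in> B"
  shows "b \<bullet> c = (if b = c then 1 else 0)"
  using assms by (auto simp: pairwise_def orthogonal_def norm_eq_1)

interpretation lborel_product: product_sigma_finite "\<lambda>_::'i. lborel :: real measure"
  by (simp add: product_sigma_finite_def lborel.sigma_finite_measure_axioms)

lemma measurable_frame[measurable]:
  "(\<lambda>y. a + (\<Sum>t\<in>T. y t *\<^sub>R t)) \<in> borel_measurable (\<Pi>\<^sub>M t\<in>T. lborel)"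
  for a :: "'a::euclidean_space"
proof -
  have "(\<lambda>y. \<Sum>t\<in>T. y t *\<^sub>R t) \<in> borel_measurable (\<Pi>\<^sub>M t\<in>T. lborel)"
    by (intro borel_measurable_sum borel_measurable_scaleR) simp_all
  then show ?thesis by simp
qed

lemma sets_flat_measure[simp, measurable_cong]: "sets (flat_measure a T) = sets borel"
  by (simp add: flat_measure_def)

lemma space_flat_measure[simp]: "space (flat_measure a T) = UNIV"
  by (simp add: flat_measure_def)

text \<open>An orthogonal map takes the standard basis to \<open>B\<close>, and the product measure does not change when
  its factors are relabelled.\<close>

lemma lborel_eq_flat_measure:
  fixes B :: "'a::euclidean_space set"
  assumes B: "orthonormal_basis B"
  shows "flat_measure a B = lborel"
proof -
  have on: "pairwise orthogonal B" "\<forall>b\<in>B. norm b = 1" "span B = UNIV"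
    using B by (auto simp: orthonormal_basis_def)
  note ind = orthonormal_independent[OF on(1,2)]
  have "card B = card (Basis::'a set)"
    using dim_span_eq_card_independent[OF ind(1)] on(3) by simp
  then obtain \<sigma> where \<sigma>: "bij_betw \<sigma> (Basis::'a set) B"
    using finite_same_card_bij[OF finite_Basis ind(2)] by metis
  define U where "U x = (\<Sum>e\<in>Basis. (x \<bullet> e) *\<^sub>R \<sigma> e)" for x :: 'a
  have \<sigma>B: "\<sigma> e \<in> B" if "e \<in> Basis" for e using \<sigma> that by (auto simp: bij_betw_def)
  have inn: "\<sigma> e \<bullet> \<sigma> e' = (if e = e' then 1 else 0)" if "e \<in> Basis" "e' \<in> Basis" for e e'
    using orthonormal_inner[OF on(1,2) \<sigma>B \<sigma>B] that \<sigma> by (auto simp: bij_betw_def inj_on_def)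
  have lU: "linear U"
    unfolding U_def by (intro linearI) (simp_all add: inner_add_left scaleR_add_left sum.distrib scaleR_sum_right)
  have "U v \<bullet> U w = v \<bullet> w" for v w
  proof -
    have "U v \<bullet> U w = (\<Sum>e\<in>Basis. \<Sum>e'\<in>Basis. (v \<bullet> e) * ((w \<bullet> e') * (if e = e' then 1 else 0)))"
      unfolding U_def inner_sum_left inner_sum_right by (intro sum.cong refl) (simp add: inn)
    also have "\<dots> = (\<Sum>e\<in>Basis. (v \<bullet> e) * (w \<bullet> e))"
      by (intro sum.cong refl) (simp add: sum_distrib_left[symmetric] if_distrib[where f="(*) _"] sum.delta' cong: if_cong)
    finally show ?thesis by (simp add: euclidean_inner[of v w])
  qed
  then have U: "orthogonal_transformation U"
    using lU by (simp add: orthogonal_transformation_def)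
  have Ub: "U e = \<sigma> e" if "e \<in> Basis" for e
    unfolding U_def using that by (simp add: inner_Basis if_distrib[where f="\<lambda>r. r *\<^sub>R _"] sum.delta cong: if_cong)
  have [measurable]: "U \<in> borel_measurable borel"
    using lU by (intro borel_measurable_continuous_onI linear_continuous_on) (simp add: linear_conv_bounded_linear)
  let ?r = "\<lambda>f::'a\<Rightarrow>real. \<lambda>e\<in>Basis. f (\<sigma> e)"
  have r[measurable]: "?r \<in> measurable (\<Pi>\<^sub>M t\<in>B. lborel) (\<Pi>\<^sub>M t\<in>Basis. lborel)"
    by (intro measurable_restrict measurable_component_singleton \<sigma>B)
  have "distr (\<Pi>\<^sub>M t\<in>B. lborel) (\<Pi>\<^sub>M t\<in>Basis. lborel) ?r = (\<Pi>\<^sub>M t\<in>(Basis::'a set). (lborel :: real measure))"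
  proof (rule lborel_product.PiM_eqI)
    fix A :: "'a \<Rightarrow> real set" assume A: "\<And>i. i \<in> Basis \<Longrightarrow> A i \<in> sets lborel"
    let ?\<tau> = "inv_into Basis \<sigma>"
    have \<tau>: "?\<tau> b \<in> Basis" "\<sigma> (?\<tau> b) = b" if "b \<in> B" for b
      using \<sigma> that by (auto simp: bij_betw_def inv_into_into f_inv_into_f)
    have \<tau>\<sigma>: "?\<tau> (\<sigma> e) = e" if "e \<in> Basis" for e using \<sigma> that by (simp add: bij_betw_def)
    have "?r -` (Pi\<^sub>E Basis A) \<inter> space (\<Pi>\<^sub>M t\<in>B. lborel) = (Pi\<^sub>E B (\<lambda>b. A (?\<tau> b)))"
    proof (intro set_eqI iffI)
      fix f assume "f \<in> ?r -` (Pi\<^sub>E Basis A) \<inter> space (\<Pi>\<^sub>M t\<in>B. lborel)"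
      then show "f \<in> (Pi\<^sub>E B (\<lambda>b. A (?\<tau> b)))"
        using \<tau> by (auto simp: space_PiM PiE_iff) (metis)
    next
      fix f assume "f \<in> (Pi\<^sub>E B (\<lambda>b. A (?\<tau> b)))"
      then show "f \<in> ?r -` (Pi\<^sub>E Basis A) \<inter> space (\<Pi>\<^sub>M t\<in>B. lborel)"
        using \<tau>\<sigma> \<sigma>B by (auto simp: space_PiM PiE_iff) (metis)
    qed
    then have "emeasure (distr (\<Pi>\<^sub>M t\<in>B. lborel) (\<Pi>\<^sub>M t\<in>Basis. lborel) ?r) (Pi\<^sub>E Basis A)
       = emeasure (\<Pi>\<^sub>M t\<in>B. lborel) (Pi\<^sub>E B (\<lambda>b. A (?\<tau> b)))"
      by (subst emeasure_distr) (auto intro!: sets_PiM_I_finite A)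
    also have "\<dots> = (\<Prod>b\<in>B. emeasure lborel (A (?\<tau> b)))"
      using A \<tau> ind(2) by (intro lborel_product.emeasure_PiM) auto
    also have "\<dots> = (\<Prod>e\<in>Basis. emeasure lborel (A e))"
      by (subst prod.reindex_bij_betw[OF \<sigma>, symmetric]) (simp add: \<tau>\<sigma>)
    finally show "emeasure (distr (\<Pi>\<^sub>M t\<in>B. lborel) (\<Pi>\<^sub>M t\<in>Basis. lborel) ?r) (Pi\<^sub>E Basis A) = (\<Prod>e\<in>Basis. emeasure lborel (A e))" .
  qed simp_all
  then have "distr lborel borel U = distr (distr (\<Pi>\<^sub>M t\<in>B. lborel) (\<Pi>\<^sub>M t\<in>Basis. lborel) ?r) borel (\<lambda>f. U (\<Sum>b\<in>Basis. f b *\<^sub>R b))"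
    by (subst lborel_eq) (simp add: distr_distr comp_def)
  also have "\<dots> = distr (\<Pi>\<^sub>M t\<in>B. lborel) borel (\<lambda>f. \<Sum>e\<in>Basis. f (\<sigma> e) *\<^sub>R \<sigma> e)"
    by (simp add: distr_distr comp_def linear_sum[OF lU] linear_scale[OF lU] Ub)
  also have "\<dots> = distr (\<Pi>\<^sub>M t\<in>B. lborel) borel (\<lambda>f. \<Sum>b\<in>B. f b *\<^sub>R b)"
    by (simp add: sum.reindex_bij_betw[OF \<sigma>, of "\<lambda>b. _ b *\<^sub>R b"])
  finally have e: "lborel = distr (\<Pi>\<^sub>M t\<in>B. lborel) borel (\<lambda>f. \<Sum>b\<in>B. f b *\<^sub>R b)"
    by (simp add: lborel_orthogonal_invariant[OF U])
  have "flat_measure a B = distr (distr (\<Pi>\<^sub>M t\<in>B. lborel) borel (\<lambda>f. \<Sum>b\<in>B. f b *\<^sub>R b)) borel ((+) a)"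
    using measurable_frame[of 0 B] by (simp add: flat_measure_def distr_distr comp_def)
  also have "\<dots> = lborel"
    unfolding e[symmetric] by (rule lborel_distr_plus)
  finally show ?thesis .
qed

lemma nn_integral_flat_measure_insert:
  fixes T :: "'a::euclidean_space set"
  assumes T: "finite T" "t \<notin> T" and [measurable]: "g \<in> borel_measurable borel"
  shows "(\<integral>\<^sup>+x. g x \<partial>flat_measure a (insert t T)) = (\<integral>\<^sup>+z. (\<integral>\<^sup>+s. g (z + s *\<^sub>R t) \<partial>lborel) \<partial>flat_measure a T)"
proof -
  have s: "(\<Sum>b\<in>T. (y(t := s)) b *\<^sub>R b) = (\<Sum>b\<in>T. y b *\<^sub>R b)" for y :: "'a \<Rightarrow> real" and s
    using T by (intro sum.cong) auto
  have "(\<integral>\<^sup>+x. g x \<partial>flat_measure a (insert t T)) = (\<integral>\<^sup>+y. (\<integral>\<^sup>+s. g (a + (\<Sum>b\<in>insert t T. (y(t := s)) b *\<^sub>R b)) \<partial>lborel) \<partial>(\<Pi>\<^sub>M t\<in>T. lborel))"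
    unfolding flat_measure_def using T
    by (subst nn_integral_distr) (simp_all add: lborel_product.product_nn_integral_insert del: sum.insert)
  also have "\<dots> = (\<integral>\<^sup>+y. (\<integral>\<^sup>+s. g (a + (\<Sum>b\<in>T. y b *\<^sub>R b) + s *\<^sub>R t) \<partial>lborel) \<partial>(\<Pi>\<^sub>M t\<in>T. lborel))"
    using T by (simp add: s fun_upd_same algebra_simps del: fun_upd_apply)
  also have "\<dots> = (\<integral>\<^sup>+z. (\<integral>\<^sup>+s. g (z + s *\<^sub>R t) \<partial>lborel) \<partial>flat_measure a T)"
    unfolding flat_measure_def by (subst nn_integral_distr) simp_all
  finally show ?thesis .
qed

lemma nn_integral_flat_measure_insert_rev:
  fixes T :: "'a::euclidean_space set"
  assumes T: "finite T" "t \<notin> T" and [measurable]: "g \<in> borel_measurable borel"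
  shows "(\<integral>\<^sup>+x. g x \<partial>flat_measure a (insert t T)) = (\<integral>\<^sup>+s. (\<integral>\<^sup>+z. g (z + s *\<^sub>R t) \<partial>flat_measure a T) \<partial>lborel)"
proof -
  have s: "(\<Sum>b\<in>T. (y(t := s)) b *\<^sub>R b) = (\<Sum>b\<in>T. y b *\<^sub>R b)" for y :: "'a \<Rightarrow> real" and s
    using T by (intro sum.cong) auto
  have "(\<integral>\<^sup>+x. g x \<partial>flat_measure a (insert t T)) = (\<integral>\<^sup>+s. (\<integral>\<^sup>+y. g (a + (\<Sum>b\<in>insert t T. (y(t := s)) b *\<^sub>R b)) \<partial>(\<Pi>\<^sub>M t\<in>T. lborel)) \<partial>lborel)"
    unfolding flat_measure_def using T
    by (subst nn_integral_distr) (simp_all add: lborel_product.product_nn_integral_insert_rev del: sum.insert)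
  also have "\<dots> = (\<integral>\<^sup>+s. (\<integral>\<^sup>+y. g (a + (\<Sum>b\<in>T. y b *\<^sub>R b) + s *\<^sub>R t) \<partial>(\<Pi>\<^sub>M t\<in>T. lborel)) \<partial>lborel)"
    using T by (simp add: s fun_upd_same algebra_simps del: fun_upd_apply)
  also have "\<dots> = (\<integral>\<^sup>+s. (\<integral>\<^sup>+z. g (z + s *\<^sub>R t) \<partial>flat_measure a T) \<partial>lborel)"
    unfolding flat_measure_def by (subst nn_integral_distr) simp_all
  finally show ?thesis .
qed

lemma integral_flat_measure_insert:
  fixes T :: "'a::euclidean_space set" and g :: "'a \<Rightarrow> real"
  assumes T: "finite T" "t \<notin> T" and g: "integrable (flat_measure a (insert t T)) g"
  shows "(\<integral>x. g x \<partial>flat_measure a (insert t T)) = (\<integral>z. (\<integral>s. g (z + s *\<^sub>R t) \<partial>lborel) \<partial>flat_measure a T)"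
proof -
  have [measurable]: "g \<in> borel_measurable borel" using g by (auto dest: borel_measurable_integrable)
  have s: "(\<Sum>b\<in>T. (y(t := s)) b *\<^sub>R b) = (\<Sum>b\<in>T. y b *\<^sub>R b)" for y :: "'a \<Rightarrow> real" and s
    using T by (intro sum.cong) auto
  have i: "integrable (\<Pi>\<^sub>M t\<in>insert t T. lborel) (\<lambda>y. g (a + (\<Sum>b\<in>insert t T. y b *\<^sub>R b)))"
    using g unfolding flat_measure_def by (subst (asm) integrable_distr_eq) auto
  have "(\<integral>x. g x \<partial>flat_measure a (insert t T)) = (\<integral>y. (\<integral>s. g (a + (\<Sum>b\<in>insert t T. (y(t := s)) b *\<^sub>R b)) \<partial>lborel) \<partial>(\<Pi>\<^sub>M t\<in>T. lborel))"
    unfolding flat_measure_def using T i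
    by (subst integral_distr) (simp_all add: lborel_product.product_integral_insert del: sum.insert)
  also have "\<dots> = (\<integral>y. (\<integral>s. g (a + (\<Sum>b\<in>T. y b *\<^sub>R b) + s *\<^sub>R t) \<partial>lborel) \<partial>(\<Pi>\<^sub>M t\<in>T. lborel))"
    using T by (simp add: s fun_upd_same algebra_simps del: fun_upd_apply)
  also have "\<dots> = (\<integral>z. (\<integral>s. g (z + s *\<^sub>R t) \<partial>lborel) \<partial>flat_measure a T)"
    unfolding flat_measure_def by (subst integral_distr) simp_all
  finally show ?thesis .
qed

lemma AE_flat_measure_normal:
  fixes T :: "'a::euclidean_space set"
  assumes "\<And>t. t \<in> T \<Longrightarrow> t \<bullet> n = 0"
  shows "AE z in flat_measure a T. (z - a) \<bullet> n = 0"
  unfolding flat_measure_def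
  using assms by (subst AE_distr_iff) (auto simp: inner_sum_left)

lemma emeasure_flat_measure_bounded:
  fixes T :: "'a::euclidean_space set"
  assumes on: "pairwise orthogonal T" "\<forall>b\<in>T. norm b = 1"
    and S: "bounded S" "S \<in> sets borel"
  shows "emeasure (flat_measure a T) S < \<infinity>"
proof -
  note fin = orthonormal_independent(2)[OF on]
  obtain R where R: "\<And>x. x \<in> S \<Longrightarrow> norm (x - a) \<le> R"
    using S(1) bounded_any_center[of S a] by (auto simp: dist_norm norm_minus_commute)
  let ?f = "\<lambda>y. a + (\<Sum>t\<in>T. y t *\<^sub>R t)"
  have "y t \<in> {-R..R}" if "?f y \<in> S" "t \<in> T" for y t
  proof -
    have "(?f y - a) \<bullet> t = (\<Sum>b\<in>T. y b * (if b = t then 1 else 0))"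
      using orthonormal_inner[OF on] that(2) by (simp add: inner_sum_left)
    also have "\<dots> = y t" using fin that(2) by (simp add: if_distrib[where f="(*) _"] sum.delta cong: if_cong)
    finally have "\<bar>y t\<bar> \<le> norm (?f y - a) * norm t"
      by (metis Cauchy_Schwarz_ineq2)
    then show ?thesis using on(2) that R[OF that(1)] by auto
  qed
  then have "?f -` S \<inter> space (\<Pi>\<^sub>M t\<in>T. lborel) \<subseteq> (Pi\<^sub>E T (\<lambda>_. {-R..R}))"
    by (auto simp: space_PiM PiE_iff)
  then have "emeasure (flat_measure a T) S \<le> emeasure (\<Pi>\<^sub>M t\<in>T. lborel) (Pi\<^sub>E T (\<lambda>_. {-R..R}))"
    unfolding flat_measure_def using S(2) fin
    by (subst emeasure_distr) (auto intro!: emeasure_mono sets_PiM_I_finite)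
  also have "\<dots> = (\<Prod>t\<in>T. emeasure lborel {-R..R})"
    using fin by (intro lborel_product.emeasure_PiM) auto
  also have "\<dots> < \<infinity>"
    by (simp add: less_top[symmetric] emeasure_lborel_Icc_eq power_eq_top_ennreal del: emeasure_lborel_Icc)
  finally show ?thesis .
qed

lemma integrable_flat_measure_bounded:
  fixes T :: "'a::euclidean_space set" and f :: "'a \<Rightarrow> real"
  assumes on: "pairwise orthogonal T" "\<forall>b\<in>T. norm b = 1"
    and S: "bounded S" "S \<in> sets borel" and [measurable]: "f \<in> borel_measurable borel" and B: "\<And>x. x \<in> S \<Longrightarrow> \<bar>f x\<bar> \<le> C"
  shows "integrable (flat_measure a T) (\<lambda>x. indicator S x * f x)"
proof (rule Bochner_Integration.integrable_bound)
  have [measurable]: "S \<in> sets borel" by fact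
  show "integrable (flat_measure a T) (\<lambda>x. C * indicator S x)"
    using emeasure_flat_measure_bounded[OF on S] S(2) by (intro integrable_mult_right) (simp add: less_top)
  show "(\<lambda>x. indicator S x * f x) \<in> borel_measurable (flat_measure a T)"
    by (simp add: measurable_cong_sets[OF sets_flat_measure refl])
  show "AE x in flat_measure a T. norm (indicator S x * f x) \<le> norm (C * indicator S x)"
    using B by (auto intro!: always_eventually simp: indicator_def) (smt (verit))
qed

text \<open>Translation invariance is inherited from Lebesgue measure on the whole space, by thickening the
  hyperplane to a slab of width one.\<close>

lemma nn_integral_flat_measure_shift:
  fixes T :: "'a::euclidean_space set"
  assumes B: "orthonormal_basis (insert n T)" "n \<notin> T" and c: "c \<bullet> n = 0"
    and [measurable]: "g \<in> borel_measurable borel"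
  shows "(\<integral>\<^sup>+z. g (z + c) \<partial>flat_measure a T) = (\<integral>\<^sup>+z. g z \<partial>flat_measure a T)"
proof -
  have on: "pairwise orthogonal (insert n T)" "\<forall>b\<in>insert n T. norm b = 1"
    using B by (auto simp: orthonormal_basis_def)
  have fin: "finite T" using orthonormal_independent(2)[OF on] by simp
  have nT: "t \<bullet> n = 0" if "t \<in> T" for t using orthonormal_inner[OF on, of t n] that B(2) by auto
  have nn: "n \<bullet> n = 1" using on(2) by (simp add: norm_eq_1)
  have AE: "AE z in flat_measure a T. (z - a) \<bullet> n = 0" by (rule AE_flat_measure_normal) (rule nT)
  \<comment> \<open>\<open>H\<close> extends \<open>g\<close> constantly along the normal, over a slab of width one.\<close>
  define H where "H x = g (x - ((x - a) \<bullet> n) *\<^sub>R n) * indicator {0..1::real} ((x - a) \<bullet> n)" for x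
  have [measurable]: "H \<in> borel_measurable borel" unfolding H_def by measurable
  have key: "(\<integral>\<^sup>+x. H (x + c) \<partial>lborel) = (\<integral>\<^sup>+z. g (z + c) \<partial>flat_measure a T)" if c: "c \<bullet> n = 0" for c
  proof -
    have "(\<integral>\<^sup>+x. H (x + c) \<partial>lborel) = (\<integral>\<^sup>+z. (\<integral>\<^sup>+s. H (z + s *\<^sub>R n + c) \<partial>lborel) \<partial>flat_measure a T)"
      unfolding lborel_eq_flat_measure[OF B(1), of a, symmetric]
      using fin B(2) by (intro nn_integral_flat_measure_insert) auto
    also have "\<dots> = (\<integral>\<^sup>+z. g (z + c) \<partial>flat_measure a T)"
    proof (rule nn_integral_cong_AE)
      show "AE z in flat_measure a T. (\<integral>\<^sup>+s. H (z + s *\<^sub>R n + c) \<partial>lborel) = g (z + c)"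
        using AE
      proof eventually_elim
        case (elim z)
        have "(z + s *\<^sub>R n + c - a) \<bullet> n = s" for s
          using elim c nn by (simp add: inner_diff_left inner_add_left)
        then have "H (z + s *\<^sub>R n + c) = g (z + c) * indicator {0..1} s" for s
          unfolding H_def by (simp add: algebra_simps)
        then show ?case by (simp add: nn_integral_cmult_indicator)
      qed
    qed
    finally show ?thesis .
  qed
  show ?thesis
    using key[OF c] key[of 0] nn_integral_lborel_shift[of H c] by simp
qed

section \<open>Projection onto a hyperplane along a direction\<close>

text \<open>Projection along \<open>u\<close> onto the hyperplane through \<open>a\<close> with normal \<open>n\<close>.\<close>

definition oblique_projection :: "'a::euclidean_space \<Rightarrow> 'a \<Rightarrow> 'a \<Rightarrow> 'a \<Rightarrow> 'a" where
  "oblique_projection a n u x = x - (((x - a) \<bullet> n) / (u \<bullet> n)) *\<^sub>R u"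

lemma measurable_oblique_projection[measurable]: "oblique_projection a n u \<in> borel_measurable borel"
  unfolding oblique_projection_def by measurable

text \<open>Both sides compute the integral of \<open>g \<circ> \<pi>\<close>, for the projection \<open>\<pi>\<close>, over the slab between the hyperplane
  and its translate by \<open>u\<close>: once by slicing along \<open>u\<close>, where each slice has length one, and once along
  the normal \<open>n\<close>, where the thickness of the slab is \<open>\<bar>u \<bullet> n\<bar>\<close>.  This replaces a Jacobian.\<close>

lemma nn_integral_oblique_projection:
  fixes T :: "'a::euclidean_space set"
  assumes B: "orthonormal_basis (insert n T)" "n \<notin> T"
    and B': "orthonormal_basis (insert u T')" "u \<notin> T'" and un: "u \<bullet> n \<noteq> 0"
    and [measurable]: "g \<in> borel_measurable borel"
  shows "(\<integral>\<^sup>+z. g (oblique_projection a n u z) \<partial>flat_measure a' T') = ennreal \<bar>u \<bullet> n\<bar> * (\<integral>\<^sup>+z. g z \<partial>flat_measure a T)"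
proof -
  let ?\<pi> = "oblique_projection a n u"
  have on: "pairwise orthogonal (insert n T)" "\<forall>b\<in>insert n T. norm b = 1"
    using B by (auto simp: orthonormal_basis_def)
  have fin: "finite T" using orthonormal_independent(2)[OF on] by simp
  have on': "pairwise orthogonal (insert u T')" "\<forall>b\<in>insert u T'. norm b = 1"
    using B' by (auto simp: orthonormal_basis_def)
  have fin': "finite T'" using orthonormal_independent(2)[OF on'] by simp
  have nT: "t \<bullet> n = 0" if "t \<in> T" for t using orthonormal_inner[OF on, of t n] that B(2) by auto
  have nn: "n \<bullet> n = 1" using on(2) by (simp add: norm_eq_1)
  have AE: "AE z in flat_measure a T. (z - a) \<bullet> n = 0" by (rule AE_flat_measure_normal) (rule nT)
  define h where "h x = ((x - a) \<bullet> n) / (u \<bullet> n)" for x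
  define G where "G x = g (?\<pi> x) * indicator {0..1} (h x)" for x
  have [measurable]: "h \<in> borel_measurable borel" unfolding h_def by measurable
  have [measurable]: "G \<in> borel_measurable borel" unfolding G_def by measurable
  have unit: "(\<integral>\<^sup>+s. indicator {0..1} (c + s) \<partial>lborel) = (1::ennreal)" for c :: real
    using nn_integral_lborel_shift[of "indicator {0..1}" c] by (simp add: add.commute)
  have len: "(\<integral>\<^sup>+s. indicator {0..1} (s / (u \<bullet> n)) \<partial>lborel) = ennreal \<bar>u \<bullet> n\<bar>"
    using un by (subst nn_integral_real_affine[of _ "u \<bullet> n" 0]) simp_all
  have "(\<integral>\<^sup>+x. G x \<partial>lborel) = (\<integral>\<^sup>+z. (\<integral>\<^sup>+s. G (z + s *\<^sub>R u) \<partial>lborel) \<partial>flat_measure a' T')"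
    unfolding lborel_eq_flat_measure[OF B'(1), of a', symmetric]
    using fin' B'(2) by (intro nn_integral_flat_measure_insert) auto
  also have "\<dots> = (\<integral>\<^sup>+z. g (?\<pi> z) \<partial>flat_measure a' T')"
  proof (rule nn_integral_cong)
    fix z
    have hs: "h (z + s *\<^sub>R u) = h z + s" for s
      using un by (simp add: h_def inner_diff_left inner_add_left field_simps)
    then have "?\<pi> (z + s *\<^sub>R u) = ?\<pi> z" for s
      unfolding oblique_projection_def h_def[symmetric] by (simp add: algebra_simps)
    then have "(\<integral>\<^sup>+s. G (z + s *\<^sub>R u) \<partial>lborel) = g (?\<pi> z) * (\<integral>\<^sup>+s. indicator {0..1} (h z + s) \<partial>lborel)"
      unfolding G_def hs by (simp add: nn_integral_cmult)
    then show "(\<integral>\<^sup>+s. G (z + s *\<^sub>R u) \<partial>lborel) = g (?\<pi> z)" by (simp add: unit)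
  qed
  finally have 1: "(\<integral>\<^sup>+x. G x \<partial>lborel) = (\<integral>\<^sup>+z. g (?\<pi> z) \<partial>flat_measure a' T')" .
  have "(\<integral>\<^sup>+x. G x \<partial>lborel) = (\<integral>\<^sup>+s. (\<integral>\<^sup>+z. G (z + s *\<^sub>R n) \<partial>flat_measure a T) \<partial>lborel)"
    unfolding lborel_eq_flat_measure[OF B(1), of a, symmetric]
    unfolding lborel_eq_flat_measure[OF B(1), of a]
    using fin B(2) nn_integral_flat_measure_insert_rev[of T n G a] lborel_eq_flat_measure[OF B(1), of a] by simp
  also have "\<dots> = (\<integral>\<^sup>+s. (\<integral>\<^sup>+z. g z \<partial>flat_measure a T) * indicator {0..1} (s / (u \<bullet> n)) \<partial>lborel)"
  proof (rule nn_integral_cong)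
    fix s
    define c where "c = s *\<^sub>R n - (s / (u \<bullet> n)) *\<^sub>R u"
    have c: "c \<bullet> n = 0" using un nn by (simp add: c_def inner_diff_left)
    have "(\<integral>\<^sup>+z. G (z + s *\<^sub>R n) \<partial>flat_measure a T) = (\<integral>\<^sup>+z. g (z + c) * indicator {0..1} (s / (u \<bullet> n)) \<partial>flat_measure a T)"
    proof (rule nn_integral_cong_AE)
      show "AE z in flat_measure a T. G (z + s *\<^sub>R n) = g (z + c) * indicator {0..1} (s / (u \<bullet> n))"
        using AE
      proof eventually_elim
        case (elim z)
        have "(z + s *\<^sub>R n - a) \<bullet> n = s" using elim nn by (simp add: inner_diff_left inner_add_left)
        then show ?case by (simp add: G_def oblique_projection_def h_def c_def algebra_simps)
      qed
    qed
    also have "\<dots> = (\<integral>\<^sup>+z. g z \<partial>flat_measure a T) * indicator {0..1} (s / (u \<bullet> n))"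
      using nn_integral_flat_measure_shift[OF B c, of g a]
      by (simp add: nn_integral_multc measurable_cong_sets[OF sets_flat_measure refl])
    finally show "(\<integral>\<^sup>+z. G (z + s *\<^sub>R n) \<partial>flat_measure a T) = (\<integral>\<^sup>+z. g z \<partial>flat_measure a T) * indicator {0..1} (s / (u \<bullet> n))" .
  qed
  also have "\<dots> = (\<integral>\<^sup>+z. g z \<partial>flat_measure a T) * ennreal \<bar>u \<bullet> n\<bar>"
    by (simp add: nn_integral_cmult len)
  finally show ?thesis using 1 by (simp add: mult.commute)
qed

lemma
  fixes T :: "'a::euclidean_space set" and g :: "'a \<Rightarrow> real"
  assumes B: "orthonormal_basis (insert n T)" "n \<notin> T"
    and B': "orthonormal_basis (insert u T')" "u \<notin> T'" and un: "u \<bullet> n \<noteq> 0"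
    and g[measurable]: "g \<in> borel_measurable borel"
  shows integral_oblique_projection:
      "(\<integral>z. g (oblique_projection a n u z) \<partial>flat_measure a' T') = \<bar>u \<bullet> n\<bar> * (\<integral>z. g z \<partial>flat_measure a T)"
    and integrable_oblique_projection:
      "integrable (flat_measure a T) g \<Longrightarrow> integrable (flat_measure a' T') (\<lambda>z. g (oblique_projection a n u z))"
proof -
  let ?\<pi> = "oblique_projection a n u"
  have pm[measurable]: "?\<pi> \<in> measurable (flat_measure a' T') borel"
    by (simp add: measurable_cong_sets[OF sets_flat_measure refl])
  have e: "distr (flat_measure a' T') borel ?\<pi> = density (flat_measure a T) (\<lambda>_. ennreal \<bar>u \<bullet> n\<bar>)"
  proof (rule measure_eqI)
    fix A assume "A \<in> sets (distr (flat_measure a' T') borel ?\<pi>)"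
    then have A[measurable]: "A \<in> sets borel" by simp
    have "emeasure (distr (flat_measure a' T') borel ?\<pi>) A = (\<integral>\<^sup>+z. indicator A z \<partial>distr (flat_measure a' T') borel ?\<pi>)"
      by simp
    also have "\<dots> = (\<integral>\<^sup>+z. indicator A (?\<pi> z) \<partial>flat_measure a' T')"
      by (intro nn_integral_distr pm) simp
    also have "\<dots> = emeasure (density (flat_measure a T) (\<lambda>_. ennreal \<bar>u \<bullet> n\<bar>)) A"
      by (simp add: nn_integral_oblique_projection[OF B B' un] emeasure_density nn_integral_cmult)
    finally show "emeasure (distr (flat_measure a' T') borel ?\<pi>) A = emeasure (density (flat_measure a T) (\<lambda>_. ennreal \<bar>u \<bullet> n\<bar>)) A" .
  qed simp
  have gm[measurable]: "g \<in> borel_measurable (flat_measure a T)"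
    by (simp add: measurable_cong_sets[OF sets_flat_measure refl])
  show "(\<integral>z. g (?\<pi> z) \<partial>flat_measure a' T') = \<bar>u \<bullet> n\<bar> * (\<integral>z. g z \<partial>flat_measure a T)"
    using integral_distr[OF pm g] by (simp add: e integral_density)
  assume "integrable (flat_measure a T) g"
  then have "integrable (distr (flat_measure a' T') borel ?\<pi>) g"
    by (simp add: e integrable_density)
  then show "integrable (flat_measure a' T') (\<lambda>z. g (?\<pi> z))"
    using integrable_distr_eq[OF pm g] by simp
qed

section \<open>Barycentric coordinates of a full-dimensional simplex\<close>

text \<open>The function \<open>l c\<close> is the barycentric coordinate that belongs to the vertex \<open>c\<close>, and \<open>d c\<close> is its constant
  gradient.\<close>

locale barycentric =
  fixes C :: "(real^'n) set" and l :: "real^'n \<Rightarrow> real^'n \<Rightarrow> real" and d :: "real^'n \<Rightarrow> real^'n"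
  assumes fin: "finite C" and two: "2 \<le> card C" and indep: "\<not> affine_dependent C"
    and l_add: "c \<in> C \<Longrightarrow> l c (x + y) = l c x + d c \<bullet> y"
    and l_vertex: "c \<in> C \<Longrightarrow> c' \<in> C \<Longrightarrow> l c c' = (if c = c' then 1 else 0)"
    and l_sum: "(\<Sum>c\<in>C. l c x) = 1"
    and l_repr: "(\<Sum>c\<in>C. l c x *\<^sub>R c) = x"

lemma barycentric_exists:
  fixes K :: "(real^'n) set"
  assumes "int CARD('n) simplex K"
  obtains C l d where "barycentric C l d" "K = convex hull C"
proof -
  obtain C where C: "\<not> affine_dependent C" "card C = CARD('n) + 1" "K = convex hull C"
    using assms by (auto simp: simplex_def)
  have fin: "finite C" by (rule aff_independent_finite[OF C(1)])
  have two: "2 \<le> card C" using C(2) by (simp add: Suc_leI)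
  obtain c0 where c0: "c0 \<in> C" using two by (cases "C = {}") auto
  \<comment> \<open>The differences to the vertex \<open>c0\<close> form a basis; its dual basis gives the gradients of the other coordinates.\<close>
  define S where "S = (\<lambda>c. c - c0) ` (C - {c0})"
  have indS: "independent S"
  proof -
    have "S = (\<lambda>x. - c0 + x) ` (C - {c0})" by (simp add: S_def)
    then show ?thesis using affine_dependent_iff_dependent2[OF c0] C(1) by metis
  qed
  have "card S = DIM(real^'n)"
    using C(2) c0 fin by (simp add: S_def card_image inj_on_def)
  then have spS: "span S = UNIV"
    using dim_eq_card_independent[OF indS] dim_eq_full[of S] by simp
  have "\<exists>g. linear g \<and> (\<forall>c'\<in>C - {c0}. g (c' - c0) = (if c = c' then 1 else (0::real)))" for c
  proof -
    obtain g where "linear g" "\<forall>v\<in>S. g v = (if v = c - c0 then 1 else (0::real))"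
      using linear_independent_extend[OF indS, of "\<lambda>v. if v = c - c0 then 1 else 0"] by auto
    then show ?thesis by (intro exI[of _ g]) (auto simp: S_def)
  qed
  then obtain g :: "real^'n \<Rightarrow> real^'n \<Rightarrow> real" where g: "\<And>c. linear (g c)"
    "\<And>c c'. c' \<in> C - {c0} \<Longrightarrow> g c (c' - c0) = (if c = c' then 1 else 0)"
    by metis
  define e where "e c = adjoint (g c) 1" for c
  have ge: "g c x = e c \<bullet> x" for c x
    using adjoint_works[OF g(1)[of c], of x 1] by (simp add: e_def inner_commute)
  define l where "l c x = (if c = c0 then 1 - (\<Sum>b\<in>C-{c0}. g b (x - c0)) else g c (x - c0))" for c x
  define d where "d c = (if c = c0 then - (\<Sum>b\<in>C-{c0}. e b) else e c)" for c
  have "barycentric C l d"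
  proof
    show "finite C" "2 \<le> card C" "\<not> affine_dependent C" by fact+
    show "l c (x + y) = l c x + d c \<bullet> y" for c x y
      by (simp add: l_def d_def ge inner_diff_right inner_add_right inner_sum_left sum.distrib sum_subtractf)
    show "l c c' = (if c = c' then 1 else 0)" if "c \<in> C" "c' \<in> C" for c c'
    proof (cases "c' = c0")
      case True
      then show ?thesis by (simp add: l_def ge)
    next
      case False
      then have "(\<Sum>b\<in>C-{c0}. g b (c' - c0)) = (\<Sum>b\<in>C-{c0}. if b = c' then 1 else 0)"
        using g(2)[of c'] that by (intro sum.cong) auto
      also have "\<dots> = 1" using False that fin by simp
      finally show ?thesis using False g(2)[of c'] that by (auto simp: l_def)
    qed
    show s: "(\<Sum>c\<in>C. l c x) = 1" for x
      using sum.remove[OF fin c0, of "\<lambda>c. l c x"] by (simp add: l_def)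
    have lin1: "linear (\<lambda>y. \<Sum>c\<in>C-{c0}. g c y *\<^sub>R (c - c0))"
      unfolding ge by (intro linearI) (simp_all add: inner_add_right scaleR_add_left sum.distrib scaleR_sum_right)
    have "(\<Sum>c\<in>C-{c0}. g c y *\<^sub>R (c - c0)) = y" if "y \<in> S" for y
    proof -
      obtain c' where c': "c' \<in> C - {c0}" "y = c' - c0" using \<open>y \<in> S\<close> by (auto simp: S_def)
      have "(\<Sum>c\<in>C-{c0}. g c y *\<^sub>R (c - c0)) = (\<Sum>c\<in>C-{c0}. if c = c' then c' - c0 else 0)"
        using g(2)[OF c'(1)] c'(2) by (intro sum.cong) auto
      then show ?thesis using c' fin by simp
    qed
    then have id: "(\<Sum>c\<in>C-{c0}. g c y *\<^sub>R (c - c0)) = y" for y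
      using linear_eq_on[OF lin1 linear_ident, of y S] spS by auto
    show "(\<Sum>c\<in>C. l c x *\<^sub>R c) = x" for x
    proof -
      have "(\<Sum>c\<in>C. l c x *\<^sub>R c) = (1 - (\<Sum>b\<in>C-{c0}. g b (x - c0))) *\<^sub>R c0 + (\<Sum>c\<in>C-{c0}. g c (x - c0) *\<^sub>R c)"
        using sum.remove[OF fin c0, of "\<lambda>c. l c x *\<^sub>R c"] by (simp add: l_def)
      also have "\<dots> = c0 + (\<Sum>c\<in>C-{c0}. g c (x - c0) *\<^sub>R (c - c0))"
        by (simp add: scaleR_diff_left scaleR_diff_right sum_subtractf scaleR_sum_left)
      finally show ?thesis by (simp add: id)
    qed
  qed
  then show thesis using that C(3) by blast
qed

lemma tangent_frame:
  fixes F :: "(real^'n) set"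
  shows "pairwise orthogonal (tangent_frame F)" "\<forall>t\<in>tangent_frame F. norm t = 1"
    "span (tangent_frame F) = span {x - y | x y. x \<in> F \<and> y \<in> F}"
  using someI_ex[OF orthonormal_frame_of_exists[of F], folded tangent_frame_def]
  unfolding orthonormal_frame_of_def by auto

lemma finite_tangent_frame: "finite (tangent_frame F)" for F :: "(real^'n) set"
  using orthonormal_independent(2)[OF tangent_frame(1,2)] .

context barycentric begin

abbreviation facet :: "real^'n \<Rightarrow> (real^'n) set" where
  "facet c \<equiv> {x \<in> convex hull C. l c x = 0}"

lemma l_diff: "c \<in> C \<Longrightarrow> l c y = l c x + d c \<bullet> (y - x)"
  using l_add[of c x "y - x"] by simp

lemma l_affine: "c \<in> C \<Longrightarrow> l c x = l c 0 + d c \<bullet> x"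
  using l_add[of c 0 x] by simp

lemma vector_repr: "(\<Sum>c\<in>C. (d c \<bullet> v) *\<^sub>R c) = v"
proof -
  have "(\<Sum>c\<in>C. (d c \<bullet> v) *\<^sub>R c) = (\<Sum>c\<in>C. l c v *\<^sub>R c) - (\<Sum>c\<in>C. l c 0 *\<^sub>R c)"
    unfolding sum_subtractf[symmetric] using l_affine[of _ v] by (intro sum.cong) (auto simp: algebra_simps)
  then show ?thesis by (simp add: l_repr)
qed

lemma d_sum: "(\<Sum>c\<in>C. d c \<bullet> v) = 0"
proof -
  have "(\<Sum>c\<in>C. d c \<bullet> v) = (\<Sum>c\<in>C. l c v) - (\<Sum>c\<in>C. l c 0)"
    unfolding sum_subtractf[symmetric] using l_affine[of _ v] by (intro sum.cong) (auto simp: algebra_simps)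
  then show ?thesis by (simp add: l_sum)
qed

lemma d_vertex_diff:
  assumes "c \<in> C" "a \<in> C" "b \<in> C"
  shows "d c \<bullet> (a - b) = (if c = a then 1 else 0) - (if c = b then 1 else 0)"
  using l_diff[OF assms(1), of a b] l_vertex[OF assms(1)] assms by simp

lemma other_vertex: "c \<in> C \<Longrightarrow> \<exists>b\<in>C. b \<noteq> c"
  using two fin by (metis card_le_Suc0_iff_eq not_less_eq_eq numeral_2_eq_2)

lemma d_nonzero: "c \<in> C \<Longrightarrow> d c \<noteq> 0"
  using other_vertex[of c] d_vertex_diff[of c c] by fastforce

lemma convex_hull_eq: "convex hull C = {x. \<forall>c\<in>C. 0 \<le> l c x}"
proof
  have "convex {x. \<forall>c\<in>C. 0 \<le> l c x}"
  proof -
    have "0 \<le> l c x \<longleftrightarrow> d c \<bullet> x \<ge> - l c 0" if "c \<in> C" for c x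
      using l_affine[OF that, of x] by linarith
    then have "{x. \<forall>c\<in>C. 0 \<le> l c x} = (\<Inter>c\<in>C. {x. d c \<bullet> x \<ge> - l c 0})"
      by auto
    then show ?thesis by (auto intro: convex_INT convex_halfspace_ge)
  qed
  then show "convex hull C \<subseteq> {x. \<forall>c\<in>C. 0 \<le> l c x}"
    by (intro hull_minimal) (auto simp: l_vertex)
  show "{x. \<forall>c\<in>C. 0 \<le> l c x} \<subseteq> convex hull C"
    using l_sum l_repr by (auto simp: convex_hull_finite[OF fin])
qed

lemma facet_eq:
  assumes c: "c \<in> C"
  shows "convex hull (C - {c}) = facet c"
proof
  have "convex {x. l c x = 0}"
  proof -
    have "l c x = 0 \<longleftrightarrow> d c \<bullet> x = - l c 0" for x
      using l_affine[OF c, of x] by linarith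
    then show ?thesis by (simp add: convex_hyperplane)
  qed
  then have "convex hull (C - {c}) \<subseteq> {x. l c x = 0}"
    by (intro hull_minimal) (auto simp: l_vertex c)
  then show "convex hull (C - {c}) \<subseteq> (facet c)"
    using hull_mono[of "C - {c}" C convex] by auto
  show "facet c \<subseteq> convex hull (C - {c})"
  proof
    fix x assume x: "x \<in> facet c"
    have "(\<Sum>b\<in>C-{c}. l b x) = 1" "(\<Sum>b\<in>C-{c}. l b x *\<^sub>R b) = x"
      using sum.remove[OF fin c, of "\<lambda>b. l b x"] sum.remove[OF fin c, of "\<lambda>b. l b x *\<^sub>R b"] x l_sum[of x] l_repr[of x] by auto
    then show "x \<in> convex hull (C - {c})"
      using x fin by (auto simp: convex_hull_finite convex_hull_eq)
  qed
qed

lemma facet_of_iff: "F facet_of convex hull C \<longleftrightarrow> (\<exists>c\<in>C. F = facet c)"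
  using facet_of_convex_hull_affine_independent_alt[OF indep, of F] two facet_eq by auto

lemma vertex_in_facet: "b \<in> C \<Longrightarrow> b \<noteq> c \<Longrightarrow> c \<in> C \<Longrightarrow> b \<in> facet c"
  by (auto simp: l_vertex hull_inc)

text \<open>The coefficients \<open>d a \<bullet> v\<close> express \<open>v\<close> through the vertices and sum to zero; if the one at \<open>c\<close>
  vanishes, only differences of vertices of the facet are left.\<close>

lemma orthogonal_to_facet:
  assumes c: "c \<in> C" and "d c \<bullet> v = 0"
  shows "v \<in> span {x - y | x y. x \<in> facet c \<and> y \<in> facet c}" (is "v \<in> span ?D")
proof -
  obtain b where b: "b \<in> C" "b \<noteq> c" using other_vertex[OF c] by auto
  have "v = (\<Sum>a\<in>C. (d a \<bullet> v) *\<^sub>R a) - (\<Sum>a\<in>C. d a \<bullet> v) *\<^sub>R b"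
    by (simp add: vector_repr d_sum)
  also have "\<dots> = (\<Sum>a\<in>C. (d a \<bullet> v) *\<^sub>R (a - b))"
    by (simp add: scaleR_diff_right sum_subtractf scaleR_sum_left)
  also have "\<dots> = (\<Sum>a\<in>C-{c}. (d a \<bullet> v) *\<^sub>R (a - b))"
    using sum.remove[OF fin c, of "\<lambda>a. (d a \<bullet> v) *\<^sub>R (a - b)"] assms(2) by simp
  also have "\<dots> \<in> span ?D"
    using vertex_in_facet[of _ c] b c by (intro span_sum span_scale span_base) blast
  finally show ?thesis .
qed

definition normal :: "real^'n \<Rightarrow> real^'n" where "normal c = - (d c /\<^sub>R norm (d c))"

lemma norm_normal: "c \<in> C \<Longrightarrow> norm (normal c) = 1"
  using d_nonzero[of c] by (simp add: normal_def)

lemma inner_normal: "v \<bullet> normal c = - (d c \<bullet> v) / norm (d c)"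
  by (simp add: normal_def inner_commute divide_inverse_commute)

text \<open>A vector orthogonal to the facet is a multiple of \<open>d c\<close>; its length and the side of the facet on which
  the simplex lies fix the factor.\<close>

lemma outward_normal_eq:
  assumes c: "c \<in> C" and F: "F = facet c"
  shows "outward_normal (convex hull C) F = normal c"
  unfolding outward_normal_def
proof (rule the_equality)
  have "(y - x) \<bullet> normal c = - (l c y - l c x) / norm (d c)" for x y
    using l_diff[OF c, of y x] by (simp add: inner_normal)
  then show "norm (normal c) = 1 \<and> (\<forall>x\<in>F. \<forall>y\<in>F. (y - x) \<bullet> normal c = 0) \<and> (\<forall>x\<in>F. \<forall>y\<in>convex hull C. (y - x) \<bullet> normal c \<le> 0)"
    using c by (auto simp: norm_normal F convex_hull_eq divide_nonpos_nonneg)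
next
  fix \<nu> assume \<nu>: "norm \<nu> = 1 \<and> (\<forall>x\<in>F. \<forall>y\<in>F. (y - x) \<bullet> \<nu> = 0) \<and> (\<forall>x\<in>F. \<forall>y\<in>convex hull C. (y - x) \<bullet> \<nu> \<le> 0)"
  obtain b where b: "b \<in> C" "b \<noteq> c" using other_vertex[OF c] by auto
  define m where "m = (c - b) \<bullet> \<nu>"
  have bF: "b \<in> F" using vertex_in_facet b c by (simp add: F)
  have aF: "(a - b) \<bullet> \<nu> = 0" if "a \<in> C" "a \<noteq> c" for a
    using \<nu> bF vertex_in_facet[OF that c] unfolding F by blast
  have "m \<le> 0" using \<nu> bF c unfolding m_def by (auto simp: hull_inc)
  have "v \<bullet> \<nu> = v \<bullet> (m *\<^sub>R d c)" for v
  proof -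
    have "v \<bullet> \<nu> = ((\<Sum>a\<in>C. (d a \<bullet> v) *\<^sub>R a) - (\<Sum>a\<in>C. d a \<bullet> v) *\<^sub>R b) \<bullet> \<nu>"
      by (simp add: vector_repr d_sum)
    also have "\<dots> = (\<Sum>a\<in>C. (d a \<bullet> v) * ((a - b) \<bullet> \<nu>))"
      by (simp add: inner_diff_left inner_sum_left right_diff_distrib sum_subtractf sum_distrib_right)
    also have "\<dots> = (d c \<bullet> v) * m + (\<Sum>a\<in>C-{c}. (d a \<bullet> v) * ((a - b) \<bullet> \<nu>))"
      unfolding m_def by (rule sum.remove[OF fin c])
    also have "\<dots> = (d c \<bullet> v) * m" using aF by simp
    finally show ?thesis by (simp add: inner_commute)
  qed
  then have \<nu>m: "\<nu> = m *\<^sub>R d c" by (metis vector_eq_ldot)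
  then have "\<bar>m\<bar> * norm (d c) = 1" using \<nu> by simp
  then have "m = - inverse (norm (d c))" using \<open>m \<le> 0\<close> d_nonzero[OF c] by (simp add: field_simps)
  then show "\<nu> = normal c" by (simp add: \<nu>m normal_def)
qed

lemma tangent_frame_normal:
  assumes c: "c \<in> C" and F: "F = facet c" and t: "t \<in> tangent_frame F"
  shows "d c \<bullet> t = 0" "t \<bullet> normal c = 0"
proof -
  have "t \<in> span {x - y | x y. x \<in> F \<and> y \<in> F}"
    using t tangent_frame(3)[of F] by (metis span_base)
  also have "\<dots> \<subseteq> {v. d c \<bullet> v = 0}"
  proof (rule span_minimal)
    show "subspace {v. d c \<bullet> v = 0}" by (rule subspace_hyperplane)
    show "{x - y | x y. x \<in> F \<and> y \<in> F} \<subseteq> {v. d c \<bullet> v = 0}"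
      using l_diff[OF c] by (auto simp: F) (metis add_0)
  qed
  finally show "d c \<bullet> t = 0" by simp
  then show "t \<bullet> normal c = 0" by (simp add: inner_normal)
qed

lemma orthonormal_basis_facet:
  assumes c: "c \<in> C" and F: "F = facet c"
  shows "orthonormal_basis (insert (normal c) (tangent_frame F))" "normal c \<notin> tangent_frame F"
proof -
  note n = tangent_frame_normal[OF c F]
  have nn: "normal c \<bullet> normal c = 1" using norm_normal[OF c] by (simp add: norm_eq_1)
  show "normal c \<notin> tangent_frame F" using n(2)[of "normal c"] nn by auto
  have "x \<in> span (insert (normal c) (tangent_frame F))" for x
  proof -
    define y where "y = x - (x \<bullet> normal c) *\<^sub>R normal c"
    have "y \<bullet> normal c = 0" by (simp add: y_def inner_diff_left nn)
    then have "d c \<bullet> y = 0" using d_nonzero[OF c] by (simp add: inner_normal)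
    then have "y \<in> span (tangent_frame F)" using orthogonal_to_facet[OF c] tangent_frame(3)[of F] F by simp
    then have "y \<in> span (insert (normal c) (tangent_frame F))"
      using span_mono[OF subset_insertI] by (rule subsetD[rotated])
    then have "(x \<bullet> normal c) *\<^sub>R normal c + y \<in> span (insert (normal c) (tangent_frame F))"
      by (rule span_add[OF span_scale[OF span_base[OF insertI1]]])
    then show ?thesis by (simp add: y_def)
  qed
  moreover have "pairwise orthogonal (insert (normal c) (tangent_frame F))"
    using tangent_frame(1)[of F] n(2) by (auto simp: pairwise_insert orthogonal_def inner_commute)
  ultimately show "orthonormal_basis (insert (normal c) (tangent_frame F))"
    using tangent_frame(2)[of F] norm_normal[OF c] by (auto simp: orthonormal_basis_def)
qed

end

section \<open>Directional derivatives and integration along lines\<close>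

lemma C_k_1D:
  fixes f :: "real^'n \<Rightarrow> real"
  assumes "C_k 1 f"
  shows has_derivative_dir_deriv: "(f has_derivative (\<lambda>t. dir_deriv t f x)) (at x)"
    and dir_deriv_linear: "linear (\<lambda>t. dir_deriv t f x)"
    and continuous_on_dir_deriv: "continuous_on UNIV (dir_deriv t f)"
    and continuous_on_C_k_1: "continuous_on UNIV f"
    and has_real_derivative_line: "((\<lambda>s. f (z + s *\<^sub>R t)) has_real_derivative dir_deriv t f (z + s *\<^sub>R t)) (at s)"
proof -
  have df: "f differentiable_on UNIV" and ci: "\<And>i. continuous_on UNIV (dir_deriv (axis i 1) f)"
    using assms by (auto simp: One_nat_def)
  have d: "(f has_derivative (\<lambda>t. dir_deriv t f x)) (at x)" for x
    using df frechet_derivative_works[of f "at x"]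
    by (simp add: differentiable_on_def dir_deriv_def[abs_def])
  then show "(f has_derivative (\<lambda>t. dir_deriv t f x)) (at x)" .
  have lin: "linear (\<lambda>t. dir_deriv t f x)" for x
    using d[of x] by (rule has_derivative_linear)
  then show "linear (\<lambda>t. dir_deriv t f x)" .
  show "continuous_on UNIV f"
    using df by (rule differentiable_imp_continuous_on)
  have "dir_deriv t f x = (\<Sum>i\<in>UNIV. t $ i * dir_deriv (axis i 1) f x)" for x
  proof -
    have "dir_deriv t f x = dir_deriv (\<Sum>i\<in>UNIV. t $ i *\<^sub>R axis i 1) f x"
      using basis_expansion[of t] by (simp only: scalar_mult_eq_scaleR)
    then show ?thesis by (simp add: linear_sum[OF lin] linear_scale[OF lin])
  qed
  then show "continuous_on UNIV (dir_deriv t f)"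
    using ci by (simp add: continuous_on_sum continuous_on_mult_left)
  have "((\<lambda>s. f (z + s *\<^sub>R t)) has_derivative (\<lambda>h. dir_deriv (h *\<^sub>R t) f (z + s *\<^sub>R t))) (at s)"
    by (rule has_derivative_compose[of "\<lambda>s. z + s *\<^sub>R t" "\<lambda>h. h *\<^sub>R t" s UNIV f, OF _ d])
       (auto intro!: derivative_eq_intros)
  then show "((\<lambda>s. f (z + s *\<^sub>R t)) has_real_derivative dir_deriv t f (z + s *\<^sub>R t)) (at s)"
    by (simp add: has_field_derivative_def linear_scale[OF lin] mult.commute[of _ "dir_deriv t f _"])
qed

lemma grad_inner:
  fixes f :: "real^'n \<Rightarrow> real"
  assumes "C_k 1 f"
  shows "grad f x \<bullet> w = dir_deriv w f x"
proof -
  note lin = dir_deriv_linear[OF assms]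
  have "w = (\<Sum>i\<in>UNIV. w $ i *\<^sub>R axis i 1)" using basis_expansion[of w] by (simp only: scalar_mult_eq_scaleR)
  then have "dir_deriv w f x = dir_deriv (\<Sum>i\<in>UNIV. w $ i *\<^sub>R axis i 1) f x" by (rule arg_cong)
  then show ?thesis by (simp add: linear_sum[OF lin] linear_scale[OF lin] grad_def inner_vec_def mult.commute)
qed

lemma integral_dir_deriv_segment:
  fixes f :: "real^'n \<Rightarrow> real"
  assumes f: "C_k 1 f" and "\<alpha> \<le> \<beta>"
  shows "(\<integral>s. indicator {\<alpha>..\<beta>} s * dir_deriv t f (z + s *\<^sub>R t) \<partial>lborel) = f (z + \<beta> *\<^sub>R t) - f (z + \<alpha> *\<^sub>R t)"
proof -
  have "continuous_on UNIV (\<lambda>s. dir_deriv t f (z + s *\<^sub>R t))"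
    by (rule continuous_on_compose2[OF continuous_on_dir_deriv[OF f]]) (auto intro!: continuous_intros)
  then have "(\<integral>s. dir_deriv t f (z + s *\<^sub>R t) * indicator {\<alpha>..\<beta>} s \<partial>lborel) = f (z + \<beta> *\<^sub>R t) - f (z + \<alpha> *\<^sub>R t)"
    using assms(2) has_real_derivative_line[OF f, of z t]
    by (intro integral_FTC_Icc_real) (auto simp: continuous_on_eq_continuous_at)
  then show ?thesis by (simp add: mult.commute)
qed

lemma affine_hull_add_direction:
  assumes x: "x \<in> affine hull F" and v: "v \<in> span {x - y | x y. x \<in> F \<and> y \<in> F}"
  shows "x + v \<in> affine hull F"
proof -
  define V where "V = (\<lambda>y. (- x) + y) ` (affine hull F)"
  have sV: "subspace V" unfolding V_def by (rule affine_diffs_subspace[OF affine_affine_hull x])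
  have "y - z \<in> V" if "y \<in> F" "z \<in> F" for y z
  proof -
    have "(- x + y) - (- x + z) \<in> V"
      using that by (intro subspace_diff[OF sV]) (auto simp: V_def hull_inc)
    then show ?thesis by simp
  qed
  then have "span {x - y | x y. x \<in> F \<and> y \<in> F} \<subseteq> V"
    using sV by (intro span_minimal) auto
  then have "v \<in> V" using v by auto
  then show ?thesis by (auto simp: V_def)
qed

lemma continuous_bounded_on_compact:
  fixes f :: "'a::metric_space \<Rightarrow> real"
  assumes "continuous_on UNIV f" "compact S"
  obtains B where "\<And>x. x \<in> S \<Longrightarrow> \<bar>f x\<bar> \<le> B"
proof -
  have "compact (f ` S)" using assms by (intro compact_continuous_image) (auto intro: continuous_on_subset)
  then have "bounded (f ` S)" by (rule compact_imp_bounded)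
  then show thesis using that by (auto simp: bounded_iff)
qed

lemma integrable_flat_measure_compact:
  fixes T :: "'a::euclidean_space set" and f :: "'a \<Rightarrow> real"
  assumes on: "pairwise orthogonal T" "\<forall>b\<in>T. norm b = 1"
    and S: "compact S" and f: "continuous_on UNIV f"
  shows "integrable (flat_measure a T) (\<lambda>x. indicator S x * f x)"
proof -
  obtain B where "\<And>x. x \<in> S \<Longrightarrow> \<bar>f x\<bar> \<le> B" using continuous_bounded_on_compact[OF f S] by auto
  then show ?thesis
    using S f by (intro integrable_flat_measure_bounded[OF on])
      (auto intro: compact_imp_bounded borel_compact borel_measurable_continuous_onI)
qed

text \<open>Each line in direction \<open>t\<close> meets \<open>F\<close> in a segment whose endpoints lie on the relative boundary,
  so the fundamental theorem of calculus gives zero line by line.\<close>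

lemma integral_tangential_derivative_eq_0:
  fixes F :: "(real^'n) set"
  assumes F: "compact F" "convex F" "a \<in> F"
    and on: "pairwise orthogonal T" "\<forall>b\<in>T. norm b = 1" and sp: "span T = span {x - y | x y. x \<in> F \<and> y \<in> F}"
    and t: "t \<in> T" and w: "C_k 1 w" and w0: "\<And>x. x \<in> rel_frontier F \<Longrightarrow> w x = 0"
  shows "(\<integral>x. indicator F x * dir_deriv t w x \<partial>flat_measure a T) = 0"
proof -
  define T' where "T' = T - {t}"
  have T: "T = insert t T'" "t \<notin> T'" using t by (auto simp: T'_def)
  have finT: "finite T" by (rule orthonormal_independent(2)[OF on])
  then have fin: "finite T'" by (simp add: T'_def)
  have add: "x + v \<in> affine hull F" if "x \<in> affine hull F" "v \<in> span T" for x v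
    using affine_hull_add_direction[OF that(1)] that(2) sp by simp
  have AE: "AE z in flat_measure a T'. z \<in> affine hull F"
  proof -
    have "{z. z \<in> affine hull F} \<in> sets borel" by (simp add: closed_affine_hull borel_closed)
    moreover have "a + (\<Sum>b\<in>T'. y b *\<^sub>R b) \<in> affine hull F" for y
      using F(3) T by (intro add span_sum span_scale span_base) (auto simp: hull_inc)
    ultimately show ?thesis
      unfolding flat_measure_def by (subst AE_distr_iff) auto
  qed
  have "(\<integral>x. indicator F x * dir_deriv t w x \<partial>flat_measure a T) =
     (\<integral>z. (\<integral>s. indicator F (z + s *\<^sub>R t) * dir_deriv t w (z + s *\<^sub>R t) \<partial>lborel) \<partial>flat_measure a T')"
    using integrable_flat_measure_compact[OF on F(1) continuous_on_dir_deriv[OF w]]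
    unfolding T(1) by (intro integral_flat_measure_insert fin T(2))
  also have "\<dots> = 0"
  proof (rule integral_eq_zero_AE)
    show "AE z in flat_measure a T'. (\<integral>s. indicator F (z + s *\<^sub>R t) * dir_deriv t w (z + s *\<^sub>R t) \<partial>lborel) = 0"
      using AE
    proof eventually_elim
      case (elim z)
      define S where "S = {s. z + s *\<^sub>R t \<in> F}"
      have "compact S"
      proof -
        obtain R where R: "\<And>x. x \<in> F \<Longrightarrow> norm (x - z) \<le> R"
          using compact_imp_bounded[OF F(1)] bounded_any_center[of F z] by (auto simp: dist_norm norm_minus_commute)
        have "bounded S"
          using R on(2) t by (intro boundedI[of S R]) (fastforce simp: S_def)
        moreover have "closed S"
          unfolding S_def using compact_imp_closed[OF F(1)]
          by (intro closed_vimage[of F "\<lambda>s. z + s *\<^sub>R t", unfolded vimage_def]) (auto intro!: continuous_intros)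
        ultimately show ?thesis by (simp add: compact_eq_bounded_closed)
      qed
      moreover have "convex S"
      proof (rule convexI)
        fix x y u v :: real assume "x \<in> S" "y \<in> S" and uv: "0 \<le> u" "0 \<le> v" "u + v = 1"
        then have "u *\<^sub>R (z + x *\<^sub>R t) + v *\<^sub>R (z + y *\<^sub>R t) \<in> F"
          using F(2) by (auto simp: S_def intro: convexD)
        also have "u *\<^sub>R (z + x *\<^sub>R t) + v *\<^sub>R (z + y *\<^sub>R t) = (u + v) *\<^sub>R z + (u * x + v * y) *\<^sub>R t"
          by (simp add: algebra_simps)
        finally show "u *\<^sub>R x + v *\<^sub>R y \<in> S" using uv by (simp add: S_def)
      qed
      ultimately obtain \<alpha> \<beta> where S: "S = {\<alpha>..\<beta>}"
        using connected_compact_interval_1[of S] convex_connected[of S] by (auto simp: cbox_interval)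
      have ind: "indicator F (z + s *\<^sub>R t) = (indicator S s :: real)" for s by (simp add: S_def indicator_def)
      show ?case
      proof (cases "\<alpha> \<le> \<beta>")
        case False
        then show ?thesis by (simp add: ind S)
      next
        case True
        have end0: "w (z + s *\<^sub>R t) = 0" if s: "s \<in> S" and \<sigma>: "\<And>e. e > 0 \<Longrightarrow> s + \<sigma> * e \<notin> S" "\<bar>\<sigma>\<bar> = 1" for s \<sigma>
        proof (rule w0)
          have "z + s *\<^sub>R t \<notin> rel_interior F"
          proof
            assume "z + s *\<^sub>R t \<in> rel_interior F"
            then obtain e where e: "e > 0" "ball (z + s *\<^sub>R t) e \<inter> affine hull F \<subseteq> F" by (auto simp: mem_rel_interior_ball)
            have "z + s *\<^sub>R t + (\<sigma> * (e/2)) *\<^sub>R t \<in> affine hull F"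
              using elim t by (intro add span_scale span_base)
            moreover have "z + s *\<^sub>R t + (\<sigma> * (e/2)) *\<^sub>R t \<in> ball (z + s *\<^sub>R t) e"
              using e(1) \<sigma>(2) on(2) t by (simp add: dist_norm abs_mult)
            ultimately have "s + \<sigma> * (e/2) \<in> S" using e(2) by (auto simp: S_def algebra_simps)
            then show False using \<sigma>(1)[of "e/2"] e(1) by simp
          qed
          then show "z + s *\<^sub>R t \<in> rel_frontier F"
            using s closure_subset[of F] by (auto simp: rel_frontier_def S_def)
        qed
        have "w (z + \<alpha> *\<^sub>R t) = 0" "w (z + \<beta> *\<^sub>R t) = 0"
          using True by (auto intro!: end0[of \<alpha> "-1"] end0[of \<beta> 1] simp: S)
        then show ?thesis
          using integral_dir_deriv_segment[OF w True, of t z] by (simp add: ind S)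
      qed
    qed
  qed
  finally show ?thesis .
qed

section \<open>The divergence theorem on a simplex\<close>

lemma surface_measure_eq: "surface_measure F = flat_measure (SOME a. a \<in> F) (tangent_frame F)"
  by (simp add: surface_measure_def flat_measure_def)

context barycentric begin

lemma compact_hull: "compact (convex hull C)"
  using fin by (simp add: finite_imp_compact_convex_hull)

lemma compact_facet: "c \<in> C \<Longrightarrow> compact (facet c)"
  using fin by (simp add: facet_eq[symmetric] finite_imp_compact_convex_hull)

text \<open>Along \<open>i - j\<close> only the coordinates of \<open>i\<close> and \<open>j\<close> change.  Hence a line in this direction meets the
  simplex exactly in the segment between its points on the planes of the facets opposite to \<open>i\<close> and to
  \<open>j\<close>, and one endpoint belongs to its facet if and only if the other one does.  The endpoints are the
  images of the line under the oblique projections, so no null sets have to be discarded.  The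
  other facets are parallel to the edge and contribute nothing.\<close>

lemma divergence_edge:
  assumes ij: "i \<in> C" "j \<in> C" "i \<noteq> j" and f: "C_k 1 f"
  defines "u \<equiv> (i - j) /\<^sub>R norm (i - j)"
  shows "(\<integral>x. indicator (convex hull C) x * dir_deriv u f x \<partial>lborel) =
    (\<Sum>c\<in>C. (u \<bullet> normal c) *
      (\<integral>x. indicator (facet c) x * f x \<partial>surface_measure (facet c)))"
proof -
  let ?K = "convex hull C"
  define \<kappa> where "\<kappa> = inverse (norm (i - j))"
  have \<kappa>: "\<kappa> > 0" using ij(3) by (simp add: \<kappa>_def)
  have du: "d c \<bullet> u = (if c = i then \<kappa> else if c = j then - \<kappa> else 0)" if "c \<in> C" for c
    using d_vertex_diff[OF that ij(1,2)] ij(3) by (simp add: u_def \<kappa>_def)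
  have lu: "l c (z + s *\<^sub>R u) = (if c = i then l i z + s * \<kappa> else if c = j then l j z - s * \<kappa> else l c z)" if "c \<in> C" for c z s
    using l_add[OF that, of z "s *\<^sub>R u"] du[OF that] by simp
  have nu: "norm u = 1" using ij(3) by (simp add: u_def)
  obtain B where B: "u \<in> B" "orthonormal_basis B"
    using vector_in_orthonormal_basis[OF nu] unfolding orthonormal_basis_def by metis
  define T where "T = B - {u}"
  have T: "orthonormal_basis (insert u T)" "u \<notin> T" using B by (auto simp: T_def insert_absorb)
  have on: "pairwise orthogonal (insert u T)" "\<forall>b\<in>insert u T. norm b = 1"
    using T by (auto simp: orthonormal_basis_def)
  have finT: "finite T" using orthonormal_independent(2)[OF on] by simp
  define F where "F c = {x \<in> ?K. l c x = 0}" for c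
  define a where "a c = (SOME a. a \<in> F c)" for c
  have aF: "a c \<in> F c" if c: "c \<in> C" for c
  proof -
    obtain b where "b \<in> C" "b \<noteq> c" using other_vertex[OF c] by auto
    then have "b \<in> F c" using vertex_in_facet[of b c] c by (simp add: F_def)
    then show ?thesis unfolding a_def by (rule someI)
  qed
  define g where "g c x = indicator (F c) x * f x" for c x
  have cf: "continuous_on UNIV f" by (rule continuous_on_C_k_1[OF f])
  have gm: "g c \<in> borel_measurable borel" if "c \<in> C" for c
    unfolding g_def using compact_facet[OF that] cf
    by (intro borel_measurable_times borel_measurable_indicator borel_compact)
      (auto simp: F_def intro: borel_measurable_continuous_onI)
  define \<pi> where "\<pi> c = oblique_projection (a c) (normal c) u" for c
  have \<pi>: "\<pi> c z = z - (l c z / (d c \<bullet> u)) *\<^sub>R u" if "c \<in> C" for c z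
  proof -
    have "l c (a c) = 0" using aF[OF that] by (simp add: F_def)
    then have "d c \<bullet> (z - a c) = l c z" using l_diff[OF that, of z "a c"] by simp
    then show ?thesis using d_nonzero[OF that] by (simp add: \<pi>_def oblique_projection_def inner_normal)
  qed
  have un: "u \<bullet> normal c = (if c = i then - \<kappa> / norm (d i) else if c = j then \<kappa> / norm (d j) else 0)" if "c \<in> C" for c
    using du[OF that] by (simp add: inner_normal)
  have int: "(\<integral>z. g c (\<pi> c z) \<partial>flat_measure 0 T) = \<bar>u \<bullet> normal c\<bar> * (\<integral>z. g c z \<partial>surface_measure (F c))"
       "integrable (flat_measure 0 T) (\<lambda>z. g c (\<pi> c z))" if c: "c = i \<or> c = j" for c
  proof -
    have cC: "c \<in> C" using c ij by auto
    have un0: "u \<bullet> normal c \<noteq> 0" using c un[OF cC] \<kappa> d_nonzero[OF cC] by auto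
    note onb = orthonormal_basis_facet[OF cC F_def]
    show "(\<integral>z. g c (\<pi> c z) \<partial>flat_measure 0 T) = \<bar>u \<bullet> normal c\<bar> * (\<integral>z. g c z \<partial>surface_measure (F c))"
      unfolding \<pi>_def surface_measure_eq a_def
      by (rule integral_oblique_projection[OF onb T un0 gm[OF cC]])
    have "integrable (flat_measure (a c) (tangent_frame (F c))) (g c)"
      unfolding g_def using compact_facet[OF cC] cf
      by (intro integrable_flat_measure_compact tangent_frame) (simp add: F_def)
    then show "integrable (flat_measure 0 T) (\<lambda>z. g c (\<pi> c z))"
      unfolding \<pi>_def by (rule integrable_oblique_projection[OF onb T un0 gm[OF cC]])
  qed
  have inner: "(\<integral>s. indicator ?K (z + s *\<^sub>R u) * dir_deriv u f (z + s *\<^sub>R u) \<partial>lborel) = g j (\<pi> j z) - g i (\<pi> i z)" for z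
  proof -
    define Q where "Q \<longleftrightarrow> (\<forall>c\<in>C-{i,j}. 0 \<le> l c z)"
    \<comment> \<open>The parameters at which the line through \<open>z\<close> meets the planes \<open>l i = 0\<close> and \<open>l j = 0\<close>.\<close>
    define \<alpha> where "\<alpha> = - l i z / \<kappa>"
    define \<beta> where "\<beta> = l j z / \<kappa>"
    have mem: "z + s *\<^sub>R u \<in> ?K \<longleftrightarrow> Q \<and> \<alpha> \<le> s \<and> s \<le> \<beta>" for s
    proof -
      have "z + s *\<^sub>R u \<in> ?K \<longleftrightarrow> (\<forall>c\<in>C. 0 \<le> l c (z + s *\<^sub>R u))" by (simp add: convex_hull_eq)
      also have "\<dots> \<longleftrightarrow> Q \<and> 0 \<le> l i (z + s *\<^sub>R u) \<and> 0 \<le> l j (z + s *\<^sub>R u)"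
        using ij lu unfolding Q_def by (smt (verit) DiffE DiffI insert_iff singletonD)
      also have "\<dots> \<longleftrightarrow> Q \<and> \<alpha> \<le> s \<and> s \<le> \<beta>"
        using \<kappa> ij by (auto simp: lu \<alpha>_def \<beta>_def field_simps)
      finally show ?thesis .
    qed
    have ind: "indicator ?K (z + s *\<^sub>R u) = (if Q then indicator {\<alpha>..\<beta>} s else (0::real))" for s
      using mem by (simp add: indicator_def)
    have \<pi>j: "\<pi> j z = z + \<beta> *\<^sub>R u" and \<pi>i: "\<pi> i z = z + \<alpha> *\<^sub>R u"
      using ij du by (simp_all add: \<pi> \<beta>_def \<alpha>_def)
    have "l j (z + \<beta> *\<^sub>R u) = 0" "l i (z + \<alpha> *\<^sub>R u) = 0"
    proof -
      have "\<beta> * \<kappa> = l j z" "\<alpha> * \<kappa> = - l i z" using \<kappa> by (simp_all add: \<beta>_def \<alpha>_def)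
      then show "l j (z + \<beta> *\<^sub>R u) = 0" "l i (z + \<alpha> *\<^sub>R u) = 0" using ij by (simp_all add: lu)
    qed
    then have "indicator (F j) (\<pi> j z) = (if Q \<and> \<alpha> \<le> \<beta> then 1 else (0::real))"
       "indicator (F i) (\<pi> i z) = (if Q \<and> \<alpha> \<le> \<beta> then 1 else (0::real))"
      using mem[of \<alpha>] mem[of \<beta>] by (auto simp: F_def \<pi>j \<pi>i indicator_def)
    then have g: "g j (\<pi> j z) - g i (\<pi> i z) = (if Q \<and> \<alpha> \<le> \<beta> then f (z + \<beta> *\<^sub>R u) - f (z + \<alpha> *\<^sub>R u) else 0)"
      by (simp add: g_def \<pi>j \<pi>i)
    show ?thesis
    proof (cases "Q \<and> \<alpha> \<le> \<beta>")
      case True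
      then show ?thesis using integral_dir_deriv_segment[OF f, of \<alpha> \<beta> u z] by (simp add: g ind)
    next
      case False
      then have "indicator ?K (z + s *\<^sub>R u) = (0::real)" for s using ind by auto
      then show ?thesis unfolding g using False by auto
    qed
  qed
  have "(\<integral>x. indicator ?K x * dir_deriv u f x \<partial>lborel) =
     (\<integral>z. (\<integral>s. indicator ?K (z + s *\<^sub>R u) * dir_deriv u f (z + s *\<^sub>R u) \<partial>lborel) \<partial>flat_measure 0 T)"
    using integrable_flat_measure_compact[OF on compact_hull continuous_on_dir_deriv[OF f], of 0 u]
      integral_flat_measure_insert[OF finT T(2), of 0 "\<lambda>x. indicator ?K x * dir_deriv u f x"]
    unfolding lborel_eq_flat_measure[OF T(1)] by blast
  also have "\<dots> = (\<integral>z. g j (\<pi> j z) \<partial>flat_measure 0 T) - (\<integral>z. g i (\<pi> i z) \<partial>flat_measure 0 T)"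
    unfolding inner using int(2) by (intro Bochner_Integration.integral_diff) auto
  also have "\<dots> = (u \<bullet> normal j) * (\<integral>z. g j z \<partial>surface_measure (F j)) + (u \<bullet> normal i) * (\<integral>z. g i z \<partial>surface_measure (F i))"
  proof -
    have "0 < u \<bullet> normal j" "u \<bullet> normal i < 0" using ij un \<kappa> d_nonzero by simp_all
    then show ?thesis using int(1)[of i] int(1)[of j] by simp
  qed
  also have "\<dots> = (\<Sum>c\<in>{i,j}. (u \<bullet> normal c) * (\<integral>z. g c z \<partial>surface_measure (F c)))"
    using ij by simp
  also have "\<dots> = (\<Sum>c\<in>C. (u \<bullet> normal c) * (\<integral>z. g c z \<partial>surface_measure (F c)))"
    using ij un fin by (intro sum.mono_neutral_left) auto
  finally show ?thesis by (simp add: g_def F_def)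
qed

text \<open>Both sides are linear in \<open>v\<close> and agree on differences of vertices, which span the space.\<close>

theorem divergence_simplex:
  assumes f: "C_k 1 f"
  shows "(\<integral>x. indicator (convex hull C) x * dir_deriv v f x \<partial>lborel) =
    (\<Sum>c\<in>C. (v \<bullet> normal c) *
      (\<integral>x. indicator (facet c) x * f x \<partial>surface_measure (facet c)))"
proof -
  let ?I = "\<lambda>v. \<integral>x. indicator (convex hull C) x * dir_deriv v f x \<partial>lborel"
  define S where "S c = (\<integral>x. indicator (facet c) x * f x \<partial>surface_measure (facet c))" for c
  have int: "integrable lborel (\<lambda>x. indicator (convex hull C) x * dir_deriv v f x)" for v
    using borel_integrable_compact[OF compact_hull continuous_on_subset[OF continuous_on_dir_deriv[OF f]], of v] by simp
  note lin = dir_deriv_linear[OF f]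
  have linI: "linear ?I"
  proof (rule linearI)
    show "?I (v + w) = ?I v + ?I w" for v w
      by (simp add: linear_add[OF lin] distrib_left Bochner_Integration.integral_add[OF int int])
    show "?I (r *\<^sub>R v) = r *\<^sub>R ?I v" for r v
      by (simp add: linear_scale[OF lin] mult.left_commute[of _ r])
  qed
  define J where "J v = (\<Sum>c\<in>C. (v \<bullet> normal c) * S c)" for v
  have linJ: "linear J"
    unfolding J_def by (intro linearI) (simp_all add: inner_add_left distrib_right sum.distrib sum_distrib_left mult.assoc)
  have edge: "?I (i - j) = J (i - j)" if "i \<in> C" "j \<in> C" for i j
  proof (cases "i = j")
    case True
    then show ?thesis using linear_0[OF lin] linear_0[OF linJ] by simp
  next
    case False
    have e: "i - j = norm (i - j) *\<^sub>R ((i - j) /\<^sub>R norm (i - j))" using False by simp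
    show ?thesis
      unfolding J_def S_def by (subst e, subst (2) e, subst linear_scale[OF linI])
       (simp only: divergence_edge[OF that False f] sum_distrib_left inner_scaleR_left real_scaleR_def mult.assoc)
  qed
  obtain b where b: "b \<in> C" using two by (cases "C = {}") auto
  have v: "v = (\<Sum>c\<in>C. (d c \<bullet> v) *\<^sub>R (c - b))"
    using vector_repr[of v] d_sum[of v] by (simp add: scaleR_diff_right sum_subtractf scaleR_sum_left[symmetric])
  have "?I v = (\<Sum>c\<in>C. (d c \<bullet> v) *\<^sub>R ?I (c - b))"
    by (subst v) (simp only: linear_sum[OF linI] linear_scale[OF linI])
  also have "\<dots> = (\<Sum>c\<in>C. (d c \<bullet> v) *\<^sub>R J (c - b))"
    using edge b by (intro sum.cong) auto
  also have "\<dots> = J v"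
    by (subst (2) v) (simp only: linear_sum[OF linJ] linear_scale[OF linJ])
  finally show ?thesis by (simp add: J_def S_def)
qed

end

section \<open>Polynomials\<close>

lemma has_derivative_dir_deriv_poly:
  assumes "real_polynomial_function (f :: 'a::euclidean_space \<Rightarrow> real)"
  shows "(f has_derivative (\<lambda>t. dir_deriv t f x)) (at x)"
  using differentiable_at_real_polynomial_function[OF assms, of x UNIV] frechet_derivative_works[of f "at x"]
  by (simp add: dir_deriv_def[abs_def])

lemma dir_deriv_eqI: "(f has_derivative f') (at x) \<Longrightarrow> dir_deriv t f x = f' t"
  by (simp add: dir_deriv_def frechet_derivative_at[symmetric])

lemma dir_deriv_simps:
  fixes f g :: "'a::euclidean_space \<Rightarrow> real"
  assumes f: "real_polynomial_function f" and g: "real_polynomial_function g"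
  shows dir_deriv_add: "dir_deriv t (\<lambda>x. f x + g x) x = dir_deriv t f x + dir_deriv t g x"
    and dir_deriv_diff: "dir_deriv t (\<lambda>x. f x - g x) x = dir_deriv t f x - dir_deriv t g x"
    and dir_deriv_mult: "dir_deriv t (\<lambda>x. f x * g x) x = dir_deriv t f x * g x + f x * dir_deriv t g x"
  using dir_deriv_eqI[OF has_derivative_add[OF has_derivative_dir_deriv_poly[OF f] has_derivative_dir_deriv_poly[OF g]], of t x]
    dir_deriv_eqI[OF has_derivative_diff[OF has_derivative_dir_deriv_poly[OF f] has_derivative_dir_deriv_poly[OF g]], of t x]
    dir_deriv_eqI[OF has_derivative_mult[OF has_derivative_dir_deriv_poly[OF f] has_derivative_dir_deriv_poly[OF g]], of t x]
  by simp_all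

lemma dir_deriv_sum:
  fixes f :: "'i \<Rightarrow> 'a::euclidean_space \<Rightarrow> real"
  assumes "\<And>i. i \<in> I \<Longrightarrow> real_polynomial_function (f i)"
  shows "dir_deriv t (\<lambda>x. \<Sum>i\<in>I. f i x) x = (\<Sum>i\<in>I. dir_deriv t (f i) x)"
  by (rule dir_deriv_eqI[OF has_derivative_sum]) (rule has_derivative_dir_deriv_poly[OF assms])

lemma dir_deriv_const: "dir_deriv t (\<lambda>x. c) x = 0"
  by (rule dir_deriv_eqI) simp

lemma dir_deriv_bounded_linear: "bounded_linear f \<Longrightarrow> dir_deriv t f x = f t"
  by (rule dir_deriv_eqI[OF bounded_linear_imp_has_derivative])

lemma real_polynomial_function_dir_deriv[intro]:
  fixes f :: "'a::euclidean_space \<Rightarrow> real"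
  assumes "real_polynomial_function f"
  shows "real_polynomial_function (dir_deriv t f)"
  using assms
proof induction
  case (linear f)
  then have "dir_deriv t f = (\<lambda>x. f t)" by (auto simp: dir_deriv_bounded_linear)
  then show ?case by auto
next
  case (const c)
  have "dir_deriv t (\<lambda>x::'a. c) = (\<lambda>x. 0)" by (auto simp: dir_deriv_const)
  then show ?case by auto
next
  case (add f g)
  then have "dir_deriv t (\<lambda>x. f x + g x) = (\<lambda>x. dir_deriv t f x + dir_deriv t g x)" by (auto simp: dir_deriv_add)
  then show ?case using add by auto
next
  case (mult f g)
  then have "dir_deriv t (\<lambda>x. f x * g x) = (\<lambda>x. dir_deriv t f x * g x + f x * dir_deriv t g x)" by (auto simp: dir_deriv_mult)
  then show ?case using mult by auto
qed

lemma dir_deriv_commute: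
  fixes f :: "'a::euclidean_space \<Rightarrow> real"
  assumes "real_polynomial_function f"
  shows "dir_deriv s (dir_deriv t f) x = dir_deriv t (dir_deriv s f) x"
  using assms
proof (induction arbitrary: x)
  case (linear f)
  then have "dir_deriv t f = (\<lambda>x. f t)" for t by (auto simp: dir_deriv_bounded_linear)
  then show ?case by (simp add: dir_deriv_const)
next
  case (const c)
  have "dir_deriv t (\<lambda>x::'a. c) = (\<lambda>x. 0)" for t by (auto simp: dir_deriv_const)
  then show ?case by (simp add: dir_deriv_const)
next
  case (add f g)
  then have "dir_deriv t (\<lambda>x. f x + g x) = (\<lambda>x. dir_deriv t f x + dir_deriv t g x)" for t by (auto simp: dir_deriv_add)
  then show ?case using add by (simp add: dir_deriv_add real_polynomial_function_dir_deriv)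
next
  case (mult f g)
  then have "dir_deriv t (\<lambda>x. f x * g x) = (\<lambda>x. dir_deriv t f x * g x + f x * dir_deriv t g x)" for t by (auto simp: dir_deriv_mult)
  then show ?case using mult
    by (simp add: dir_deriv_add dir_deriv_mult real_polynomial_function_dir_deriv real_polynomial_function.intros(4))
qed

lemma continuous_on_poly: "real_polynomial_function f \<Longrightarrow> continuous_on S f" for f :: "'a::euclidean_space \<Rightarrow> real"
  by (rule differentiable_imp_continuous_on[OF differentiable_on_real_polynomial_function])

lemma C_k_1_poly:
  fixes f :: "real^'n \<Rightarrow> real"
  assumes "real_polynomial_function f"
  shows "C_k 1 f"
  using assms by (auto simp: One_nat_def differentiable_on_real_polynomial_function continuous_on_poly real_polynomial_function_dir_deriv)

lemma linear_dir_deriv_poly: "real_polynomial_function f \<Longrightarrow> linear (\<lambda>t. dir_deriv t f x)" for f :: "real^'n \<Rightarrow> real"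
  using dir_deriv_linear[OF C_k_1_poly] .

lemma linear_dir_deriv_poly2:
  fixes f :: "real^'n \<Rightarrow> real"
  assumes f: "real_polynomial_function f"
  shows "linear (\<lambda>v. dir_deriv w (dir_deriv v f) x)"
  by (subst dir_deriv_commute[OF f]) (rule linear_dir_deriv_poly[OF real_polynomial_function_dir_deriv[OF f]])

lemma polys_imp_real_polynomial_function:
  fixes p :: "real^'n \<Rightarrow> real"
  assumes "p \<in> polys k"
  shows "real_polynomial_function p"
proof -
  obtain c where p: "p = (\<lambda>x. \<Sum>\<alpha> | (\<Sum>i\<in>UNIV. \<alpha> i) \<le> k. c \<alpha> * (\<Prod>i\<in>UNIV. x $ i ^ \<alpha> i))"
    using assms by (auto simp: polys_def)
  have 1: "real_polynomial_function (\<lambda>x::real^'n. x $ i)" for i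
    by (rule real_polynomial_function.intros(1)) (rule bounded_linear_vec_nth)
  show ?thesis
  proof (cases "finite {\<alpha>::'n \<Rightarrow> nat. (\<Sum>i\<in>UNIV. \<alpha> i) \<le> k}")
    case True
    then show ?thesis unfolding p
      by (intro real_polynomial_function_sum real_polynomial_function.intros(4) real_polynomial_function.intros(2) real_polynomial_function_prod real_polynomial_function_power 1) auto
  next
    case False
    then show ?thesis unfolding p by (simp add: real_polynomial_function.intros(2))
  qed
qed

text \<open>The restriction to a line is a univariate polynomial with infinitely many zeros.\<close>

lemma poly_zero_on_line:
  fixes p :: "'a::euclidean_space \<Rightarrow> real"
  assumes p: "real_polynomial_function p" and e: "e > 0" and z: "\<And>s. 0 < s \<Longrightarrow> s < e \<Longrightarrow> p (x + s *\<^sub>R v) = 0"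
  shows "p (x + s *\<^sub>R v) = 0"
proof -
  have "real_polynomial_function (p \<circ> (\<lambda>s::real. x + s *\<^sub>R v))"
  proof (rule real_polynomial_function_compose[OF _ p])
    show "polynomial_function (\<lambda>s::real. x + s *\<^sub>R v)"
      by (intro polynomial_function_add polynomial_function_const polynomial_function_bounded_linear bounded_linear_scaleR_left)
  qed
  then obtain a n where a: "(p \<circ> (\<lambda>s::real. x + s *\<^sub>R v)) = (\<lambda>s. \<Sum>i\<le>n. a i * s ^ i)"
    using real_polynomial_function_imp_sum by blast
  then have a': "p (x + s *\<^sub>R v) = (\<Sum>i\<le>n. a i * s ^ i)" for s by (metis comp_apply)
  have "{0<..<e} \<subseteq> {s. (\<Sum>i\<le>n. a i * s ^ i) = 0}" using z a' by auto
  moreover have "infinite {0<..<e}" using e by (simp add: infinite_Ioo)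
  ultimately have "infinite {s. (\<Sum>i\<le>n. a i * s ^ i) = 0}" using finite_subset by blast
  then have "\<forall>i\<le>n. a i = 0" using polyfun_finite_roots[of a n] by auto
  then show ?thesis using a' by simp
qed

text \<open>Join a point of the affine hull to a relative interior point of \<open>F\<close>; near the latter the joining line
  stays in \<open>F\<close>.\<close>

lemma poly_zero_on_affine_hull:
  fixes p :: "'a::euclidean_space \<Rightarrow> real"
  assumes p: "real_polynomial_function p" and F: "convex F" and z: "\<And>x. x \<in> rel_interior F \<Longrightarrow> p x = 0"
    and y: "y \<in> affine hull F"
  shows "p y = 0"
proof -
  have "F \<noteq> {}" using y by auto
  then obtain x where x: "x \<in> rel_interior F" using F rel_interior_eq_empty by blast
  obtain e where e: "e > 0" "ball x e \<inter> affine hull F \<subseteq> F" using x by (auto simp: mem_rel_interior_ball)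
  then have rel: "ball x e \<inter> affine hull F \<subseteq> rel_interior F"
    by (intro rel_interior_maximal) (auto intro!: openin_Int_open simp: openin_open)
  define v where "v = y - x"
  define \<delta> where "\<delta> = e / (norm v + 1)"
  have \<delta>: "\<delta> > 0" using e(1) by (simp add: \<delta>_def add_nonneg_pos)
  have xA: "x \<in> affine hull F" using x rel_interior_subset[of F] hull_subset[of F affine] by blast
  have "p (x + s *\<^sub>R v) = 0" if "0 < s" "s < \<delta>" for s
  proof (rule z, rule subsetD[OF rel], rule IntI)
    have "x + s *\<^sub>R v = (1 - s) *\<^sub>R x + s *\<^sub>R y" by (simp add: v_def algebra_simps)
    then show "x + s *\<^sub>R v \<in> affine hull F" using mem_affine[OF affine_affine_hull xA y, of "1 - s" s] by simp
    have "s * norm v \<le> s * (norm v + 1)" using that by (intro mult_left_mono) auto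
    also have "\<dots> < e" using that by (simp add: \<delta>_def pos_less_divide_eq add_nonneg_pos)
    finally show "x + s *\<^sub>R v \<in> ball x e" using that by (simp add: dist_norm)
  qed
  from poly_zero_on_line[OF p \<delta> this, of 1] show ?thesis by (simp add: v_def)
qed

lemma poly_eq_zero_if_AE:
  fixes p :: "real^'n \<Rightarrow> real"
  assumes p: "real_polynomial_function p" and i: "interior K \<noteq> {}" and K: "K \<in> sets lebesgue"
    and ae: "AE x in lebesgue_on K. p x = 0"
  shows "p y = 0"
proof -
  define N where "N = interior K \<inter> {x. p x \<noteq> 0}"
  have N: "open N"
    unfolding N_def by (intro open_Int open_interior open_Collect_neq continuous_on_poly[OF p] continuous_on_const)
  have "AE x in lebesgue. x \<in> K \<longrightarrow> p x = 0" using ae K by (simp add: AE_restrict_space_iff)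
  then have "AE x in lebesgue. x \<notin> N"
    by eventually_elim (use interior_subset in \<open>auto simp: N_def\<close>)
  then have "N \<in> null_sets lebesgue"
    using N by (subst AE_iff_null_sets) (auto intro: borel_open)
  then have "N = {}" using open_not_negligible[OF N] by (auto simp: negligible_iff_null_sets)
  obtain x e where "e > 0" "ball x e \<subseteq> interior K" using i open_interior[of K] open_contains_ball by blast
  moreover have "affine hull ball x e = UNIV" using \<open>e > 0\<close> by (intro affine_hull_open) auto
  moreover have "p z = 0" if "z \<in> rel_interior (ball x e)" for z
    using that \<open>ball x e \<subseteq> interior K\<close> \<open>N = {}\<close> rel_interior_subset[of "ball x e"] unfolding N_def by blast
  ultimately show ?thesis
    using poly_zero_on_affine_hull[OF p convex_ball, of x e y] by blast
qed

text \<open>The trace of a bilinear form does not depend on the orthonormal basis.  It is used to rewrite the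
  Laplacian, and a contraction with the gradient, in the frame of a facet.\<close>

lemma trace_orthonormal_basis:
  fixes f :: "real^'n \<Rightarrow> real^'n \<Rightarrow> real"
  assumes B: "orthonormal_basis B" and l1: "\<And>y. linear (\<lambda>x. f x y)" and l2: "\<And>x. linear (\<lambda>y. f x y)"
  shows "(\<Sum>i\<in>UNIV. f (axis i 1) (axis i 1)) = (\<Sum>b\<in>B. f b b)"
proof -
  have on: "pairwise orthogonal B" "\<forall>b\<in>B. norm b = 1" "span B = UNIV" using B by (auto simp: orthonormal_basis_def)
  have fin: "finite B" using orthonormal_independent(2)[OF on(1,2)] .
  have e: "(\<Sum>b\<in>B. (x \<bullet> b) *\<^sub>R b) = x" for x
    using orthonormal_basis_expand[OF on(1), of x] on fin by auto
  have "(\<Sum>i\<in>UNIV. f (axis i 1) (axis i 1)) = (\<Sum>i\<in>UNIV. \<Sum>b\<in>B. (axis i 1 \<bullet> b) * f b (axis i 1))"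
  proof (rule sum.cong[OF refl])
    fix i :: 'n
    have "f (\<Sum>b\<in>B. (axis i 1 \<bullet> b) *\<^sub>R b) (axis i 1) = (\<Sum>b\<in>B. (axis i 1 \<bullet> b) * f b (axis i 1))"
      by (simp add: linear_sum[OF l1] linear_scale[OF l1])
    then show "f (axis i 1) (axis i 1) = (\<Sum>b\<in>B. (axis i 1 \<bullet> b) * f b (axis i 1))" by (simp add: e)
  qed
  also have "\<dots> = (\<Sum>b\<in>B. \<Sum>i\<in>UNIV. b $ i * f b (axis i 1))"
    by (subst sum.swap) (simp add: inner_axis' )
  also have "\<dots> = (\<Sum>b\<in>B. f b (\<Sum>i\<in>UNIV. b $ i *\<^sub>R axis i 1))"
    by (simp add: linear_sum[OF l2] linear_scale[OF l2])
  also have "\<dots> = (\<Sum>b\<in>B. f b b)"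
  proof (intro sum.cong refl)
    fix b :: "real^'n"
    show "f b (\<Sum>i\<in>UNIV. b $ i *\<^sub>R axis i 1) = f b b"
      using basis_expansion[of b] by (simp only: scalar_mult_eq_scaleR)
  qed
  finally show ?thesis .
qed

section \<open>The divergence identity on one element\<close>

text \<open>This is the component in direction \<open>v\<close> of the vector field \<open>\<Delta>p \<nabla>p - D\<^sup>2p \<nabla>p\<close>.\<close>

definition boundary_field :: "(real^'n \<Rightarrow> real) \<Rightarrow> real^'n \<Rightarrow> real^'n \<Rightarrow> real" where
  "boundary_field p v x = laplacian p x * dir_deriv v p x
     - (\<Sum>j\<in>UNIV. dir_deriv (axis j 1) p x * dir_deriv (axis j 1) (dir_deriv v p) x)"

lemma poly_laplacian:
  fixes p :: "real^'n \<Rightarrow> real"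
  assumes "real_polynomial_function p"
  shows "real_polynomial_function (laplacian p)"
  unfolding laplacian_def[abs_def] using assms by (intro real_polynomial_function_sum) auto

lemma poly_boundary_field:
  fixes p :: "real^'n \<Rightarrow> real"
  assumes p: "real_polynomial_function p"
  shows "real_polynomial_function (boundary_field p v)"
  unfolding boundary_field_def[abs_def] using p poly_laplacian[OF p]
  by (intro real_polynomial_function_diff real_polynomial_function_sum real_polynomial_function.intros(4)) auto

lemma linear_boundary_field:
  fixes p :: "real^'n \<Rightarrow> real"
  assumes p: "real_polynomial_function p"
  shows "linear (\<lambda>v. boundary_field p v x)"
proof -
  note l2 = linear_add[OF linear_dir_deriv_poly2[OF p]] linear_scale[OF linear_dir_deriv_poly2[OF p]]
  note l1 = linear_add[OF linear_dir_deriv_poly[OF p]] linear_scale[OF linear_dir_deriv_poly[OF p]]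
  show ?thesis
    unfolding boundary_field_def
    by (intro linearI) (simp_all add: l1 l2 algebra_simps sum.distrib sum_distrib_left)
qed

lemma norm_hessian:
  "(norm (hessian p x))\<^sup>2 = (\<Sum>i\<in>UNIV. \<Sum>j\<in>UNIV. (dir_deriv (axis j 1) (dir_deriv (axis i 1) p) x)\<^sup>2)"
  by (simp add: power2_norm_eq_inner inner_vec_def hessian_def) (simp add: power2_eq_square)

text \<open>The terms with third derivatives cancel because partial derivatives commute.\<close>

lemma divergence_boundary_field:
  fixes p :: "real^'n \<Rightarrow> real"
  assumes p: "real_polynomial_function p"
  shows "(\<Sum>i\<in>UNIV. dir_deriv (axis i 1) (boundary_field p (axis i 1)) x) = (laplacian p x)\<^sup>2 - (norm (hessian p x))\<^sup>2"
proof -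
  let ?D = "\<lambda>i. dir_deriv (axis i 1)"
  note P = real_polynomial_function_dir_deriv[OF p]
  note L = poly_laplacian[OF p]
  have e: "?D i (boundary_field p (axis i 1)) x =
     ?D i (laplacian p) x * ?D i p x + laplacian p x * ?D i (?D i p) x
     - (\<Sum>j\<in>UNIV. (?D i (?D j p) x) * (?D j (?D i p) x) + ?D j p x * ?D i (?D j (?D i p)) x)" for i
    unfolding boundary_field_def[abs_def]
    by (simp add: dir_deriv_diff dir_deriv_mult dir_deriv_sum p L P real_polynomial_function_dir_deriv
        real_polynomial_function.intros(4) real_polynomial_function_sum)
  have dl: "?D j (laplacian p) x = (\<Sum>i\<in>UNIV. ?D i (?D j (?D i p)) x)" for j
  proof -
    have "?D j (laplacian p) x = (\<Sum>i\<in>UNIV. ?D j (?D i (?D i p)) x)"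
      unfolding laplacian_def[abs_def] by (intro dir_deriv_sum real_polynomial_function_dir_deriv p)
    then show ?thesis by (simp add: dir_deriv_commute[OF P, of "axis j 1"])
  qed
  have "(\<Sum>i\<in>UNIV. ?D i (boundary_field p (axis i 1)) x) =
     (\<Sum>i\<in>UNIV. ?D i (laplacian p) x * ?D i p x) + laplacian p x * (\<Sum>i\<in>UNIV. ?D i (?D i p) x)
     - (\<Sum>i\<in>UNIV. \<Sum>j\<in>UNIV. (?D i (?D j p) x) * (?D j (?D i p) x)) - (\<Sum>i\<in>UNIV. \<Sum>j\<in>UNIV. ?D j p x * ?D i (?D j (?D i p)) x)"
    unfolding e by (simp add: sum_subtractf sum.distrib sum_distrib_left)
  also have "(\<Sum>i\<in>UNIV. \<Sum>j\<in>UNIV. ?D j p x * ?D i (?D j (?D i p)) x) = (\<Sum>j\<in>UNIV. ?D j (laplacian p) x * ?D j p x)"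
    by (subst sum.swap) (simp add: dl sum_distrib_right mult.commute[of "?D _ p x"])
  also have "(\<Sum>i\<in>UNIV. \<Sum>j\<in>UNIV. (?D i (?D j p) x) * (?D j (?D i p) x)) = (norm (hessian p x))\<^sup>2"
    unfolding norm_hessian by (intro sum.cong refl) (simp add: power2_eq_square dir_deriv_commute[OF p])
  finally show ?thesis by (simp add: power2_eq_square laplacian_def[symmetric])
qed

text \<open>In the frame of a facet the two contributions of the second normal derivative cancel.  The product
  \<open>\<partial>\<^sub>t p \<partial>\<^sub>t\<partial>\<^sub>n p\<close> that remains is a tangential derivative up to another copy of \<open>\<partial>\<^sub>t\<partial>\<^sub>t p \<partial>\<^sub>n p\<close>, whence the
  factor two.\<close>

lemma boundary_field_normal:
  fixes p :: "real^'n \<Rightarrow> real"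
  assumes p: "real_polynomial_function p" and B: "orthonormal_basis (insert n T)" "n \<notin> T" "finite T"
  shows "boundary_field p n x = 2 * ((\<Sum>t\<in>T. dir_deriv t (dir_deriv t p) x) * dir_deriv n p x)
     - (\<Sum>t\<in>T. dir_deriv t (\<lambda>x. dir_deriv t p x * dir_deriv n p x) x)"
proof -
  note P = real_polynomial_function_dir_deriv[OF p]
  note lin = linear_dir_deriv_poly2[OF p]
  have "laplacian p x = (\<Sum>b\<in>insert n T. dir_deriv b (dir_deriv b p) x)"
    unfolding laplacian_def
    by (rule trace_orthonormal_basis[OF B(1), of "\<lambda>v w. dir_deriv v (dir_deriv w p) x"]) (intro linear_dir_deriv_poly P lin)+
  moreover have "(\<Sum>j\<in>UNIV. dir_deriv (axis j 1) p x * dir_deriv (axis j 1) (dir_deriv n p) x) = (\<Sum>b\<in>insert n T. dir_deriv b p x * dir_deriv b (dir_deriv n p) x)"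
  proof (rule trace_orthonormal_basis[OF B(1), of "\<lambda>v w. dir_deriv v p x * dir_deriv w (dir_deriv n p) x"])
    note l1 = linear_add[OF linear_dir_deriv_poly[OF p]] linear_scale[OF linear_dir_deriv_poly[OF p]]
    note l2 = linear_add[OF linear_dir_deriv_poly[OF P[of n]]] linear_scale[OF linear_dir_deriv_poly[OF P[of n]]]
    show "linear (\<lambda>v. dir_deriv v p x * dir_deriv w (dir_deriv n p) x)" for w
      by (intro linearI) (simp_all add: l1 algebra_simps)
    show "linear (\<lambda>w. dir_deriv v p x * dir_deriv w (dir_deriv n p) x)" for v
      by (intro linearI) (simp_all add: l2 algebra_simps)
  qed
  ultimately show ?thesis using B(2,3)
    by (simp add: boundary_field_def dir_deriv_mult P p sum.distrib algebra_simps sum_distrib_left sum_distrib_right)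
qed

context barycentric begin

lemma element_identity:
  assumes p: "real_polynomial_function p"
  shows "(\<integral>x. indicator (convex hull C) x * (laplacian p x)\<^sup>2 \<partial>lborel) - (\<integral>x. indicator (convex hull C) x * (norm (hessian p x))\<^sup>2 \<partial>lborel)
   = (\<Sum>c\<in>C. \<integral>x. indicator (facet c) x * boundary_field p (normal c) x \<partial>surface_measure (facet c))"
proof -
  let ?K = "convex hull C" and ?F = "\<lambda>c. (facet c)"
  have int: "integrable lborel (\<lambda>x. indicator ?K x * f x)" if "continuous_on UNIV f" for f :: "real^'n \<Rightarrow> real"
    using borel_integrable_compact[OF compact_hull continuous_on_subset[OF that], of] by simp
  have cl: "continuous_on UNIV (\<lambda>x. (laplacian p x)\<^sup>2)"
    by (intro continuous_on_power continuous_on_poly poly_laplacian p)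
  have ch: "continuous_on UNIV (\<lambda>x. (norm (hessian p x))\<^sup>2)"
    unfolding norm_hessian by (intro continuous_on_sum continuous_on_power continuous_on_poly real_polynomial_function_dir_deriv p)
  have intS: "integrable (surface_measure (?F c)) (\<lambda>x. indicator (?F c) x * boundary_field p v x)" if "c \<in> C" for c v
    unfolding surface_measure_eq
    by (intro integrable_flat_measure_compact tangent_frame compact_facet that continuous_on_poly poly_boundary_field p)
  have "(\<integral>x. indicator ?K x * (laplacian p x)\<^sup>2 \<partial>lborel) - (\<integral>x. indicator ?K x * (norm (hessian p x))\<^sup>2 \<partial>lborel)
     = (\<integral>x. (\<Sum>i\<in>UNIV. indicator ?K x * dir_deriv (axis i 1) (boundary_field p (axis i 1)) x) \<partial>lborel)"
    by (subst Bochner_Integration.integral_diff[OF int[OF cl] int[OF ch], symmetric])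
      (simp add: sum_distrib_left[symmetric] divergence_boundary_field[OF p] right_diff_distrib)
  also have "\<dots> = (\<Sum>i\<in>UNIV. \<integral>x. indicator ?K x * dir_deriv (axis i 1) (boundary_field p (axis i 1)) x \<partial>lborel)"
    by (intro Bochner_Integration.integral_sum int continuous_on_poly real_polynomial_function_dir_deriv poly_boundary_field p)
  also have "\<dots> = (\<Sum>i\<in>UNIV. \<Sum>c\<in>C. (axis i 1 \<bullet> normal c) * (\<integral>x. indicator (?F c) x * boundary_field p (axis i 1) x \<partial>surface_measure (?F c)))"
    by (simp only: divergence_simplex[OF C_k_1_poly[OF poly_boundary_field[OF p]]])
  also have "\<dots> = (\<Sum>c\<in>C. \<Sum>i\<in>UNIV. \<integral>x. (axis i 1 \<bullet> normal c) * (indicator (?F c) x * boundary_field p (axis i 1) x) \<partial>surface_measure (?F c))"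
    by (subst sum.swap) simp
  also have "\<dots> = (\<Sum>c\<in>C. \<integral>x. indicator (?F c) x * boundary_field p (normal c) x \<partial>surface_measure (?F c))"
  proof (rule sum.cong[OF refl])
    fix c assume c: "c \<in> C"
    have bf: "boundary_field p (normal c) x = (\<Sum>i\<in>UNIV. (axis i 1 \<bullet> normal c) * boundary_field p (axis i 1) x)" for x
    proof -
      note lin = linear_boundary_field[OF p, of x]
      have "normal c = (\<Sum>i\<in>UNIV. (axis i 1 \<bullet> normal c) *\<^sub>R axis i 1)"
        using basis_expansion[of "normal c"] by (simp only: scalar_mult_eq_scaleR inner_axis' inner_real_def mult_1 real_inner_1_left)
      then have "boundary_field p (normal c) x = boundary_field p (\<Sum>i\<in>UNIV. (axis i 1 \<bullet> normal c) *\<^sub>R axis i 1) x"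
        by (rule arg_cong)
      then show ?thesis by (simp only: linear_sum[OF lin] linear_scale[OF lin] real_scaleR_def)
    qed
    show "(\<Sum>i\<in>UNIV. \<integral>x. (axis i 1 \<bullet> normal c) * (indicator (?F c) x * boundary_field p (axis i 1) x) \<partial>surface_measure (?F c))
      = (\<integral>x. indicator (?F c) x * boundary_field p (normal c) x \<partial>surface_measure (?F c))"
      by (subst Bochner_Integration.integral_sum[symmetric])
        (auto intro!: integrable_mult_right intS c simp: bf sum_distrib_left mult.left_commute)
  qed
  finally show ?thesis .
qed

end

section \<open>The polynomial on an element\<close>

lemma full_simplex_interior:
  fixes K :: "(real^'n) set"
  assumes "int CARD('n) simplex K"
  shows "interior K \<noteq> {}" "rel_interior K = interior K" "compact K" "convex K"
proof -
  show cK: "convex K" "compact K" using assms convex_simplex compact_simplex by auto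
  have "affine hull K = UNIV" using aff_dim_simplex[OF assms] aff_dim_eq_full[of K] by simp
  then show r: "rel_interior K = interior K" by (rule rel_interior_interior)
  have "K \<noteq> {}" using assms by (auto simp: simplex_def)
  then show "interior K \<noteq> {}" using r rel_interior_eq_empty[OF cK(1)] by simp
qed

text \<open>Two polynomials that agree almost everywhere on an element agree on an open set, hence everywhere;
  so the definite description denotes.\<close>

lemma elem_poly_represents:
  fixes K :: "(real^'n) set"
  assumes K: "int CARD('n) simplex K" and p: "p \<in> polys k" and ae: "AE x in lebesgue_on K. v x = p x"
  shows "real_polynomial_function (elem_poly v K)" "AE x in lebesgue_on K. v x = elem_poly v K x"
proof -
  let ?P = "\<lambda>p. (\<exists>k. p \<in> polys k) \<and> (AE x in lebesgue_on K. v x = p x)"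
  note fs = full_simplex_interior[OF K]
  have "\<exists>!p. ?P p"
  proof (rule ex1I)
    show "?P p" using p ae by blast
    fix q assume q: "?P q"
    have "q y - p y = 0" for y
    proof (rule poly_eq_zero_if_AE)
      show "real_polynomial_function (\<lambda>x. q x - p x)"
        using q p polys_imp_real_polynomial_function by (intro real_polynomial_function_diff) auto
      show "interior K \<noteq> {}" by fact
      show "K \<in> sets lebesgue" using fs(3) by (intro lmeasurable_compact[THEN fmeasurableD])
      have "AE x in lebesgue_on K. v x = q x" using q by simp
      then show "AE x in lebesgue_on K. q x - p x = 0" using ae by eventually_elim simp
    qed
    then show "q = p" by auto
  qed
  from theI'[OF this] have "?P (elem_poly v K)" by (simp add: elem_poly_def)
  then show "real_polynomial_function (elem_poly v K)" "AE x in lebesgue_on K. v x = elem_poly v K x"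
    using polys_imp_real_polynomial_function by auto
qed

section \<open>Convergence of traces on a facet\<close>

text \<open>Young's inequality bounds the product by an arbitrarily small constant plus a multiple of the square of \<open>u m\<close>.\<close>

lemma tendsto_integral_mult_zero:
  fixes u :: "nat \<Rightarrow> 'a \<Rightarrow> real" and r :: "'a \<Rightarrow> real"
  assumes M: "finite_measure M"
    and [measurable]: "\<And>m. u m \<in> borel_measurable M" "r \<in> borel_measurable M"
    and int: "\<And>m. integrable M (\<lambda>x. (u m x)\<^sup>2)" and lim: "(\<lambda>m. \<integral>x. (u m x)\<^sup>2 \<partial>M) \<longlonglongrightarrow> 0"
    and B: "\<And>x. x \<in> space M \<Longrightarrow> \<bar>r x\<bar> \<le> B"
  shows "\<And>m. integrable M (\<lambda>x. u m x * r x)" "(\<lambda>m. \<integral>x. u m x * r x \<partial>M) \<longlonglongrightarrow> 0"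
proof -
  interpret finite_measure M by fact
  have am: "\<bar>u m x * r x\<bar> \<le> \<delta> + (B\<^sup>2 / (4 * \<delta>)) * (u m x)\<^sup>2" if "x \<in> space M" "\<delta> > 0" for m x \<delta>
  proof -
    have "\<bar>u m x * r x\<bar> \<le> \<bar>u m x\<bar> * B" using B[OF that(1)] by (simp add: abs_mult mult_left_mono)
    moreover have "0 \<le> (\<bar>u m x\<bar> * B - 2 * \<delta>)\<^sup>2 / (4 * \<delta>)" using that by simp
    moreover have "(\<bar>u m x\<bar> * B - 2 * \<delta>)\<^sup>2 / (4 * \<delta>) = \<delta> + (B\<^sup>2 / (4 * \<delta>)) * (u m x)\<^sup>2 - \<bar>u m x\<bar> * B"
      using that by (simp add: power2_eq_square field_simps)
    ultimately show ?thesis by linarith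
  qed
  have intb: "integrable M (\<lambda>x. \<delta> + (B\<^sup>2 / (4 * \<delta>)) * (u m x)\<^sup>2)" for m \<delta>
    using int[of m] by simp
  show i: "integrable M (\<lambda>x. u m x * r x)" for m
    using am[of _ 1 m] by (intro Bochner_Integration.integrable_bound[OF intb[of 1 m]]) (auto intro!: AE_I2 simp del: abs_mult)
  show "(\<lambda>m. \<integral>x. u m x * r x \<partial>M) \<longlonglongrightarrow> 0"
  proof (rule LIMSEQ_I)
    fix \<epsilon> :: real assume \<epsilon>: "0 < \<epsilon>"
    define \<mu> where "\<mu> = measure M (space M)"
    define \<delta> where "\<delta> = \<epsilon> / (2 * (\<mu> + 1))"
    have \<mu>: "0 \<le> \<mu>" by (simp add: \<mu>_def)
    then have \<delta>: "0 < \<delta>" "\<delta> * \<mu> < \<epsilon> / 2"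
      using \<epsilon> by (auto simp: \<delta>_def field_simps add_nonneg_pos)
    define K where "K = B\<^sup>2 / (4 * \<delta>)"
    have "(\<lambda>m. K * (\<integral>x. (u m x)\<^sup>2 \<partial>M)) \<longlonglongrightarrow> K * 0" by (intro tendsto_mult tendsto_const lim)
    then obtain N where N: "\<And>m. m \<ge> N \<Longrightarrow> \<bar>K * (\<integral>x. (u m x)\<^sup>2 \<partial>M)\<bar> < \<epsilon> / 2"
      using LIMSEQ_D[of _ 0 "\<epsilon> / 2"] \<epsilon> by fastforce
    have "norm ((\<integral>x. u m x * r x \<partial>M) - 0) < \<epsilon>" if "m \<ge> N" for m
    proof -
      have "\<bar>\<integral>x. u m x * r x \<partial>M\<bar> \<le> (\<integral>x. \<bar>u m x * r x\<bar> \<partial>M)" by (rule integral_abs_bound)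
      also have "\<dots> \<le> (\<integral>x. \<delta> + K * (u m x)\<^sup>2 \<partial>M)"
        unfolding K_def using am[OF _ \<delta>(1)] intb[of \<delta> m] i[of m]
        by (intro integral_mono) (auto simp del: abs_mult)
      also have "\<dots> = \<delta> * \<mu> + K * (\<integral>x. (u m x)\<^sup>2 \<partial>M)"
        using int[of m] by (simp add: \<mu>_def)
      also have "\<dots> < \<epsilon>" using \<delta>(2) N[OF that] by linarith
      finally show ?thesis by simp
    qed
    then show "\<exists>N. \<forall>m\<ge>N. norm ((\<integral>x. u m x * r x \<partial>M) - 0) < \<epsilon>" by blast
  qed
qed

lemma C_k_1_mult:
  fixes f g :: "real^'n \<Rightarrow> real"
  assumes f: "C_k 1 f" and g: "C_k 1 g"
  shows "C_k 1 (\<lambda>x. f x * g x)"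
    and "dir_deriv t (\<lambda>x. f x * g x) x = dir_deriv t f x * g x + f x * dir_deriv t g x"
proof -
  have d: "((\<lambda>x. f x * g x) has_derivative (\<lambda>h. f x * dir_deriv h g x + dir_deriv h f x * g x)) (at x)" for x
    by (intro has_derivative_mult has_derivative_dir_deriv f g)
  show e: "dir_deriv t (\<lambda>x. f x * g x) x = dir_deriv t f x * g x + f x * dir_deriv t g x" for t x
    using dir_deriv_eqI[OF d, of t x] by simp
  have "(\<lambda>x. f x * g x) differentiable_on UNIV"
    using d by (auto simp: differentiable_on_def differentiable_def)
  moreover have "continuous_on UNIV (dir_deriv t (\<lambda>x. f x * g x))" for t
    unfolding e by (intro continuous_on_add continuous_on_mult continuous_on_dir_deriv continuous_on_C_k_1 f g)
  ultimately show "C_k 1 (\<lambda>x. f x * g x)" by (simp add: One_nat_def)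
qed

lemma C_k_1_diff:
  fixes f g :: "real^'n \<Rightarrow> real"
  assumes f: "C_k 1 f" and g: "C_k 1 g"
  shows "C_k 1 (\<lambda>x. f x - g x)"
    and "dir_deriv t (\<lambda>x. f x - g x) x = dir_deriv t f x - dir_deriv t g x"
proof -
  have d: "((\<lambda>x. f x - g x) has_derivative (\<lambda>h. dir_deriv h f x - dir_deriv h g x)) (at x)" for x
    by (intro has_derivative_diff has_derivative_dir_deriv f g)
  show e: "dir_deriv t (\<lambda>x. f x - g x) x = dir_deriv t f x - dir_deriv t g x" for t x
    using dir_deriv_eqI[OF d, of t x] by simp
  have "(\<lambda>x. f x - g x) differentiable_on UNIV"
    using d by (auto simp: differentiable_on_def differentiable_def)
  moreover have "continuous_on UNIV (dir_deriv t (\<lambda>x. f x - g x))" for t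
    unfolding e by (intro continuous_on_diff continuous_on_dir_deriv f g)
  ultimately show "C_k 1 (\<lambda>x. f x - g x)" by (simp add: One_nat_def)
qed

lemma integral_lebesgue_on_borel:
  fixes f :: "'a::euclidean_space \<Rightarrow> real"
  assumes K: "K \<in> sets borel" and f: "f \<in> borel_measurable borel"
  shows "(\<integral>x. f x \<partial>lebesgue_on K) = (\<integral>x. indicator K x * f x \<partial>lborel)"
proof -
  have "K \<in> sets lebesgue" using K by (simp add: sets_completionI_sets)
  then have "(\<integral>x. f x \<partial>lebesgue_on K) = (\<integral>x. indicator K x * f x \<partial>lebesgue)"
    by (subst integral_restrict_space) auto
  also have "\<dots> = (\<integral>x. indicator K x * f x \<partial>lborel)"
    using K f by (intro integral_completion) auto
  finally show ?thesis .
qed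

context barycentric begin

lemma l_polynomial: "c \<in> C \<Longrightarrow> real_polynomial_function (l c)"
proof -
  assume "c \<in> C"
  then have eq: "l c = (\<lambda>x. l c 0 + d c \<bullet> x)" by (intro ext l_affine)
  have "real_polynomial_function (\<lambda>x. a + d c \<bullet> x)" for a
    by (intro real_polynomial_function.intros(2,3) real_polynomial_function.intros(1) bounded_linear_inner_right)
  then show ?thesis by (subst eq)
qed

lemma l_le_1: "c \<in> C \<Longrightarrow> x \<in> convex hull C \<Longrightarrow> l c x \<le> 1"
  using l_sum[of x] member_le_sum[of c C "\<lambda>c. l c x"] fin by (auto simp: convex_hull_eq)

text \<open>If another coordinate vanished at a relative interior point of the facet opposite to \<open>c\<close>, the face
  where it vanishes would contain this facet and with it the vertex where the coordinate is one.\<close>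

lemma rel_interior_facet_pos:
  assumes c: "c \<in> C" "c' \<in> C" "c' \<noteq> c" and x: "x \<in> rel_interior (facet c)"
  shows "0 < l c' x"
proof -
  let ?F = "\<lambda>c. (facet c)"
  have xF: "x \<in> ?F c" using x rel_interior_subset by blast
  have "l c' x \<noteq> 0"
  proof
    assume "l c' x = 0"
    then have ne: "?F c' \<inter> rel_interior (?F c) \<noteq> {}" using x xF by blast
    have fc: "?F c' face_of convex hull C" using facet_of_iff c facet_of_imp_face_of by blast
    have "?F c \<subseteq> convex hull C" by blast
    then have "?F c \<subseteq> ?F c'" by (rule subset_of_face_of[OF fc _ ne])
    then have "c' \<in> ?F c'" using vertex_in_facet[OF c(2,3,1)] by blast
    then show False using c l_vertex[of c' c'] by simp
  qed
  then show ?thesis using xF c by (force simp: convex_hull_eq)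
qed

text \<open>Let \<open>w\<^sub>m = \<phi>\<^sub>m - p\<close>.  As \<open>q\<close> vanishes on the other facets, the divergence theorem says that the integral of \<open>w\<^sub>m q\<close> over the facet is the integral of
  \<open>\<partial>\<^sub>n(w\<^sub>m q)\<close> over the element, which converges to the integral of \<open>h q\<close> with \<open>h = g - \<partial>\<^sub>n p\<close>.  It remains to
  see that this limit is zero, without knowing yet that \<open>g\<close> is the derivative of \<open>p\<close>.  For
  a test polynomial that vanishes on all facets the boundary integrals are zero, and \<open>q\<close> is the
  dominated limit of the polynomials \<open>q (1 - (1 - l c)\<^sup>j)\<close>, which vanish on all facets.\<close>

lemma trace_limit:
  assumes c: "c \<in> C" and \<phi>: "\<And>m. C_k 1 (\<phi> m)" and p: "real_polynomial_function p" and q: "real_polynomial_function q"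
    and q0: "\<And>c' x. c' \<in> C \<Longrightarrow> c' \<noteq> c \<Longrightarrow> l c' x = 0 \<Longrightarrow> q x = 0"
    and L2: "(\<lambda>m. \<integral>x. (\<phi> m x - p x)\<^sup>2 \<partial>lebesgue_on (convex hull C)) \<longlonglongrightarrow> 0"
    and g[measurable]: "g \<in> borel_measurable (lebesgue_on (convex hull C))"
      and g2: "integrable (lebesgue_on (convex hull C)) (\<lambda>x. (g x)\<^sup>2)"
    and L2g: "(\<lambda>m. \<integral>x. (dir_deriv (normal c) (\<phi> m) x - g x)\<^sup>2 \<partial>lebesgue_on (convex hull C)) \<longlonglongrightarrow> 0"
  defines "F \<equiv> (facet c)"
  shows "(\<lambda>m. \<integral>x. indicator F x * (\<phi> m x * q x) \<partial>surface_measure F) \<longlonglongrightarrow> (\<integral>x. indicator F x * (p x * q x) \<partial>surface_measure F)"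
proof -
  define K where "K = convex hull C"
  define M where "M = lebesgue_on K"
  define v where "v = normal c"
  have cK: "compact K" using compact_hull by (simp add: K_def)
  have Kb: "K \<in> sets borel" using cK by (rule borel_compact)
  have Kl: "K \<in> sets lebesgue" using Kb by (simp add: sets_completionI_sets)
  have fM: "finite_measure M" unfolding M_def
    by (intro finite_measure_lebesgue_on lmeasurable_compact cK)
  interpret finite_measure M by fact
  have sp: "space M = K" by (simp add: M_def)
  have cm: "f \<in> borel_measurable M" if "continuous_on UNIV f" for f :: "real^'n \<Rightarrow> real"
  proof -
    have "f \<in> borel_measurable lebesgue"
      using borel_measurable_continuous_onI[OF that] by (simp add: measurable_completion)
    then show ?thesis unfolding M_def by (rule measurable_restrict_space1)
  qed
  have gM: "g \<in> borel_measurable M" using g by (simp add: M_def K_def)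
  have bd: "\<exists>B. \<forall>x\<in>K. \<bar>f x\<bar> \<le> B" if "continuous_on UNIV f" for f :: "real^'n \<Rightarrow> real"
    using continuous_bounded_on_compact[OF that cK] by metis
  have ib: "integrable M f" if f: "continuous_on UNIV f" for f :: "real^'n \<Rightarrow> real"
  proof -
    obtain B where "\<And>x. x \<in> K \<Longrightarrow> \<bar>f x\<bar> \<le> B" using bd[OF f] by auto
    then show ?thesis by (intro integrable_const_bound[of _ B] cm f) (auto intro!: AE_I2 simp: sp)
  qed
  note pC = C_k_1_poly[OF p]
  define w where "w m x = \<phi> m x - p x" for m x
  have wC: "C_k 1 (w m)" for m unfolding w_def by (rule C_k_1_diff(1)[OF \<phi> pC])
  have dw: "dir_deriv t (w m) x = dir_deriv t (\<phi> m) x - dir_deriv t p x" for t m x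
    unfolding w_def by (rule C_k_1_diff(2)[OF \<phi> pC])
  define h where "h x = g x - dir_deriv v p x" for x
  have hM: "h \<in> borel_measurable M" unfolding h_def
    by (intro borel_measurable_diff gM cm continuous_on_dir_deriv pC)
  have ig2: "integrable M (\<lambda>x. (g x)\<^sup>2)" using g2 by (simp add: M_def K_def)
  have i_sq: "integrable M (\<lambda>x. (f x - g x)\<^sup>2)" if f: "continuous_on UNIV f" for f
  proof (rule Bochner_Integration.integrable_bound)
    show "integrable M (\<lambda>x. 2 * (f x)\<^sup>2 + 2 * (g x)\<^sup>2)"
      by (intro Bochner_Integration.integrable_add integrable_mult_right ig2 ib continuous_on_power f)
    show "(\<lambda>x. (f x - g x)\<^sup>2) \<in> borel_measurable M"
      by (intro borel_measurable_power borel_measurable_diff cm f gM)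
    have "(a - b)\<^sup>2 \<le> 2 * a\<^sup>2 + 2 * b\<^sup>2" for a b :: real
      using zero_le_power2[of "a + b"] by (simp add: power2_eq_square algebra_simps)
    then show "AE x in M. norm ((f x - g x)\<^sup>2) \<le> norm (2 * (f x)\<^sup>2 + 2 * (g x)\<^sup>2)" by (auto intro!: AE_I2)
  qed
  have u1: "dir_deriv v (w m) x - h x = dir_deriv v (\<phi> m) x - g x" for m x by (simp add: dw h_def)
  have h2: "integrable M (\<lambda>x. (h x)\<^sup>2)"
    using i_sq[OF continuous_on_dir_deriv[OF pC, of v]] by (simp add: h_def power2_commute)
  have hr: "integrable M (\<lambda>x. h x * r x)" if r: "continuous_on UNIV r" for r
  proof -
    obtain B where "\<And>x. x \<in> K \<Longrightarrow> \<bar>r x\<bar> \<le> B" using bd[OF r] by auto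
    note B = this
    show ?thesis
    proof (rule Bochner_Integration.integrable_bound)
      show "integrable M (\<lambda>x. B * (1 + (h x)\<^sup>2))" using h2 by simp
      show "(\<lambda>x. h x * r x) \<in> borel_measurable M" by (intro borel_measurable_times hM cm r)
      have "\<bar>a\<bar> \<le> 1 + a\<^sup>2" for a :: real
        using sum_squares_bound[of 1 "\<bar>a\<bar>"] abs_ge_zero[of a] unfolding power2_abs one_power2 by linarith
      then have le: "\<bar>h x * r x\<bar> \<le> (1 + (h x)\<^sup>2) * B" if "x \<in> K" for x
        unfolding abs_mult using B[OF that] by (intro mult_mono) simp_all
      show "AE x in M. norm (h x * r x) \<le> norm (B * (1 + (h x)\<^sup>2))"
      proof (rule AE_I2)
        fix x assume "x \<in> space M"
        then have "\<bar>h x * r x\<bar> \<le> (1 + (h x)\<^sup>2) * B" using le by (simp add: sp)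
        also have "\<dots> \<le> \<bar>B * (1 + (h x)\<^sup>2)\<bar>" by (simp add: mult.commute)
        finally show "norm (h x * r x) \<le> norm (B * (1 + (h x)\<^sup>2))" by (simp only: real_norm_def)
      qed
    qed
  qed
  have lim: "(\<lambda>m. \<integral>x. dir_deriv v (\<lambda>x. w m x * r x) x \<partial>M) \<longlonglongrightarrow> (\<integral>x. h x * r x \<partial>M)"
    if r: "real_polynomial_function r" for r
  proof -
    note rC = C_k_1_poly[OF r]
    note cr = continuous_on_C_k_1[OF rC] and cdr = continuous_on_dir_deriv[OF rC, of v]
    obtain B where B: "\<And>x. x \<in> K \<Longrightarrow> \<bar>r x\<bar> \<le> B" using bd[OF cr] by auto
    obtain B' where B': "\<And>x. x \<in> K \<Longrightarrow> \<bar>dir_deriv v r x\<bar> \<le> B'" using bd[OF cdr] by auto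
    have mu1: "(\<lambda>x. dir_deriv v (w m) x - h x) \<in> borel_measurable M" for m
      by (intro borel_measurable_diff hM cm continuous_on_dir_deriv wC)
    have sq1: "integrable M (\<lambda>x. (dir_deriv v (w m) x - h x)\<^sup>2)" for m
      unfolding u1 by (rule i_sq[OF continuous_on_dir_deriv[OF \<phi>]])
    have li1: "(\<lambda>m. \<integral>x. (dir_deriv v (w m) x - h x)\<^sup>2 \<partial>M) \<longlonglongrightarrow> 0"
      unfolding u1 using L2g by (simp add: M_def K_def v_def)
    have b1: "\<bar>r x\<bar> \<le> B" if "x \<in> space M" for x using B that by (simp add: sp)
    note L1 = tendsto_integral_mult_zero[OF fM mu1 cm[OF cr] sq1 li1 b1]
    have sq3: "integrable M (\<lambda>x. (w m x)\<^sup>2)" for m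
      by (intro ib continuous_on_power continuous_on_C_k_1[OF wC])
    have li3: "(\<lambda>m. \<integral>x. (w m x)\<^sup>2 \<partial>M) \<longlonglongrightarrow> 0"
      using L2 by (simp add: w_def M_def K_def)
    have b3: "\<bar>dir_deriv v r x\<bar> \<le> B'" if "x \<in> space M" for x using B' that by (simp add: sp)
    note L3 = tendsto_integral_mult_zero[OF fM cm[OF continuous_on_C_k_1[OF wC]] cm[OF cdr] sq3 li3 b3]
    have "(\<integral>x. dir_deriv v (\<lambda>x. w m x * r x) x \<partial>M) = (\<integral>x. (dir_deriv v (w m) x - h x) * r x \<partial>M) + (\<integral>x. w m x * dir_deriv v r x \<partial>M) + (\<integral>x. h x * r x \<partial>M)" for m
    proof -
      have "dir_deriv v (\<lambda>x. w m x * r x) x = (dir_deriv v (w m) x - h x) * r x + w m x * dir_deriv v r x + h x * r x" for x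
        using C_k_1_mult(2)[OF wC rC, of v m x] by (simp add: algebra_simps)
      then show ?thesis using L1(1)[of m] L3(1)[of m] hr[OF cr] by simp
    qed
    moreover have "(\<lambda>m. (\<integral>x. (dir_deriv v (w m) x - h x) * r x \<partial>M) + (\<integral>x. w m x * dir_deriv v r x \<partial>M) + (\<integral>x. h x * r x \<partial>M)) \<longlonglongrightarrow> 0 + 0 + (\<integral>x. h x * r x \<partial>M)"
      by (intro tendsto_add L1(2) L3(2) tendsto_const)
    ultimately show ?thesis by simp
  qed
  have div: "(\<integral>x. dir_deriv v (\<lambda>x. w m x * r x) x \<partial>M) = (\<integral>x. indicator F x * (w m x * r x) \<partial>surface_measure F)"
    if r: "real_polynomial_function r" and r0: "\<And>c' x. c' \<in> C \<Longrightarrow> c' \<noteq> c \<Longrightarrow> l c' x = 0 \<Longrightarrow> r x = 0" for r m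
  proof -
    have wr: "C_k 1 (\<lambda>x. w m x * r x)" by (rule C_k_1_mult(1)[OF wC C_k_1_poly[OF r]])
    let ?S = "\<lambda>c'. (v \<bullet> normal c') * (\<integral>x. indicator {x \<in> K. l c' x = 0} x * (w m x * r x) \<partial>surface_measure {x \<in> K. l c' x = 0})"
    have "(\<integral>x. dir_deriv v (\<lambda>x. w m x * r x) x \<partial>M) = (\<integral>x. indicator K x * dir_deriv v (\<lambda>x. w m x * r x) x \<partial>lborel)"
      unfolding M_def by (intro integral_lebesgue_on_borel Kb borel_measurable_continuous_onI continuous_on_dir_deriv wr)
    also have "\<dots> = (\<Sum>c'\<in>C. ?S c')" unfolding K_def by (rule divergence_simplex[OF wr])
    also have "\<dots> = ?S c + (\<Sum>c'\<in>C-{c}. ?S c')" by (rule sum.remove[OF fin c])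
    also have "(\<Sum>c'\<in>C-{c}. ?S c') = 0"
    proof (rule sum.neutral, rule ballI)
      fix c' assume c': "c' \<in> C - {c}"
      have "indicator {x \<in> K. l c' x = 0} x * (w m x * r x) = 0" for x
        using r0[of c' x] c' by (auto simp: indicator_def)
      then show "?S c' = 0" by (simp only: Bochner_Integration.integral_zero mult_zero_right)
    qed
    also have "v \<bullet> normal c = 1" using norm_normal[OF c] by (simp add: v_def norm_eq_1)
    finally show ?thesis by (simp add: F_def K_def)
  qed
  define \<eta> where "\<eta> j x = 1 - (1 - l c x) ^ j" for j :: nat and x
  have \<eta>p: "real_polynomial_function (\<eta> j)" for j
    unfolding \<eta>_def using l_polynomial[OF c] by (intro real_polynomial_function_diff real_polynomial_function_power real_polynomial_function.intros(2))
  have hq\<eta>: "(\<integral>x. h x * (q x * \<eta> j x) \<partial>M) = 0" for j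
  proof -
    have r: "real_polynomial_function (\<lambda>x. q x * \<eta> j x)" using q \<eta>p by (rule real_polynomial_function.intros(4))
    have "(\<integral>x. dir_deriv v (\<lambda>x. w m x * (q x * \<eta> j x)) x \<partial>M) = 0" for m
    proof -
      have "indicator F x * (w m x * (q x * \<eta> j x)) = 0" for x by (auto simp: F_def indicator_def \<eta>_def)
      moreover have r0: "q x * \<eta> j x = 0" if "c' \<in> C" "c' \<noteq> c" "l c' x = 0" for c' x using q0[OF that] by simp
      ultimately show ?thesis using div[OF r r0, where m=m] by (simp only: Bochner_Integration.integral_zero)
    qed
    then have "(\<lambda>m::nat. 0) \<longlonglongrightarrow> (\<integral>x. h x * (q x * \<eta> j x) \<partial>M)" using lim[OF r] by simp
    then show ?thesis by (rule LIMSEQ_unique) (rule tendsto_const)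
  qed
  have hq: "(\<integral>x. h x * q x \<partial>M) = 0"
  proof -
    have cq: "continuous_on UNIV q" by (rule continuous_on_poly[OF q])
    have "(\<lambda>j. \<integral>x. h x * (q x * \<eta> j x) \<partial>M) \<longlonglongrightarrow> (\<integral>x. h x * q x \<partial>M)"
    proof (rule integral_dominated_convergence[where w="\<lambda>x. \<bar>h x * q x\<bar>"])
      show "(\<lambda>x. h x * q x) \<in> borel_measurable M" by (intro borel_measurable_times hM cm cq)
      show "(\<lambda>x. h x * (q x * \<eta> j x)) \<in> borel_measurable M" for j
        by (intro borel_measurable_times hM cm cq continuous_on_poly \<eta>p)
      show "integrable M (\<lambda>x. \<bar>h x * q x\<bar>)" using hr[OF cq] by simp
      have "{x. l c x = 0} = {x. d c \<bullet> x = - l c 0}"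
      proof (rule Collect_cong)
        show "l c x = 0 \<longleftrightarrow> d c \<bullet> x = - l c 0" for x using l_affine[OF c, of x] by linarith
      qed
      then have "negligible {x. l c x = 0}" using d_nonzero[OF c] negligible_hyperplane[of "d c" "- l c 0"] by simp
      then have neg: "AE x in lebesgue. x \<notin> {x. l c x = 0}"
        by (intro AE_not_in) (simp add: negligible_iff_null_sets)
      have ae: "AE x in M. l c x \<noteq> 0" unfolding M_def
        using Kl neg by (subst AE_restrict_space_iff) (auto elim!: eventually_mono)
      have l01: "0 \<le> l c x" "l c x \<le> 1" if "x \<in> K" for x
        using that c l_le_1[OF c] by (auto simp: K_def convex_hull_eq)
      show "AE x in M. (\<lambda>j. h x * (q x * \<eta> j x)) \<longlonglongrightarrow> h x * q x"
        using ae AE_space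
      proof eventually_elim
        case (elim x)
        then have "0 \<le> l c x" "l c x \<le> 1" "l c x \<noteq> 0" using l01[of x] by (simp_all add: sp)
        then have "norm (1 - l c x) < 1" unfolding real_norm_def by linarith
        then have "(\<lambda>j. (1 - l c x) ^ j) \<longlonglongrightarrow> 0" by (rule LIMSEQ_power_zero)
        then have "(\<lambda>j. h x * (q x * \<eta> j x)) \<longlonglongrightarrow> h x * (q x * (1 - 0))"
          unfolding \<eta>_def by (intro tendsto_mult tendsto_diff tendsto_const)
        then show ?case by simp
      qed
      show "AE x in M. norm (h x * (q x * \<eta> j x)) \<le> \<bar>h x * q x\<bar>" for j
      proof (rule AE_I2)
        fix x assume "x \<in> space M"
        then have l: "0 \<le> 1 - l c x" "1 - l c x \<le> 1" using l01[of x] by (auto simp: sp)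
        then have "\<bar>\<eta> j x\<bar> \<le> 1" using power_le_one[OF l, of j] zero_le_power[OF l(1), of j] by (simp add: \<eta>_def)
        then have "\<bar>h x * q x\<bar> * \<bar>\<eta> j x\<bar> \<le> \<bar>h x * q x\<bar> * 1" by (intro mult_left_mono) auto
        then show "norm (h x * (q x * \<eta> j x)) \<le> \<bar>h x * q x\<bar>" by (simp add: abs_mult mult.assoc)
      qed
    qed
    then have "(\<lambda>j::nat. 0) \<longlonglongrightarrow> (\<integral>x. h x * q x \<partial>M)" using hq\<eta> by simp
    then show ?thesis by (rule LIMSEQ_unique) (rule tendsto_const)
  qed
  have cF: "compact F" unfolding F_def by (rule compact_facet[OF c])
  have intF: "integrable (surface_measure F) (\<lambda>x. indicator F x * f x)" if "continuous_on UNIV f" for f :: "real^'n \<Rightarrow> real"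
    unfolding surface_measure_eq by (intro integrable_flat_measure_compact tangent_frame cF that)
  have "(\<lambda>m. \<integral>x. indicator F x * (w m x * q x) \<partial>surface_measure F) \<longlonglongrightarrow> 0"
    using lim[OF q] div[OF q q0] hq by simp
  moreover have "(\<integral>x. indicator F x * (w m x * q x) \<partial>surface_measure F) =
     (\<integral>x. indicator F x * (\<phi> m x * q x) \<partial>surface_measure F) - (\<integral>x. indicator F x * (p x * q x) \<partial>surface_measure F)" for m
  proof -
    have eq: "indicator F x * (w m x * q x) = indicator F x * (\<phi> m x * q x) - indicator F x * (p x * q x)" for x
      by (simp add: w_def left_diff_distrib right_diff_distrib)
    show ?thesis unfolding eq
      by (intro Bochner_Integration.integral_diff intF continuous_on_mult continuous_on_C_k_1[OF \<phi>] continuous_on_poly p q)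
  qed
  ultimately show ?thesis by (simp add: LIM_zero_iff)
qed

end

section \<open>Positivity of the surface measure\<close>

text \<open>In frame coordinates the set contains a small box around the point \<open>x\<close>.\<close>

lemma flat_measure_rel_open_pos:
  fixes F :: "'a::euclidean_space set"
  assumes on: "pairwise orthogonal T" "\<forall>b\<in>T. norm b = 1" and sp: "span T = span {x - y | x y. x \<in> F \<and> y \<in> F}"
    and a: "a \<in> F" and x: "x \<in> rel_interior F" and U: "open U" "x \<in> U" and F: "F \<in> sets borel"
  shows "emeasure (flat_measure a T) (F \<inter> U) > 0"
proof -
  have finT: "finite T" by (rule orthonormal_independent(2)[OF on])
  have add: "z + v \<in> affine hull F" if "z \<in> affine hull F" "v \<in> span T" for z v
    using affine_hull_add_direction[OF that(1)] that(2) sp by simp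
  obtain e where e: "e > 0" "ball x e \<inter> affine hull F \<subseteq> F" using x by (auto simp: mem_rel_interior_ball)
  obtain e' where e': "e' > 0" "ball x e' \<subseteq> U" using U open_contains_ball by blast
  \<comment> \<open>The sum of \<open>card T\<close> coordinate deviations of size \<open>\<delta>\<close> stays below both radii.\<close>
  define \<delta> where "\<delta> = min e e' / (real (card T) + 1)"
  have \<delta>: "\<delta> > 0" using e(1) e'(1) by (simp add: \<delta>_def add_nonneg_pos)
  have "x \<in> F" using x rel_interior_subset by blast
  then have "x - a \<in> span T" unfolding sp using a by (intro span_base) blast
  define y0 where "y0 b = (x - a) \<bullet> b" for b
  have y0: "(\<Sum>b\<in>T. y0 b *\<^sub>R b) = x - a"
    unfolding y0_def using \<open>x - a \<in> span T\<close> orthonormal_basis_expand[OF on(1)] on(2) finT by auto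
  let ?f = "\<lambda>y. a + (\<Sum>t\<in>T. y t *\<^sub>R t)"
  have in_FU: "?f y \<in> F \<inter> U" if y: "\<And>t. t \<in> T \<Longrightarrow> y t \<in> {y0 t - \<delta>..y0 t + \<delta>}" for y
  proof -
    have "?f y - x = (\<Sum>t\<in>T. (y t - y0 t) *\<^sub>R t)"
      by (simp add: scaleR_diff_left sum_subtractf y0)
    also have "norm \<dots> \<le> (\<Sum>t\<in>T. \<delta>)"
    proof (rule sum_norm_le)
      fix t assume "t \<in> T"
      then show "norm ((y t - y0 t) *\<^sub>R t) \<le> \<delta>" using y[of t] on(2) by (simp add: abs_le_iff)
    qed
    also have "\<dots> < (real (card T) + 1) * \<delta>" using \<delta> by (simp add: algebra_simps)
    also have "\<dots> = min e e'" by (simp add: \<delta>_def add_nonneg_pos)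
    finally have n: "norm (?f y - x) < min e e'" .
    have "?f y \<in> affine hull F"
      using a by (intro add span_sum span_scale span_base) (auto simp: hull_inc)
    then show ?thesis using n e(2) e'(2) by (auto simp: dist_norm norm_minus_commute)
  qed
  have "0 < (\<Prod>t\<in>T. emeasure lborel {y0 t - \<delta>..y0 t + \<delta>})"
    using \<delta> finT by (simp add: prod_pos zero_less_iff_neq_zero)
  also have "\<dots> = emeasure (\<Pi>\<^sub>M t\<in>T. lborel) (Pi\<^sub>E T (\<lambda>t. {y0 t - \<delta>..y0 t + \<delta>}))"
    using finT by (intro lborel_product.emeasure_PiM[symmetric]) auto
  also have "\<dots> \<le> emeasure (\<Pi>\<^sub>M t\<in>T. lborel) (?f -` (F \<inter> U) \<inter> space (\<Pi>\<^sub>M t\<in>T. lborel))"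
  proof (rule emeasure_mono)
    show "Pi\<^sub>E T (\<lambda>t. {y0 t - \<delta>..y0 t + \<delta>}) \<subseteq> ?f -` (F \<inter> U) \<inter> space (\<Pi>\<^sub>M t\<in>T. lborel)"
      using in_FU by (auto simp: space_PiM PiE_iff)
    show "?f -` (F \<inter> U) \<inter> space (\<Pi>\<^sub>M t\<in>T. lborel) \<in> sets (\<Pi>\<^sub>M t\<in>T. lborel)"
      using F U(1) by (intro measurable_sets[OF measurable_frame]) auto
  qed
  also have "\<dots> = emeasure (flat_measure a T) (F \<inter> U)"
    unfolding flat_measure_def using F U(1) by (subst emeasure_distr) auto
  finally show ?thesis .
qed

lemma zero_on_rel_interior_if_integral_zero:
  fixes F :: "(real^'n) set" and f :: "real^'n \<Rightarrow> real"
  assumes F: "compact F" "F \<noteq> {}" and f: "continuous_on UNIV f" and nn: "\<And>x. x \<in> F \<Longrightarrow> 0 \<le> f x"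
    and int: "(\<integral>x. indicator F x * f x \<partial>surface_measure F) = 0" and x: "x \<in> rel_interior F"
  shows "f x = 0"
proof (rule ccontr)
  assume "f x \<noteq> 0"
  moreover have "x \<in> F" using x rel_interior_subset by blast
  ultimately have fx: "0 < f x" using nn[of x] by (simp add: less_le)
  let ?T = "tangent_frame F" and ?a = "SOME a. a \<in> F"
  have a: "?a \<in> F" using F(2) by (simp add: some_in_eq)
  note on = tangent_frame[of F]
  define U where "U = {x. 0 < f x}"
  have U: "open U" unfolding U_def by (intro open_Collect_less continuous_on_const f)
  have Fb: "F \<in> sets borel" using F(1) by (rule borel_compact)
  have i: "integrable (surface_measure F) (\<lambda>x. indicator F x * f x)"
    unfolding surface_measure_eq by (intro integrable_flat_measure_compact on F f)
  have "AE x in surface_measure F. indicator F x * f x = 0"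
    using int integral_nonneg_eq_0_iff_AE[OF i] nn by (auto simp: indicator_def)
  then have "AE x in surface_measure F. x \<notin> F \<inter> U"
    by eventually_elim (auto simp: U_def)
  then have "F \<inter> U \<in> null_sets (surface_measure F)"
    using Fb U by (subst AE_iff_null_sets) (auto simp: surface_measure_eq)
  moreover have "emeasure (surface_measure F) (F \<inter> U) > 0"
    unfolding surface_measure_eq
    by (rule flat_measure_rel_open_pos[OF on a x U _ Fb]) (simp add: U_def fx)
  ultimately show False by (auto simp: null_sets_def)
qed

section \<open>Traces of functions in the Sobolev space\<close>

text \<open>A domain that lies locally above the graph of a continuous function has exterior points, below the
  graph, arbitrarily close to any boundary point.  This excludes slits, and makes the interior of every element a part of
  the domain.\<close>

lemma lipschitz_boundary_interior_closure:
  fixes \<Omega> :: "(real^'n) set"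
  assumes op: "open \<Omega>" and lip: "lipschitz_boundary \<Omega>"
  shows "interior (closure \<Omega>) = \<Omega>"
proof
  show "\<Omega> \<subseteq> interior (closure \<Omega>)" using op closure_subset by (rule interior_maximal[rotated])
  show "interior (closure \<Omega>) \<subseteq> \<Omega>"
  proof (rule ccontr)
    assume "\<not> interior (closure \<Omega>) \<subseteq> \<Omega>"
    then obtain x where x: "x \<in> interior (closure \<Omega>)" "x \<notin> \<Omega>" by auto
    then have "x \<in> frontier \<Omega>" using op interior_subset by (auto simp: frontier_def interior_open)
    then obtain r e L \<gamma> where r: "r > 0" and e: "norm e = 1" and \<gamma>: "L-lipschitz_on {y. y \<bullet> e = 0} \<gamma>"
      and eq: "\<Omega> \<inter> ball x r = {y \<in> ball x r. \<gamma> (y - (y \<bullet> e) *\<^sub>R e) < y \<bullet> e}"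
      using lip unfolding lipschitz_boundary_def by blast
    have ee: "e \<bullet> e = 1" using e by (simp add: norm_eq_1)
    obtain s where s: "s > 0" "ball x s \<subseteq> closure \<Omega>" using x(1) by (auto simp: mem_interior)
    define \<tau> where "\<tau> = min r s / 2"
    have \<tau>: "\<tau> > 0" "\<tau> < r" "\<tau> < s" using r s by (auto simp: \<tau>_def)
    \<comment> \<open>The function \<open>F\<close> is negative exactly on the part of \<open>\<Omega>\<close> near \<open>x\<close>; going down from \<open>x\<close> makes it positive.\<close>
    define z where "z = x - \<tau> *\<^sub>R e"
    define F where "F y = \<gamma> (y - (y \<bullet> e) *\<^sub>R e) - y \<bullet> e" for y
    have cF: "continuous_on UNIV F" unfolding F_def
    proof (intro continuous_on_diff)
      show "continuous_on UNIV (\<lambda>y. \<gamma> (y - (y \<bullet> e) *\<^sub>R e))"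
        by (rule continuous_on_compose2[OF lipschitz_on_continuous_on[OF \<gamma>]])
          (auto intro!: continuous_intros simp: inner_diff_left ee)
    qed (intro continuous_intros)
    have xb: "x \<notin> \<Omega> \<inter> ball x r" using x by simp
    have "0 \<le> F x" using xb r unfolding eq F_def by auto
    moreover have "F z = F x + \<tau>"
    proof -
      have "z \<bullet> e = x \<bullet> e - \<tau>" by (simp add: z_def inner_diff_left ee)
      then have "z - (z \<bullet> e) *\<^sub>R e = x - (x \<bullet> e) *\<^sub>R e" by (simp add: z_def algebra_simps)
      then show ?thesis using \<open>z \<bullet> e = x \<bullet> e - \<tau>\<close> by (simp add: F_def)
    qed
    ultimately have "0 < F z" using \<tau> by simp
    define U where "U = {y. 0 < F y} \<inter> ball x r"
    have "open U" unfolding U_def by (intro open_Int open_ball open_Collect_less continuous_on_const cF)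
    moreover have "z \<in> U" using \<open>0 < F z\<close> \<tau> e by (simp add: U_def z_def dist_norm)
    moreover have "U \<inter> \<Omega> = {}"
    proof -
      have False if "y \<in> U" "y \<in> \<Omega>" for y
      proof -
        have "y \<in> \<Omega> \<inter> ball x r" using that by (simp add: U_def)
        then have "F y < 0" unfolding eq by (simp add: F_def)
        then show False using that by (simp add: U_def)
      qed
      then show ?thesis by blast
    qed
    ultimately have "z \<notin> closure \<Omega>" by (auto simp: closure_iff_nhds_not_empty)
    moreover have "z \<in> ball x s" using \<tau> e by (simp add: z_def dist_norm)
    ultimately show False using s by blast
  qed
qed

lemma square_integrable_diff:
  fixes f g :: "real^'n \<Rightarrow> 'b::euclidean_space"
  assumes \<Omega>: "open \<Omega>" "bounded \<Omega>" and f: "continuous_on UNIV f" and g: "square_integrable_on \<Omega> g"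
  shows "(\<lambda>x. f x - g x) \<in> borel_measurable (lebesgue_on \<Omega>)"
    "integrable (lebesgue_on \<Omega>) (\<lambda>x. (norm (f x - g x))\<^sup>2)"
proof -
  have gm: "g \<in> borel_measurable (lebesgue_on \<Omega>)" and gi: "integrable (lebesgue_on \<Omega>) (\<lambda>x. (norm (g x))\<^sup>2)"
    using g by (auto simp: square_integrable_on_def)
  have fm: "f \<in> borel_measurable (lebesgue_on \<Omega>)"
    using borel_measurable_continuous_onI[OF f] by (intro measurable_restrict_space1) (simp add: measurable_completion)
  show m: "(\<lambda>x. f x - g x) \<in> borel_measurable (lebesgue_on \<Omega>)" by (intro borel_measurable_diff fm gm)
  interpret finite_measure "lebesgue_on \<Omega>"
    using \<Omega> by (intro finite_measure_lebesgue_on lmeasurable_open)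
  have "compact (closure \<Omega>)" using \<Omega> by (simp add: compact_closure)
  moreover have "continuous_on UNIV (\<lambda>x. (norm (f x))\<^sup>2)" by (intro continuous_on_power continuous_on_norm f)
  ultimately obtain B where B: "\<And>x. x \<in> closure \<Omega> \<Longrightarrow> \<bar>(norm (f x))\<^sup>2\<bar> \<le> B"
    using continuous_bounded_on_compact by blast
  show "integrable (lebesgue_on \<Omega>) (\<lambda>x. (norm (f x - g x))\<^sup>2)"
  proof (rule Bochner_Integration.integrable_bound)
    show "integrable (lebesgue_on \<Omega>) (\<lambda>x. 2 * B + 2 * (norm (g x))\<^sup>2)" using gi by simp
    show "(\<lambda>x. (norm (f x - g x))\<^sup>2) \<in> borel_measurable (lebesgue_on \<Omega>)"
      using m by measurable
    show "AE x in lebesgue_on \<Omega>. norm ((norm (f x - g x))\<^sup>2) \<le> norm (2 * B + 2 * (norm (g x))\<^sup>2)"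
    proof (rule AE_I2)
      fix x assume "x \<in> space (lebesgue_on \<Omega>)"
      then have b: "(norm (f x))\<^sup>2 \<le> B" using B[of x] closure_subset[of \<Omega>] by auto
      have "(norm (f x - g x))\<^sup>2 \<le> (norm (f x) + norm (g x))\<^sup>2"
        by (intro power_mono norm_triangle_ineq4) simp
      also have "\<dots> \<le> 2 * (norm (f x))\<^sup>2 + 2 * (norm (g x))\<^sup>2"
        using sum_squares_bound[of "norm (f x)" "norm (g x)"] by (simp add: power2_sum)
      finally have "(norm (f x - g x))\<^sup>2 \<le> 2 * B + 2 * (norm (g x))\<^sup>2" using b by simp
      then show "norm ((norm (f x - g x))\<^sup>2) \<le> norm (2 * B + 2 * (norm (g x))\<^sup>2)" by simp
    qed
  qed
qed

lemma norm_L2_square: "(norm_L2 S f)\<^sup>2 = (LINT x|lebesgue_on S. (norm (f x))\<^sup>2)"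
  unfolding norm_L2_def by (intro real_sqrt_pow2 Bochner_Integration.integral_nonneg) simp

lemma AE_interior_convex:
  fixes K :: "(real^'n) set"
  assumes K: "compact K" "convex K"
  shows "AE x in lebesgue_on K. x \<in> interior K"
proof -
  have Kl: "K \<in> sets lebesgue" using K(1) by (intro lmeasurable_compact[THEN fmeasurableD])
  have "negligible (frontier K)" using K(2) by (rule negligible_convex_frontier)
  then have "AE x in lebesgue. x \<notin> frontier K" by (intro AE_not_in) (simp add: negligible_iff_null_sets)
  then have "AE x in lebesgue. x \<in> K \<longrightarrow> x \<in> interior K"
    by eventually_elim (use compact_imp_closed[OF K(1)] in \<open>auto simp: frontier_def closure_closed\<close>)
  then show ?thesis using Kl by (simp add: AE_restrict_space_iff)
qed

lemma integral_lebesgue_on_le: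
  fixes f g :: "real^'n \<Rightarrow> real"
  assumes K: "compact K" "convex K" "interior K \<subseteq> \<Omega>" and \<Omega>: "open \<Omega>"
    and g: "integrable (lebesgue_on \<Omega>) g" and g0: "\<And>x. 0 \<le> g x"
    and le: "AE x in lebesgue_on K. f x \<le> g x"
  shows "(\<integral>x. f x \<partial>lebesgue_on K) \<le> (\<integral>x. g x \<partial>lebesgue_on \<Omega>)"
proof -
  have Kl: "K \<in> sets lebesgue" using K(1) by (intro lmeasurable_compact[THEN fmeasurableD])
  have \<Omega>l: "\<Omega> \<in> sets lebesgue" using \<Omega> by (simp add: borel_open sets_completionI_sets)
  have "(\<integral>x. f x \<partial>lebesgue_on K) = (\<integral>x. indicator K x * f x \<partial>lebesgue)"
    using Kl by (subst integral_restrict_space) auto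
  also have "\<dots> \<le> (\<integral>x. indicator \<Omega> x * g x \<partial>lebesgue)"
  proof (rule integral_mono_AE')
    show "integrable lebesgue (\<lambda>x. indicator \<Omega> x * g x)"
      using g \<Omega>l by (subst (asm) integrable_restrict_space) auto
    have "AE x in lebesgue. x \<in> K \<longrightarrow> x \<in> interior K"
      using AE_interior_convex[OF K(1,2)] Kl by (simp add: AE_restrict_space_iff)
    moreover have "AE x in lebesgue. x \<in> K \<longrightarrow> f x \<le> g x" using le Kl by (simp add: AE_restrict_space_iff)
    ultimately show "AE x in lebesgue. indicator K x * f x \<le> indicator \<Omega> x * g x"
      by eventually_elim (use g0 K(3) in \<open>auto simp: indicator_def\<close>)
    show "AE x in lebesgue. 0 \<le> indicator \<Omega> x * g x" using g0 by auto
  qed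
  also have "\<dots> = (\<integral>x. g x \<partial>lebesgue_on \<Omega>)"
    using \<Omega>l by (subst integral_restrict_space) auto
  finally show ?thesis .
qed

text \<open>One sequence of test functions serves all elements.  This is what allows comparing the traces from
  both sides of a facet.\<close>

lemma H1_0_trace_sequence:
  fixes v :: "real^'n \<Rightarrow> real"
  assumes \<Omega>: "open \<Omega>" "bounded \<Omega>" and v: "v \<in> H1_0 \<Omega>"
  obtains \<phi> where "\<And>m::nat. \<phi> m \<in> test_functions \<Omega>"
    "\<And>C l d c p q. \<lbrakk>barycentric C l d; interior (convex hull C) \<subseteq> \<Omega>; real_polynomial_function p;
       AE x in lebesgue_on (convex hull C). v x = p x; c \<in> C; real_polynomial_function q;
       \<And>c' x. c' \<in> C \<Longrightarrow> c' \<noteq> c \<Longrightarrow> l c' x = 0 \<Longrightarrow> q x = 0\<rbrakk> \<Longrightarrow>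
     (\<lambda>m. \<integral>x. indicator {x \<in> convex hull C. l c x = 0} x * (\<phi> m x * q x) \<partial>surface_measure {x \<in> convex hull C. l c x = 0})
     \<longlonglongrightarrow> (\<integral>x. indicator {x \<in> convex hull C. l c x = 0} x * (p x * q x) \<partial>surface_measure {x \<in> convex hull C. l c x = 0})"
proof -
  obtain g \<phi> where vs: "square_integrable_on \<Omega> v" and gs: "square_integrable_on \<Omega> g" and \<phi>: "\<And>m::nat. \<phi> m \<in> test_functions \<Omega>"
    and l1: "(\<lambda>m. norm_L2 \<Omega> (\<lambda>x. \<phi> m x - v x)) \<longlonglongrightarrow> 0" and l2: "(\<lambda>m. norm_L2 \<Omega> (\<lambda>x. grad (\<phi> m) x - g x)) \<longlonglongrightarrow> 0"
    using v unfolding H1_0_def by blast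
  have \<phi>C: "C_k 1 (\<phi> m)" for m using \<phi>[of m] by (auto simp: test_functions_def simp del: One_nat_def)
  have L1: "(\<lambda>m. \<integral>x. (norm (\<phi> m x - v x))\<^sup>2 \<partial>lebesgue_on \<Omega>) \<longlonglongrightarrow> 0"
    using tendsto_power[OF l1, of 2] by (simp add: norm_L2_square)
  have L2: "(\<lambda>m. \<integral>x. (norm (grad (\<phi> m) x - g x))\<^sup>2 \<partial>lebesgue_on \<Omega>) \<longlonglongrightarrow> 0"
    using tendsto_power[OF l2, of 2] by (simp add: norm_L2_square)
  have cg: "continuous_on UNIV (grad (\<phi> m))" for m
    unfolding grad_def[abs_def] by (intro continuous_on_vec_lambda continuous_on_dir_deriv \<phi>C)
  note dg = grad_inner[OF \<phi>C, symmetric]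
  note i1 = square_integrable_diff(2)[OF \<Omega> continuous_on_C_k_1[OF \<phi>C] vs]
  note i2 = square_integrable_diff(2)[OF \<Omega> cg gs]
  show thesis
  proof (rule that[OF \<phi>])
    fix C l d c p q
    assume "barycentric C l d" and K: "interior (convex hull C) \<subseteq> \<Omega>" and p: "real_polynomial_function p"
      and ae: "AE x in lebesgue_on (convex hull C). v x = p x" and c: "c \<in> C" and q: "real_polynomial_function q"
      and q0: "\<And>c' x. c' \<in> C \<Longrightarrow> c' \<noteq> c \<Longrightarrow> l c' x = 0 \<Longrightarrow> q x = 0"
    interpret barycentric C l d by fact
    let ?K = "convex hull C"
    define n where "n = normal c"
    have nn: "norm n = 1" using norm_normal[OF c] by (simp add: n_def)
    note le = integral_lebesgue_on_le[OF compact_hull convex_convex_hull K \<Omega>(1)]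
    have A: "(\<lambda>m. \<integral>x. (\<phi> m x - p x)\<^sup>2 \<partial>lebesgue_on ?K) \<longlonglongrightarrow> 0"
    proof (rule tendsto_sandwich[OF _ _ tendsto_const L1])
      show "\<forall>\<^sub>F m in sequentially. 0 \<le> (\<integral>x. (\<phi> m x - p x)\<^sup>2 \<partial>lebesgue_on ?K)"
        by (auto intro!: always_eventually)
      have "(\<integral>x. (\<phi> m x - p x)\<^sup>2 \<partial>lebesgue_on ?K) \<le> (\<integral>x. (norm (\<phi> m x - v x))\<^sup>2 \<partial>lebesgue_on \<Omega>)" for m
        using ae by (intro le i1) (auto elim!: eventually_mono)
      then show "\<forall>\<^sub>F m in sequentially. (\<integral>x. (\<phi> m x - p x)\<^sup>2 \<partial>lebesgue_on ?K) \<le> (\<integral>x. (norm (\<phi> m x - v x))\<^sup>2 \<partial>lebesgue_on \<Omega>)"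
        by simp
    qed
    \<comment> \<open>The gradient \<open>g\<close> is only meaningful on \<open>\<Omega>\<close>, while the element may touch the boundary.\<close>
    define g' where "g' x = (if x \<in> \<Omega> then g x \<bullet> n else 0)" for x
    have \<Omega>l: "\<Omega> \<in> sets lebesgue" using \<Omega>(1) by (simp add: borel_open sets_completionI_sets)
    have Kl: "?K \<in> sets lebesgue" using compact_hull by (intro lmeasurable_compact[THEN fmeasurableD])
    have "(\<lambda>x. g x \<bullet> n) \<in> borel_measurable (lebesgue_on \<Omega>)"
      using gs unfolding square_integrable_on_def by (intro borel_measurable_inner) auto
    then have "(\<lambda>x. indicator \<Omega> x *\<^sub>R (g x \<bullet> n)) \<in> borel_measurable lebesgue"
      using \<Omega>l by (subst (asm) borel_measurable_restrict_space_iff) auto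
    moreover have "g' = (\<lambda>x. indicator \<Omega> x *\<^sub>R (g x \<bullet> n))" by (auto simp: g'_def indicator_def)
    ultimately have gm: "g' \<in> borel_measurable lebesgue" by simp
    have gn: "(g' x)\<^sup>2 \<le> (norm (g x))\<^sup>2" if "x \<in> \<Omega>" for x
      using Cauchy_Schwarz_ineq2[of "g x" n] nn that unfolding g'_def
      by (metis abs_le_square_iff abs_norm_cancel mult.right_neutral)
    have gi: "integrable (lebesgue_on ?K) (\<lambda>x. (g' x)\<^sup>2)"
    proof -
      have "integrable lebesgue (\<lambda>x. indicator \<Omega> x * (norm (g x))\<^sup>2)"
        using gs \<Omega>l unfolding square_integrable_on_def by (subst (asm) integrable_restrict_space) auto
      then have "integrable lebesgue (\<lambda>x. indicator ?K x * (g' x)\<^sup>2)"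
      proof (rule Bochner_Integration.integrable_bound)
        show "(\<lambda>x. indicator ?K x * (g' x)\<^sup>2) \<in> borel_measurable lebesgue"
          using gm Kl by measurable
        show "AE x in lebesgue. norm (indicator ?K x * (g' x)\<^sup>2) \<le> norm (indicator \<Omega> x * (norm (g x))\<^sup>2)"
          using gn by (intro AE_I2) (auto simp: indicator_def g'_def)
      qed
      then show ?thesis using Kl by (subst integrable_restrict_space) auto
    qed
    have B: "(\<lambda>m. \<integral>x. (dir_deriv n (\<phi> m) x - g' x)\<^sup>2 \<partial>lebesgue_on ?K) \<longlonglongrightarrow> 0"
    proof (rule tendsto_sandwich[OF _ _ tendsto_const L2])
      show "\<forall>\<^sub>F m in sequentially. 0 \<le> (\<integral>x. (dir_deriv n (\<phi> m) x - g' x)\<^sup>2 \<partial>lebesgue_on ?K)"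
        by (auto intro!: always_eventually)
      have pt: "(dir_deriv n (\<phi> m) x - g' x)\<^sup>2 \<le> (norm (grad (\<phi> m) x - g x))\<^sup>2" if "x \<in> \<Omega>" for m x
      proof -
        have "dir_deriv n (\<phi> m) x - g' x = (grad (\<phi> m) x - g x) \<bullet> n"
          using that by (simp add: dg g'_def inner_diff_left)
        moreover have "\<bar>(grad (\<phi> m) x - g x) \<bullet> n\<bar> \<le> norm (grad (\<phi> m) x - g x)"
          using Cauchy_Schwarz_ineq2[of "grad (\<phi> m) x - g x" n] nn by simp
        ultimately show ?thesis by (simp add: abs_le_square_iff[symmetric])
      qed
      have "(\<integral>x. (dir_deriv n (\<phi> m) x - g' x)\<^sup>2 \<partial>lebesgue_on ?K) \<le> (\<integral>x. (norm (grad (\<phi> m) x - g x))\<^sup>2 \<partial>lebesgue_on \<Omega>)" for m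
      proof (rule le[OF i2])
        show "AE x in lebesgue_on ?K. (dir_deriv n (\<phi> m) x - g' x)\<^sup>2 \<le> (norm (grad (\<phi> m) x - g x))\<^sup>2"
          using AE_interior_convex[OF compact_hull convex_convex_hull] by eventually_elim (use K pt in blast)
      qed auto
      then show "\<forall>\<^sub>F m in sequentially. (\<integral>x. (dir_deriv n (\<phi> m) x - g' x)\<^sup>2 \<partial>lebesgue_on ?K) \<le> (\<integral>x. (norm (grad (\<phi> m) x - g x))\<^sup>2 \<partial>lebesgue_on \<Omega>)"
        by simp
    qed
    show "(\<lambda>m. \<integral>x. indicator {x \<in> convex hull C. l c x = 0} x * (\<phi> m x * q x) \<partial>surface_measure {x \<in> convex hull C. l c x = 0})
     \<longlonglongrightarrow> (\<integral>x. indicator {x \<in> convex hull C. l c x = 0} x * (p x * q x) \<partial>surface_measure {x \<in> convex hull C. l c x = 0})"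
      by (rule trace_limit[OF c \<phi>C p q q0 A _ gi B[unfolded n_def]])
        (assumption | rule measurable_restrict_space1 gm)+
  qed
qed

context barycentric begin

text \<open>Up to a factor, the bubble function of the facet opposite to \<open>c\<close>: it vanishes on the other facets.\<close>

definition weight :: "real^'n \<Rightarrow> real^'n \<Rightarrow> real" where
  "weight c x = (\<Prod>c'\<in>C - {c}. l c' x)"

lemma weight_polynomial: "real_polynomial_function (weight c)"
  unfolding weight_def[abs_def] using fin by (intro real_polynomial_function_prod l_polynomial) auto

lemma weight_nonneg: "x \<in> convex hull C \<Longrightarrow> 0 \<le> weight c x"
  unfolding weight_def by (intro prod_nonneg) (auto simp: convex_hull_eq)

lemma weight_pos: "c \<in> C \<Longrightarrow> x \<in> rel_interior (facet c) \<Longrightarrow> 0 < weight c x"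
  unfolding weight_def by (intro prod_pos) (auto intro: rel_interior_facet_pos)

lemma weight_zero: "c' \<in> C \<Longrightarrow> c' \<noteq> c \<Longrightarrow> l c' x = 0 \<Longrightarrow> weight c x = 0"
  unfolding weight_def using fin by (intro prod_zero) auto

lemma convex_facet: "c \<in> C \<Longrightarrow> convex (facet c)"
  by (simp add: facet_eq[symmetric])

lemma facet_nonempty: "c \<in> C \<Longrightarrow> (facet c) \<noteq> {}"
  using other_vertex[of c] vertex_in_facet[of _ c] by blast

end

text \<open>The integrand \<open>Q w\<^sup>2\<close> is continuous and nonnegative on \<open>F\<close>, and \<open>Q\<close> is positive on its relative
  interior.\<close>

lemma poly_zero_on_facet:
  fixes F :: "(real^'n) set"
  assumes F: "compact F" "convex F" "F \<noteq> {}" and w: "real_polynomial_function w" and Q: "real_polynomial_function Q"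
    and Q0: "\<And>x. x \<in> F \<Longrightarrow> 0 \<le> Q x" and Q1: "\<And>x. x \<in> rel_interior F \<Longrightarrow> 0 < Q x"
    and int: "(\<integral>x. indicator F x * (w x * (Q x * w x)) \<partial>surface_measure F) = 0" and y: "y \<in> affine hull F"
  shows "w y = 0"
proof (rule poly_zero_on_affine_hull[OF w F(2) _ y])
  fix x assume x: "x \<in> rel_interior F"
  have "w x * (Q x * w x) = 0"
  proof (rule zero_on_rel_interior_if_integral_zero[OF F(1,3) _ _ int x])
    show "continuous_on UNIV (\<lambda>x. w x * (Q x * w x))" by (intro continuous_on_mult continuous_on_poly w Q)
    show "0 \<le> w x * (Q x * w x)" if "x \<in> F" for x
      using mult_nonneg_nonneg[OF Q0[OF that] zero_le_square[of "w x"]] by (simp add: mult.left_commute)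
  qed
  then show "w x = 0" using Q1[OF x] by simp
qed

text \<open>Test functions vanish on the boundary of the domain, and the trace of \<open>v\<close> is their limit.\<close>

lemma H1_0_zero_on_boundary_facet:
  fixes v :: "real^'n \<Rightarrow> real"
  assumes \<Omega>: "open \<Omega>" "bounded \<Omega>" and v: "v \<in> H1_0 \<Omega>" and "barycentric C l d" and K: "interior (convex hull C) \<subseteq> \<Omega>"
    and p: "real_polynomial_function p" and ae: "AE x in lebesgue_on (convex hull C). v x = p x" and c: "c \<in> C"
    and fr: "{x \<in> convex hull C. l c x = 0} \<subseteq> frontier \<Omega>" and y: "y \<in> affine hull {x \<in> convex hull C. l c x = 0}"
  shows "p y = 0"
proof -
  interpret barycentric C l d by fact
  let ?F = "{x \<in> convex hull C. l c x = 0}"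
  obtain \<phi> where \<phi>: "\<And>m::nat. \<phi> m \<in> test_functions \<Omega>" and
    lim: "\<And>q. real_polynomial_function q \<Longrightarrow> (\<And>c' x. c' \<in> C \<Longrightarrow> c' \<noteq> c \<Longrightarrow> l c' x = 0 \<Longrightarrow> q x = 0) \<Longrightarrow>
     (\<lambda>m. \<integral>x. indicator ?F x * (\<phi> m x * q x) \<partial>surface_measure ?F) \<longlonglongrightarrow> (\<integral>x. indicator ?F x * (p x * q x) \<partial>surface_measure ?F)"
  proof (rule H1_0_trace_sequence[OF \<Omega> v], goal_cases)
    case (1 \<phi>)
    show ?case
      by (rule 1(1)[of \<phi>]) (use 1(2) 1(3)[OF \<open>barycentric C l d\<close> K p ae c] in blast)+
  qed
  have z0: "indicator ?F x * (\<phi> m x * q) = 0" for x m q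
  proof (cases "x \<in> ?F")
    case True
    then have "x \<notin> \<Omega>" using fr frontier_disjoint_eq[of \<Omega>] \<Omega>(1) by blast
    then have "\<phi> m x = 0" using \<phi>[of m] closure_subset[of "{x. \<phi> m x \<noteq> 0}"] by (auto simp: test_functions_def)
    then show ?thesis by simp
  qed simp
  have wp: "real_polynomial_function (\<lambda>x. weight c x * p x)" using weight_polynomial p by (rule real_polynomial_function.intros(4))
  have "weight c x * p x = 0" if "c' \<in> C" "c' \<noteq> c" "l c' x = 0" for c' x using weight_zero[OF that] by simp
  from lim[OF wp this] have "(\<lambda>m::nat. 0::real) \<longlonglongrightarrow> (\<integral>x. indicator ?F x * (p x * (weight c x * p x)) \<partial>surface_measure ?F)"
    unfolding z0 by simp
  then have "(\<integral>x. indicator ?F x * (p x * (weight c x * p x)) \<partial>surface_measure ?F) = 0"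
    by (rule LIMSEQ_unique) (rule tendsto_const)
  from poly_zero_on_facet[OF compact_facet convex_facet facet_nonempty p weight_polynomial _ _ this y] c
  show ?thesis using weight_nonneg weight_pos by blast
qed

text \<open>The product of the weights of both elements is admissible as a factor of the test polynomial on either
  side, so the same integrals over \<open>F\<close> converge to those of \<open>p\<close> and to those of \<open>p'\<close>.\<close>

lemma H1_0_continuous_across_facet:
  fixes v :: "real^'n \<Rightarrow> real"
  assumes \<Omega>: "open \<Omega>" "bounded \<Omega>" and v: "v \<in> H1_0 \<Omega>"
    and b: "barycentric C l d" and K: "interior (convex hull C) \<subseteq> \<Omega>"
    and p: "real_polynomial_function p" and ae: "AE x in lebesgue_on (convex hull C). v x = p x" and c: "c \<in> C"
    and b': "barycentric C' l' d'" and K': "interior (convex hull C') \<subseteq> \<Omega>"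
    and p': "real_polynomial_function p'" and ae': "AE x in lebesgue_on (convex hull C'). v x = p' x" and c': "c' \<in> C'"
    and F: "F = {x \<in> convex hull C. l c x = 0}" and F': "F = {x \<in> convex hull C'. l' c' x = 0}"
    and y: "y \<in> affine hull F"
  shows "p y = p' y"
proof -
  interpret barycentric C l d by fact
  interpret N: barycentric C' l' d' by fact
  obtain \<phi> where lim: "\<And>q. real_polynomial_function q \<Longrightarrow> (\<And>a x. a \<in> C \<Longrightarrow> a \<noteq> c \<Longrightarrow> l a x = 0 \<Longrightarrow> q x = 0) \<Longrightarrow>
     (\<lambda>m::nat. \<integral>x. indicator F x * (\<phi> m x * q x) \<partial>surface_measure F) \<longlonglongrightarrow> (\<integral>x. indicator F x * (p x * q x) \<partial>surface_measure F)"
   and lim': "\<And>q. real_polynomial_function q \<Longrightarrow> (\<And>a x. a \<in> C' \<Longrightarrow> a \<noteq> c' \<Longrightarrow> l' a x = 0 \<Longrightarrow> q x = 0) \<Longrightarrow>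
     (\<lambda>m. \<integral>x. indicator F x * (\<phi> m x * q x) \<partial>surface_measure F) \<longlonglongrightarrow> (\<integral>x. indicator F x * (p' x * q x) \<partial>surface_measure F)"
  proof (rule H1_0_trace_sequence[OF \<Omega> v], goal_cases)
    case (1 \<phi>)
    show ?case
      by (rule 1(1)[of \<phi>]) (use 1(3)[OF b K p ae c, folded F] 1(3)[OF b' K' p' ae' c', folded F'] in blast)+
  qed
  define w where "w x = p x - p' x" for x
  have w: "real_polynomial_function w" unfolding w_def using p p' by (rule real_polynomial_function_diff)
  define Q where "Q x = weight c x * N.weight c' x" for x
  have Q: "real_polynomial_function Q" unfolding Q_def using weight_polynomial N.weight_polynomial by (rule real_polynomial_function.intros(4))
  have Qw: "real_polynomial_function (\<lambda>x. Q x * w x)" using Q w by (rule real_polynomial_function.intros(4))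
  have z: "Q x * w x = 0" if "a \<in> C" "a \<noteq> c" "l a x = 0" for a x using weight_zero[OF that] by (simp add: Q_def)
  have z': "Q x * w x = 0" if "a \<in> C'" "a \<noteq> c'" "l' a x = 0" for a x using N.weight_zero[OF that] by (simp add: Q_def)
  have e: "(\<integral>x. indicator F x * (p x * (Q x * w x)) \<partial>surface_measure F) = (\<integral>x. indicator F x * (p' x * (Q x * w x)) \<partial>surface_measure F)"
    using lim[OF Qw z] lim'[OF Qw z'] by (rule LIMSEQ_unique)
  have i: "integrable (surface_measure F) (\<lambda>x. indicator F x * (r x * (Q x * w x)))" if "real_polynomial_function r" for r
    unfolding surface_measure_eq
    by (intro integrable_flat_measure_compact tangent_frame continuous_on_poly real_polynomial_function.intros(4) that Q w)
      (simp add: F compact_facet c)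
  have "(\<integral>x. indicator F x * (w x * (Q x * w x)) \<partial>surface_measure F) = 0"
  proof -
    have eq: "indicator F x * (w x * (Q x * w x)) = indicator F x * (p x * (Q x * w x)) - indicator F x * (p' x * (Q x * w x))" for x
      by (simp only: w_def[of x] left_diff_distrib right_diff_distrib)
    show ?thesis unfolding eq using i[OF p] i[OF p'] e by simp
  qed
  then have "w y = 0"
  proof (rule poly_zero_on_facet[OF _ _ _ w Q _ _ _ y, rotated -1])
    show "compact F" "convex F" "F \<noteq> {}"
      using compact_facet[OF c, folded F] convex_facet[OF c, folded F] facet_nonempty[OF c, folded F] by blast+
    show "0 \<le> Q x" if "x \<in> F" for x
      using that weight_nonneg N.weight_nonneg F F' unfolding Q_def by (intro mult_nonneg_nonneg) blast+
    show "0 < Q x" if "x \<in> rel_interior F" for x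
      using weight_pos[OF c] N.weight_pos[OF c'] that F F' unfolding Q_def by (intro mult_pos_pos) simp_all
  qed
  then show ?thesis by (simp add: w_def)
qed

lemma dir_deriv_zero_on_affine_hull:
  fixes w :: "real^'n \<Rightarrow> real"
  assumes w: "real_polynomial_function w" and z: "\<And>x. x \<in> affine hull F \<Longrightarrow> w x = 0"
    and t: "t \<in> span {x - y | x y. x \<in> F \<and> y \<in> F}" and x: "x \<in> affine hull F"
  shows "dir_deriv t w x = 0"
proof -
  have "w (x + s *\<^sub>R t) = 0" for s
    by (intro z affine_hull_add_direction[OF x] span_scale t)
  then have "((\<lambda>s. 0) has_real_derivative dir_deriv t w (x + 0 *\<^sub>R t)) (at 0)"
    using has_real_derivative_line[OF C_k_1_poly[OF w], of x t 0] by simp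
  then show ?thesis using DERIV_unique[OF DERIV_const] by fastforce
qed

section \<open>Elements that share a facet\<close>

lemma mesh_element:
  fixes K :: "(real^'n) set"
  assumes mesh: "conforming_triangulation \<Omega> \<T>" and K: "K \<in> \<T>"
  obtains C l d where "barycentric C l d" "K = convex hull C"
  using mesh K barycentric_exists[of K] unfolding conforming_triangulation_def by metis

context barycentric begin

lemma d_normal: "c \<in> C \<Longrightarrow> d c \<bullet> normal c = - norm (d c)"
  using d_nonzero[of c] by (simp add: normal_def dot_square_norm power2_eq_square)

lemma normal_step_inside:
  assumes c: "c \<in> C" and x: "x \<in> rel_interior (facet c)"
  shows "\<forall>\<^sub>F s in at_right 0. x - s *\<^sub>R normal c \<in> convex hull C \<and> l c (x - s *\<^sub>R normal c) > 0"
proof -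
  have xF: "x \<in> convex hull C" "l c x = 0" using x rel_interior_subset by blast+
  note dn = d_normal[OF c]
  have 1: "l c (x - s *\<^sub>R normal c) = s * norm (d c)" for s
    using l_add[OF c, of x "- (s *\<^sub>R normal c)"] xF dn by simp
  have "\<forall>\<^sub>F s in at_right 0. 0 < l c' (x - s *\<^sub>R normal c)" if c': "c' \<in> C" for c'
  proof (cases "c' = c")
    case True
    then show ?thesis using d_nonzero[OF c] by (auto simp: 1 eventually_at_filter)
  next
    case False
    have "((\<lambda>s. l c' (x - s *\<^sub>R normal c)) \<longlongrightarrow> l c' (x - 0 *\<^sub>R normal c)) (at_right 0)"
      by (intro isCont_tendsto_compose[OF continuous_on_interior[OF continuous_on_poly[OF l_polynomial[OF c'], of UNIV]]] tendsto_intros) simp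
    then show ?thesis using rel_interior_facet_pos[OF c c' False x]
      by (intro order_tendstoD(1)) auto
  qed
  then have "\<forall>\<^sub>F s in at_right 0. \<forall>c'\<in>C. 0 < l c' (x - s *\<^sub>R normal c)"
    by (intro eventually_ball_finite fin) auto
  then show ?thesis
    by eventually_elim (use c in \<open>auto simp: convex_hull_eq intro: less_imp_le\<close>)
qed

end

text \<open>The intersection of the two elements is a common face.  It contains a relative interior point of \<open>F\<close>,
  hence all of \<open>F\<close>, and it cannot have larger dimension.\<close>

lemma facet_of_neighbour:
  fixes \<T> :: "(real^'n) set set"
  assumes mesh: "conforming_triangulation \<Omega> \<T>" and K: "K \<in> \<T>" "K' \<in> \<T>" "K \<noteq> K'" and F: "F facet_of K"
    and x: "x \<in> rel_interior F" "x \<in> K'"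
  shows "F facet_of K'" "K \<inter> K' = F"
proof -
  have s: "int CARD('n) simplex K" "int CARD('n) simplex K'" and i: "(K \<inter> K') face_of K" "(K \<inter> K') face_of K'"
    using mesh K unfolding conforming_triangulation_def triangulation_def by (simp, simp, blast, metis inf_commute)
  note cv = full_simplex_interior(4)[OF s(1)] full_simplex_interior(4)[OF s(2)]
  note ad = aff_dim_simplex[OF s(1)] aff_dim_simplex[OF s(2)]
  have FK: "F \<subseteq> K" using F facet_of_imp_subset by blast
  have "x \<in> F" using x rel_interior_subset by blast
  then have "(K \<inter> K') \<inter> rel_interior F \<noteq> {}" using x FK by blast
  then have FI: "F \<subseteq> K \<inter> K'" by (rule subset_of_face_of[OF i(1) FK])
  have "K \<inter> K' \<noteq> K"
  proof
    assume "K \<inter> K' = K"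
    then have "K face_of K'" using i by simp
    then show False using face_of_aff_dim_lt[OF cv(2), of K] K(3) ad by simp
  qed
  then have lt: "aff_dim (K \<inter> K') < int CARD('n)" using face_of_aff_dim_lt[OF cv(1) i(1)] ad by simp
  have "F face_of (K \<inter> K')"
    using facet_of_imp_face_of[OF F] FI by (rule face_of_subset) blast
  then have "F = K \<inter> K'"
    using face_of_aff_dim_lt[of "K \<inter> K'" F] cv F lt ad by (auto simp: facet_of_def convex_Int)
  then show "K \<inter> K' = F" "F facet_of K'" using F i(2) ad by (auto simp: facet_of_def)
qed

lemma facet_barycentric:
  fixes \<T> :: "(real^'n) set set"
  assumes mesh: "conforming_triangulation \<Omega> \<T>" and K: "K \<in> \<T>" and F: "F facet_of K"
  obtains C l d c where "barycentric C l d" "K = convex hull C" "c \<in> C" "F = {x \<in> convex hull C. l c x = 0}"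
    "outward_normal K F = barycentric.normal d c"
proof -
  obtain C l d where b: "barycentric C l d" "K = convex hull C" using mesh_element[OF mesh K] .
  interpret barycentric C l d by fact
  obtain c where "c \<in> C" "F = {x \<in> convex hull C. l c x = 0}" using F b(2) facet_of_iff by auto
  then show thesis using that[OF b] outward_normal_eq b(2) by simp
qed

lemma facet_basis:
  fixes \<T> :: "(real^'n) set set"
  assumes mesh: "conforming_triangulation \<Omega> \<T>" and K: "K \<in> \<T>" and F: "F facet_of K"
  shows "orthonormal_basis (insert (outward_normal K F) (tangent_frame F))" "outward_normal K F \<notin> tangent_frame F"
    "finite (tangent_frame F)" "norm (outward_normal K F) = 1" "compact F" "convex F" "F \<noteq> {}"
proof -
  obtain C l d c where b: "barycentric C l d" "K = convex hull C" "c \<in> C" "F = {x \<in> convex hull C. l c x = 0}"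
    "outward_normal K F = barycentric.normal d c" using facet_barycentric[OF mesh K F] .
  interpret barycentric C l d by fact
  show "orthonormal_basis (insert (outward_normal K F) (tangent_frame F))" "outward_normal K F \<notin> tangent_frame F"
    "finite (tangent_frame F)" "norm (outward_normal K F) = 1" "compact F" "convex F" "F \<noteq> {}"
    unfolding b(5)
    using orthonormal_basis_facet[OF b(3,4)] finite_tangent_frame norm_normal[OF b(3)]
      compact_facet[OF b(3), folded b(4)] convex_facet[OF b(3), folded b(4)] facet_nonempty[OF b(3), folded b(4)]
    by blast+
qed

text \<open>Both are unit normals of the same hyperplane.\<close>

lemma outward_normal_cases:
  fixes \<T> :: "(real^'n) set set"
  assumes mesh: "conforming_triangulation \<Omega> \<T>" and K: "K \<in> \<T>" "F facet_of K" and K': "K' \<in> \<T>" "F facet_of K'"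
  shows "outward_normal K' F = outward_normal K F \<or> outward_normal K' F = - outward_normal K F"
proof -
  define n where "n = outward_normal K F"
  define n' where "n' = outward_normal K' F"
  note B = facet_basis[OF mesh K] and B' = facet_basis[OF mesh K']
  have on: "pairwise orthogonal (insert n (tangent_frame F))" "\<forall>b\<in>insert n (tangent_frame F). norm b = 1" "span (insert n (tangent_frame F)) = UNIV"
    using B(1) by (auto simp: orthonormal_basis_def n_def)
  have on': "pairwise orthogonal (insert n' (tangent_frame F))" "\<forall>b\<in>insert n' (tangent_frame F). norm b = 1"
    using B'(1) by (auto simp: orthonormal_basis_def n'_def)
  have t: "n' \<bullet> t = 0" if "t \<in> tangent_frame F" for t
    using orthonormal_inner[OF on', of n' t] that B'(2) by (auto simp: n'_def)
  have "n' = (\<Sum>b\<in>insert n (tangent_frame F). (n' \<bullet> b) *\<^sub>R b)"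
    using orthonormal_basis_expand[OF on(1), of n'] on B(3) by auto
  also have "\<dots> = (n' \<bullet> n) *\<^sub>R n" using B(2,3) t by (simp add: n_def)
  finally have e: "n' = (n' \<bullet> n) *\<^sub>R n" .
  then have "\<bar>n' \<bullet> n\<bar> * norm n = norm n'" by (metis norm_scaleR)
  then have "\<bar>n' \<bullet> n\<bar> = 1" using B(4) B'(4) by (simp add: n_def n'_def)
  then show ?thesis using e unfolding n_def[symmetric] n'_def[symmetric]
    by (metis abs_eq_iff' scaleR_minus1_left scaleR_one)
qed

text \<open>Two elements on the same side of \<open>F\<close> overlap near a relative interior point of \<open>F\<close>, but the
  intersection of different elements would be \<open>F\<close> itself.\<close>

lemma same_normal_imp_eq:
  fixes \<T> :: "(real^'n) set set"
  assumes mesh: "conforming_triangulation \<Omega> \<T>" and K: "K \<in> \<T>" "F facet_of K" and K': "K' \<in> \<T>" "F facet_of K'"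
    and n: "outward_normal K F = outward_normal K' F"
  shows "K = K'"
proof (rule ccontr)
  assume ne: "K \<noteq> K'"
  obtain C l d c where b: "barycentric C l d" "K = convex hull C" "c \<in> C" "F = {x \<in> convex hull C. l c x = 0}"
    "outward_normal K F = barycentric.normal d c" using facet_barycentric[OF mesh K] .
  obtain C' l' d' c' where b': "barycentric C' l' d'" "K' = convex hull C'" "c' \<in> C'" "F = {x \<in> convex hull C'. l' c' x = 0}"
    "outward_normal K' F = barycentric.normal d' c'" using facet_barycentric[OF mesh K'] .
  interpret barycentric C l d by fact
  interpret N: barycentric C' l' d' by fact
  have "rel_interior F \<noteq> {}" using facet_basis(6,7)[OF mesh K] rel_interior_eq_empty by blast
  then obtain x where x: "x \<in> rel_interior F" by auto
  have "x \<in> K'" using x rel_interior_subset[of F] facet_of_imp_subset[OF K'(2)] by blast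
  then have i: "K \<inter> K' = F" using facet_of_neighbour(2)[OF mesh K(1) K'(1) ne K(2) x] by simp
  have "\<forall>\<^sub>F s in at_right (0::real). x - s *\<^sub>R normal c \<in> convex hull C \<and> l c (x - s *\<^sub>R normal c) > 0"
    using x b(3,4) by (intro normal_step_inside) auto
  moreover have "\<forall>\<^sub>F s in at_right (0::real). x - s *\<^sub>R N.normal c' \<in> convex hull C' \<and> l' c' (x - s *\<^sub>R N.normal c') > 0"
    using x b'(3,4) by (intro N.normal_step_inside) auto
  moreover have "N.normal c' = normal c" using n b(5) b'(5) by simp
  ultimately have "\<forall>\<^sub>F s in at_right (0::real). x - s *\<^sub>R normal c \<in> K \<inter> K' \<and> l c (x - s *\<^sub>R normal c) > 0"
    unfolding b(2) b'(2) by (auto elim: eventually_elim2)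
  then have "\<exists>s::real. x - s *\<^sub>R normal c \<in> K \<inter> K' \<and> l c (x - s *\<^sub>R normal c) > 0"
    by (intro eventually_happens'[of "at_right (0::real)"]) auto
  then show False unfolding i b(4) by auto
qed

text \<open>A facet that is not in the boundary has a relative interior point \<open>x\<close> in the domain.  A small step
  from \<open>x\<close> in the direction of the outward normal stays in the domain and leads to an element \<open>K'\<close> on the other side.
  A third element would have the same normal as one of these two.\<close>

lemma interior_facet_pair:
  fixes \<T> :: "(real^'n) set set"
  assumes \<Omega>: "open \<Omega>" and mesh: "conforming_triangulation \<Omega> \<T>" and F: "F \<in> interior_faces \<Omega> \<T>"
  obtains K K' where "K \<noteq> K'" "{K \<in> \<T>. F facet_of K} = {K, K'}" "outward_normal K' F = - outward_normal K F"
proof -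
  obtain K where K: "K \<in> \<T>" "F facet_of K" and nF: "\<not> F \<subseteq> frontier \<Omega>" using F by (auto simp: interior_faces_def)
  have T: "finite \<T>" "\<Union>\<T> = closure \<Omega>" and s: "\<And>K. K \<in> \<T> \<Longrightarrow> int CARD('n) simplex K"
    using mesh unfolding conforming_triangulation_def triangulation_def by auto
  have cl: "closed K" if "K \<in> \<T>" for K using s[OF that] by (rule closed_simplex)
  obtain C l d c where b: "barycentric C l d" "K = convex hull C" "c \<in> C" "F = {x \<in> convex hull C. l c x = 0}"
    "outward_normal K F = barycentric.normal d c" using facet_barycentric[OF mesh K] .
  interpret barycentric C l d by fact
  have FO: "F \<subseteq> closure \<Omega>" using T(2) K facet_of_imp_subset by blast
  obtain y where y: "y \<in> F" "y \<in> \<Omega>" using nF FO \<Omega> by (auto simp: frontier_def interior_open)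
  have "y \<in> closure (rel_interior F)" using y(1) facet_basis(6)[OF mesh K] convex_closure_rel_interior closure_subset by blast
  then obtain x where x: "x \<in> rel_interior F" "x \<in> \<Omega>"
    using y(2) \<Omega> by (metis closure_iff_nhds_not_empty disjoint_iff inf.orderE order_refl)
  have xF: "x \<in> F" using x rel_interior_subset by blast
  \<comment> \<open>Near \<open>x\<close> there are only elements that contain \<open>x\<close>.\<close>
  define A where "A = \<Union>{K' \<in> \<T>. x \<notin> K'}"
  have "closed A" unfolding A_def using T(1) cl by (intro closed_Union) auto
  then have op: "open (\<Omega> - A)" using \<Omega> by (rule open_Diff[rotated])
  have xA: "x \<in> \<Omega> - A" using x(2) by (auto simp: A_def)
  obtain e where e: "e > 0" "ball x e \<subseteq> \<Omega> - A" using op xA open_contains_ball by blast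
  define z where "z = x + (e/2) *\<^sub>R normal c"
  have "z \<in> ball x e" using e(1) norm_normal[OF b(3)] by (simp add: z_def dist_norm)
  then have z: "z \<in> \<Omega>" "z \<notin> A" using e(2) by auto
  then have "z \<in> \<Union>\<T>" using T(2) closure_subset by blast
  then obtain K' where K': "K' \<in> \<T>" "z \<in> K'" by blast
  then have xK': "x \<in> K'" using z(2) by (auto simp: A_def)
  have ne: "K \<noteq> K'"
  proof
    assume "K = K'"
    then have "0 \<le> l c z" using K'(2) b(2,3) by (auto simp: convex_hull_eq)
    moreover have "l c z = - (e/2) * norm (d c)"
      using xF b(4) l_add[OF b(3), of x "(e/2) *\<^sub>R normal c"] d_normal[OF b(3)] by (simp add: z_def)
    ultimately show False using e(1) d_nonzero[OF b(3)] by (simp add: mult_le_0_iff zero_le_mult_iff)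
  qed
  have F': "F facet_of K'" by (rule facet_of_neighbour(1)[OF mesh K(1) K'(1) ne K(2) x(1) xK'])
  have opp: "outward_normal K' F = - outward_normal K F"
    using outward_normal_cases[OF mesh K K'(1) F'] same_normal_imp_eq[OF mesh K K'(1) F'] ne by metis
  have "K'' = K \<or> K'' = K'" if "K'' \<in> \<T>" "F facet_of K''" for K''
    using outward_normal_cases[OF mesh K that] same_normal_imp_eq[OF mesh K that] same_normal_imp_eq[OF mesh K'(1) F' that] opp by metis
  then have "{K \<in> \<T>. F facet_of K} = {K, K'}" using K K' F' by blast
  then show thesis using that ne opp by blast
qed

section \<open>Summation over the mesh\<close>

lemma element_boundary_sum:
  fixes K :: "(real^'n) set"
  assumes K: "int CARD('n) simplex K" and p: "real_polynomial_function p"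
  shows "(norm_L2 K (laplacian p))\<^sup>2 - (norm_L2 K (hessian p))\<^sup>2
   = (\<Sum>F | F facet_of K. \<integral>x. indicator F x * boundary_field p (outward_normal K F) x \<partial>surface_measure F)"
proof -
  obtain C l d where b: "barycentric C l d" "K = convex hull C" using barycentric_exists[OF K] .
  interpret barycentric C l d by fact
  let ?F = "\<lambda>c. {x \<in> convex hull C. l c x = 0}"
  have Kb: "K \<in> sets borel" using compact_hull b(2) by (simp add: borel_compact)
  have cl: "(\<lambda>x. (laplacian p x)\<^sup>2) \<in> borel_measurable borel"
    by (intro borel_measurable_continuous_onI continuous_on_power continuous_on_poly poly_laplacian p)
  have ch: "(\<lambda>x. (norm (hessian p x))\<^sup>2) \<in> borel_measurable borel"
    unfolding norm_hessian by (intro borel_measurable_continuous_onI continuous_on_sum continuous_on_power continuous_on_poly real_polynomial_function_dir_deriv p)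
  have "(norm_L2 K (laplacian p))\<^sup>2 - (norm_L2 K (hessian p))\<^sup>2 =
     (\<integral>x. indicator K x * (laplacian p x)\<^sup>2 \<partial>lborel) - (\<integral>x. indicator K x * (norm (hessian p x))\<^sup>2 \<partial>lborel)"
    by (simp add: norm_L2_square integral_lebesgue_on_borel[OF Kb cl] integral_lebesgue_on_borel[OF Kb ch])
  also have "\<dots> = (\<Sum>c\<in>C. \<integral>x. indicator (?F c) x * boundary_field p (normal c) x \<partial>surface_measure (?F c))"
    unfolding b(2) by (rule element_identity[OF p])
  also have "\<dots> = (\<Sum>c\<in>C. \<integral>x. indicator (?F c) x * boundary_field p (outward_normal K (?F c)) x \<partial>surface_measure (?F c))"
    using outward_normal_eq b(2) by (intro sum.cong) auto
  also have "\<dots> = (\<Sum>F\<in>?F ` C. \<integral>x. indicator F x * boundary_field p (outward_normal K F) x \<partial>surface_measure F)"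
  proof (subst sum.reindex)
    show "inj_on ?F C"
    proof (rule inj_onI, rule ccontr)
      fix c c' assume c: "c \<in> C" "c' \<in> C" and eq: "?F c = ?F c'" and "c \<noteq> c'"
      then have "c' \<in> ?F c'" using vertex_in_facet[of c' c] by blast
      then show False using l_vertex[OF c(2,2)] by simp
    qed
  qed simp
  also have "?F ` C = {F. F facet_of K}" using facet_of_iff b(2) by auto
  finally show ?thesis .
qed

text \<open>The relative boundary of a facet consists of vertices in dimension two and of edges in dimension
  three.\<close>

lemma rel_frontier_facet:
  fixes K :: "(real^'n) set"
  assumes K: "int CARD('n) simplex K" and F: "F facet_of K" and z: "z \<in> rel_frontier F"
  obtains e where "e face_of K" "e \<subseteq> F" "z \<in> e" "aff_dim e = int CARD('n) - 2"
proof -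
  have "polytope F" using simplex_imp_polytope[OF K] F face_of_polytope_polytope by (auto simp: facet_of_def)
  then have "z \<in> \<Union>{e. e facet_of F}" using z rel_frontier_of_polyhedron polytope_imp_polyhedron by blast
  then obtain e where e: "e facet_of F" "z \<in> e" by blast
  show thesis
  proof (rule that)
    show "e face_of K" using e(1) F by (auto simp: facet_of_def intro: face_of_trans)
    show "e \<subseteq> F" using e(1) by (rule facet_of_imp_subset)
    show "aff_dim e = int CARD('n) - 2" using e(1) F aff_dim_simplex[OF K] by (simp add: facet_of_def)
  qed fact
qed

lemma grad_eq_on_rel_frontier:
  fixes v :: "real^'n \<Rightarrow> real"
  assumes dim: "CARD('n) = 2 \<or> CARD('n) = 3" and mesh: "conforming_triangulation \<Omega> \<T>" and fe: "v \<in> fe_space \<Omega> \<T> k"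
    and K: "K \<in> \<T>" "F facet_of K" and K': "K' \<in> \<T>" "F facet_of K'" and z: "z \<in> rel_frontier F"
  shows "grad (elem_poly v K) z = grad (elem_poly v K') z"
proof -
  have s: "int CARD('n) simplex K" using mesh K unfolding conforming_triangulation_def by blast
  obtain e where e: "e face_of K" "e \<subseteq> F" "z \<in> e" "aff_dim e = int CARD('n) - 2" using rel_frontier_facet[OF s K(2) z] .
  have FK: "F \<subseteq> K" "F \<subseteq> K'" using K K' facet_of_imp_subset by blast+
  show ?thesis using dim
  proof
    assume n: "CARD('n) = 2"
    then have "aff_dim e = 0" using e(4) by simp
    then obtain w where "e = {w}" using aff_dim_eq_0 by blast
    then have "z \<in> mesh_vertices \<T>" using e(1,3) K(1) by (auto simp: mesh_vertices_def)
    then have "C1_at \<T> v z" using fe n by (auto simp: fe_space_def)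
    then show ?thesis using K(1) K'(1) e(2,3) FK unfolding C1_at_def by blast
  next
    assume n: "CARD('n) = 3"
    then have "e edge_of K" using e(1,4) by (simp add: edge_of_def)
    then have "e \<in> mesh_edges \<T>" using K(1) by (auto simp: mesh_edges_def)
    then have "C1_on_edge \<T> v e" using fe n by (auto simp: fe_space_def)
    then show ?thesis using K(1) K'(1) e(2,3) FK unfolding C1_on_edge_def by blast
  qed
qed

lemma boundary_facet_zero:
  fixes p :: "real^'n \<Rightarrow> real"
  assumes mesh: "conforming_triangulation \<Omega> \<T>" and K: "K \<in> \<T>" "F facet_of K"
    and p: "real_polynomial_function p" and z: "\<And>x. x \<in> affine hull F \<Longrightarrow> p x = 0"
  shows "(\<integral>x. indicator F x * boundary_field p (outward_normal K F) x \<partial>surface_measure F) = 0"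
proof -
  let ?n = "outward_normal K F" and ?T = "tangent_frame F"
  note B = facet_basis[OF mesh K]
  have t: "t \<in> span {x - y | x y. x \<in> F \<and> y \<in> F}" if "t \<in> ?T" for t
    using that tangent_frame(3)[of F] by (metis span_base)
  have 1: "dir_deriv t p x = 0" if "t \<in> ?T" "x \<in> affine hull F" for t x
    by (rule dir_deriv_zero_on_affine_hull[OF p z t]) (use that in auto)
  have 2: "dir_deriv t (dir_deriv t p) x = 0" if "t \<in> ?T" "x \<in> affine hull F" for t x
    by (rule dir_deriv_zero_on_affine_hull[OF real_polynomial_function_dir_deriv[OF p] 1[OF that(1)] t]) (use that in auto)
  have "boundary_field p ?n x = 0" if "x \<in> F" for x
    unfolding boundary_field_normal[OF p B(1,2,3)]
    using 1 2 that by (simp add: hull_inc dir_deriv_mult real_polynomial_function_dir_deriv p)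
  then have "indicator F x * boundary_field p ?n x = 0" for x by (simp add: indicator_def)
  then show ?thesis by (simp only: Bochner_Integration.integral_zero)
qed

text \<open>The fields \<open>\<psi> t\<close> collect, from both sides, the products under the tangential derivatives.  With
  opposite normals and equal gradients they vanish on the relative boundary of \<open>F\<close>.\<close>

lemma interior_facet_identity:
  fixes p p' :: "real^'n \<Rightarrow> real"
  assumes mesh: "conforming_triangulation \<Omega> \<T>" and K: "K \<in> \<T>" "F facet_of K" and K': "K' \<in> \<T>" "F facet_of K'"
    and n': "outward_normal K' F = - outward_normal K F"
    and p: "real_polynomial_function p" and p': "real_polynomial_function p'"
    and eq: "\<And>x. x \<in> affine hull F \<Longrightarrow> p x = p' x"
    and grad: "\<And>z. z \<in> rel_frontier F \<Longrightarrow> grad p z = grad p' z"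
  shows "(\<integral>x. indicator F x * boundary_field p (outward_normal K F) x \<partial>surface_measure F)
      + (\<integral>x. indicator F x * boundary_field p' (outward_normal K' F) x \<partial>surface_measure F)
    = 2 * (\<integral>x. indicator F x * ((grad p x \<bullet> outward_normal K F + grad p' x \<bullet> outward_normal K' F) * tangential_laplacian F p x) \<partial>surface_measure F)"
    and "x \<in> F \<Longrightarrow> tangential_laplacian F p x = tangential_laplacian F p' x"
proof -
  define n where "n = outward_normal K F"
  define m where "m = outward_normal K' F"
  let ?T = "tangent_frame F" and ?S = "surface_measure F"
  note B = facet_basis[OF mesh K, folded n_def] and B' = facet_basis[OF mesh K', folded m_def]
  note pd = real_polynomial_function_dir_deriv
  have t: "t \<in> span {x - y | x y. x \<in> F \<and> y \<in> F}" if "t \<in> ?T" for t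
    using that tangent_frame(3)[of F] by (metis span_base)
  define w where "w x = p x - p' x" for x
  have w: "real_polynomial_function w" unfolding w_def using p p' by (rule real_polynomial_function_diff)
  have dw: "dir_deriv t w x = dir_deriv t p x - dir_deriv t p' x" for t x
    unfolding w_def by (rule dir_deriv_diff[OF p p'])
  have ddw: "dir_deriv t (dir_deriv t w) x = dir_deriv t (dir_deriv t p) x - dir_deriv t (dir_deriv t p') x" for t x
  proof -
    have "dir_deriv t w = (\<lambda>x. dir_deriv t p x - dir_deriv t p' x)" using dw by auto
    then show ?thesis using dir_deriv_diff[OF pd[OF p] pd[OF p']] by simp
  qed
  have z1: "dir_deriv t w x = 0" if "t \<in> ?T" "x \<in> affine hull F" for t x
    by (rule dir_deriv_zero_on_affine_hull[OF w _ t]) (use that eq in \<open>auto simp: w_def\<close>)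
  have z2: "dir_deriv t (dir_deriv t w) x = 0" if "t \<in> ?T" "x \<in> affine hull F" for t x
    by (rule dir_deriv_zero_on_affine_hull[OF pd[OF w] z1[OF that(1)] t]) (use that in auto)
  show tl: "tangential_laplacian F p x = tangential_laplacian F p' x" if "x \<in> F" for x
    unfolding tangential_laplacian_def using z2 that ddw by (intro sum.cong) (auto simp: hull_inc)
  define \<psi> where "\<psi> t x = dir_deriv t p x * dir_deriv n p x + dir_deriv t p' x * dir_deriv m p' x" for t x
  have \<psi>p: "real_polynomial_function (\<psi> t)" for t
    unfolding \<psi>_def by (intro real_polynomial_function.intros(3,4) pd p p')
  have \<psi>0: "\<psi> t z = 0" if "t \<in> ?T" "z \<in> rel_frontier F" for t z
  proof -
    have g: "dir_deriv u p z = dir_deriv u p' z" for u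
      using grad[OF that(2)] grad_inner[OF C_k_1_poly[OF p], of z u] grad_inner[OF C_k_1_poly[OF p'], of z u] by simp
    have "dir_deriv m p' z = - dir_deriv n p' z"
      using linear_neg[OF linear_dir_deriv_poly[OF p', of z], of n] n' by (simp add: m_def n_def)
    then show ?thesis by (simp add: \<psi>_def g)
  qed
  define J where "J x = (dir_deriv n p x + dir_deriv m p' x) * tangential_laplacian F p x" for x
  have bf: "boundary_field p n x + boundary_field p' m x = 2 * J x - (\<Sum>t\<in>?T. dir_deriv t (\<psi> t) x)" if "x \<in> F" for x
  proof -
    have "(\<Sum>t\<in>?T. dir_deriv t (\<psi> t) x) = (\<Sum>t\<in>?T. dir_deriv t (\<lambda>x. dir_deriv t p x * dir_deriv n p x) x) + (\<Sum>t\<in>?T. dir_deriv t (\<lambda>x. dir_deriv t p' x * dir_deriv m p' x) x)"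
      unfolding \<psi>_def[abs_def] sum.distrib[symmetric]
      by (intro sum.cong refl dir_deriv_add real_polynomial_function.intros(4) pd p p')
    moreover have "boundary_field p n x = 2 * (tangential_laplacian F p x * dir_deriv n p x) - (\<Sum>t\<in>?T. dir_deriv t (\<lambda>x. dir_deriv t p x * dir_deriv n p x) x)"
      unfolding boundary_field_normal[OF p B(1-3)] tangential_laplacian_def ..
    moreover have "boundary_field p' m x = 2 * (tangential_laplacian F p' x * dir_deriv m p' x) - (\<Sum>t\<in>?T. dir_deriv t (\<lambda>x. dir_deriv t p' x * dir_deriv m p' x) x)"
      unfolding boundary_field_normal[OF p' B'(1-3)] tangential_laplacian_def ..
    ultimately show ?thesis using tl[OF that] by (simp add: J_def algebra_simps)
  qed
  have int: "integrable ?S (\<lambda>x. indicator F x * f x)" if "real_polynomial_function f" for f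
    unfolding surface_measure_eq by (intro integrable_flat_measure_compact tangent_frame B(5) continuous_on_poly that)
  have tlp: "real_polynomial_function (tangential_laplacian F p)"
    unfolding tangential_laplacian_def[abs_def] by (intro real_polynomial_function_sum pd p B(3))
  have Jp: "real_polynomial_function J"
    unfolding J_def[abs_def] by (intro real_polynomial_function.intros(3,4) pd p p' tlp)
  have \<psi>i: "(\<integral>x. indicator F x * dir_deriv t (\<psi> t) x \<partial>?S) = 0" if "t \<in> ?T" for t
    unfolding surface_measure_eq
  proof (rule integral_tangential_derivative_eq_0[OF B(5,6) _ tangent_frame that C_k_1_poly[OF \<psi>p]])
    show "(SOME a. a \<in> F) \<in> F" using B(7) by (simp add: some_in_eq)
    show "\<psi> t x = 0" if "x \<in> rel_frontier F" for x by (rule \<psi>0) fact+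
  qed
  have "(\<integral>x. indicator F x * boundary_field p n x \<partial>?S) + (\<integral>x. indicator F x * boundary_field p' m x \<partial>?S)
    = (\<integral>x. indicator F x * boundary_field p n x + indicator F x * boundary_field p' m x \<partial>?S)"
    by (intro Bochner_Integration.integral_add[symmetric] int poly_boundary_field p p')
  also have "\<dots> = (\<integral>x. 2 * (indicator F x * J x) - (\<Sum>t\<in>?T. indicator F x * dir_deriv t (\<psi> t) x) \<partial>?S)"
  proof (rule Bochner_Integration.integral_cong[OF refl])
    fix x
    show "indicator F x * boundary_field p n x + indicator F x * boundary_field p' m x = 2 * (indicator F x * J x) - (\<Sum>t\<in>?T. indicator F x * dir_deriv t (\<psi> t) x)"
      using bf[of x] by (cases "x \<in> F") simp_all
  qed
  also have "\<dots> = (\<integral>x. 2 * (indicator F x * J x) \<partial>?S) - (\<integral>x. (\<Sum>t\<in>?T. indicator F x * dir_deriv t (\<psi> t) x) \<partial>?S)"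
    by (intro Bochner_Integration.integral_diff integrable_mult_right Bochner_Integration.integrable_sum int Jp pd \<psi>p)
  also have "(\<integral>x. (\<Sum>t\<in>?T. indicator F x * dir_deriv t (\<psi> t) x) \<partial>?S) = (\<Sum>t\<in>?T. \<integral>x. indicator F x * dir_deriv t (\<psi> t) x \<partial>?S)"
    by (intro Bochner_Integration.integral_sum int pd \<psi>p)
  also have "\<dots> = 0" using \<psi>i by simp
  also have "(\<integral>x. 2 * (indicator F x * J x) \<partial>?S) - 0 = 2 * (\<integral>x. indicator F x * J x \<partial>?S)" by simp
  finally show "(\<integral>x. indicator F x * boundary_field p (outward_normal K F) x \<partial>surface_measure F)
      + (\<integral>x. indicator F x * boundary_field p' (outward_normal K' F) x \<partial>surface_measure F)
    = 2 * (\<integral>x. indicator F x * ((grad p x \<bullet> outward_normal K F + grad p' x \<bullet> outward_normal K' F) * tangential_laplacian F p x) \<partial>surface_measure F)"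
    by (simp add: J_def grad_inner[OF C_k_1_poly[OF p]] grad_inner[OF C_k_1_poly[OF p']] n_def m_def)
qed

theorem lemma3p3:
  fixes \<Omega> :: "(real^'n) set" and \<T> :: "(real^'n) set set" and k :: nat
    and v\<^sub>h :: "real^'n \<Rightarrow> real"
  assumes dim_deg: "CARD('n) = 2 \<and> k \<ge> 3 \<or> CARD('n) = 3 \<and> k \<ge> 5"
    and domain: "lipschitz_polytopal_domain \<Omega>"
    and mesh: "conforming_triangulation \<Omega> \<T>"
    and fe: "v\<^sub>h \<in> fe_space \<Omega> \<T> k"
  shows "(\<Sum>K\<in>\<T>. (norm_L2 K (laplacian (elem_poly v\<^sub>h K)))\<^sup>2) =
         (\<Sum>K\<in>\<T>. (norm_L2 K (hessian (elem_poly v\<^sub>h K)))\<^sup>2) +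
         2 * (\<Sum>F\<in>interior_faces \<Omega> \<T>.
                inner_L2_face F (jump \<T> (\<lambda>K. grad (elem_poly v\<^sub>h K)) F) (face_laplacian \<T> v\<^sub>h F))"
proof -
  have \<Omega>: "open \<Omega>" "bounded \<Omega>" and lip: "lipschitz_boundary \<Omega>"
    using domain by (auto simp: lipschitz_polytopal_domain_def)
  have fin: "finite \<T>" and s: "\<And>K. K \<in> \<T> \<Longrightarrow> int CARD('n) simplex K" and un: "\<Union>\<T> = closure \<Omega>"
    using mesh by (auto simp: conforming_triangulation_def triangulation_def)
  have int\<Omega>: "interior K \<subseteq> \<Omega>" if "K \<in> \<T>" for K
    using interior_mono[of K "closure \<Omega>"] un that lipschitz_boundary_interior_closure[OF \<Omega>(1) lip] by blast
  have v: "v\<^sub>h \<in> H1_0 \<Omega>" using fe by (simp add: fe_space_def)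
  define P where "P K = elem_poly v\<^sub>h K" for K
  have P: "real_polynomial_function (P K)" "AE x in lebesgue_on K. v\<^sub>h x = P K x" if K: "K \<in> \<T>" for K
  proof -
    obtain p where "p \<in> polys k" "AE x in lebesgue_on K. v\<^sub>h x = p x" using fe K by (auto simp: fe_space_def)
    then show "real_polynomial_function (P K)" "AE x in lebesgue_on K. v\<^sub>h x = P K x"
      unfolding P_def using elem_poly_represents[OF s[OF K]] by blast+
  qed
  define B where "B K F = (\<integral>x. indicator F x * boundary_field (P K) (outward_normal K F) x \<partial>surface_measure F)" for K F
  define \<F> where "\<F> = (\<Union>K\<in>\<T>. {F. F facet_of K})"
  have fin\<F>: "finite \<F>"
    unfolding \<F>_def using fin finite_polytope_facets[OF simplex_imp_polytope[OF s]] by blast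
  have iF: "interior_faces \<Omega> \<T> \<subseteq> \<F>" by (auto simp: interior_faces_def \<F>_def)
  have bdry: "B K F = 0" if F: "F \<notin> interior_faces \<Omega> \<T>" and K: "K \<in> \<T>" "F facet_of K" for K F
  proof -
    have fr: "F \<subseteq> frontier \<Omega>" using F K by (auto simp: interior_faces_def)
    obtain C l d c where b: "barycentric C l d" "K = convex hull C" "c \<in> C" "F = {x \<in> convex hull C. l c x = 0}"
      using facet_barycentric[OF mesh K] .
    have "P K y = 0" if "y \<in> affine hull F" for y
      using H1_0_zero_on_boundary_facet[OF \<Omega> v b(1) _ P(1)[OF K(1)] _ b(3)] int\<Omega>[OF K(1)] P(2)[OF K(1)] fr that
      unfolding b(2,4) by blast
    then show ?thesis unfolding B_def by (intro boundary_facet_zero[OF mesh K P(1)[OF K(1)]])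
  qed
  have inter: "(\<Sum>K | K \<in> \<T> \<and> F facet_of K. B K F) = 2 * inner_L2_face F (jump \<T> (\<lambda>K. grad (elem_poly v\<^sub>h K)) F) (face_laplacian \<T> v\<^sub>h F)"
    if F: "F \<in> interior_faces \<Omega> \<T>" for F
  proof -
    obtain K K' where ne: "K \<noteq> K'" and KK: "{K \<in> \<T>. F facet_of K} = {K, K'}" and n': "outward_normal K' F = - outward_normal K F"
      using interior_facet_pair[OF \<Omega>(1) mesh F] .
    have K: "K \<in> \<T>" "F facet_of K" and K': "K' \<in> \<T>" "F facet_of K'" using KK by blast+
    obtain C l d c where b: "barycentric C l d" "K = convex hull C" "c \<in> C" "F = {x \<in> convex hull C. l c x = 0}"
      using facet_barycentric[OF mesh K] .
    obtain C' l' d' c' where b': "barycentric C' l' d'" "K' = convex hull C'" "c' \<in> C'" "F = {x \<in> convex hull C'. l' c' x = 0}"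
      using facet_barycentric[OF mesh K'] .
    have eq: "P K y = P K' y" if "y \<in> affine hull F" for y
      by (rule H1_0_continuous_across_facet[OF \<Omega> v b(1) int\<Omega>[OF K(1), unfolded b(2)] P(1)[OF K(1), unfolded b(2)] P(2)[OF K(1), unfolded b(2)] b(3)
          b'(1) int\<Omega>[OF K'(1), unfolded b'(2)] P(1)[OF K'(1), unfolded b'(2)] P(2)[OF K'(1), unfolded b'(2)] b'(3) b(4) b'(4) that, folded b(2) b'(2)])
    have gr: "grad (P K) z = grad (P K') z" if "z \<in> rel_frontier F" for z
      unfolding P_def using dim_deg by (intro grad_eq_on_rel_frontier[OF _ mesh fe K K' that]) auto
    note id = interior_facet_identity[OF mesh K K' n' P(1)[OF K(1)] P(1)[OF K'(1)] eq gr]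
    have tl: "tangential_laplacian F (P K) x = tangential_laplacian F (P K') x" if "x \<in> F" for x
      using that by (rule id(2)[rotated -1])
    have jump: "jump \<T> (\<lambda>K. grad (elem_poly v\<^sub>h K)) F x = grad (P K) x \<bullet> outward_normal K F + grad (P K') x \<bullet> outward_normal K' F" for x
      unfolding jump_def KK P_def using ne by simp
    have fl: "face_laplacian \<T> v\<^sub>h F x = tangential_laplacian F (P K) x" if "x \<in> F" for x
      unfolding face_laplacian_def
    proof (rule the_equality)
      show "\<forall>L\<in>\<T>. F facet_of L \<longrightarrow> tangential_laplacian F (elem_poly v\<^sub>h L) x = tangential_laplacian F (P K) x"
      proof (intro ballI impI)
        fix L assume "L \<in> \<T>" "F facet_of L"
        then have "L \<in> {K, K'}" using KK by blast
        then show "tangential_laplacian F (elem_poly v\<^sub>h L) x = tangential_laplacian F (P K) x"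
          using tl[OF that] unfolding P_def by (elim insertE emptyE) simp_all
      qed
      fix d assume "\<forall>L\<in>\<T>. F facet_of L \<longrightarrow> tangential_laplacian F (elem_poly v\<^sub>h L) x = d"
      then show "d = tangential_laplacian F (P K) x"
        using K unfolding P_def by simp
    qed
    have "(\<Sum>K | K \<in> \<T> \<and> F facet_of K. B K F) = B K F + B K' F"
      unfolding KK using ne by simp
    also have "\<dots> = 2 * (\<integral>x. indicator F x * ((grad (P K) x \<bullet> outward_normal K F + grad (P K') x \<bullet> outward_normal K' F) * tangential_laplacian F (P K) x) \<partial>surface_measure F)"
      unfolding B_def by (rule id(1))
    also have "(\<integral>x. indicator F x * ((grad (P K) x \<bullet> outward_normal K F + grad (P K') x \<bullet> outward_normal K' F) * tangential_laplacian F (P K) x) \<partial>surface_measure F)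
       = inner_L2_face F (jump \<T> (\<lambda>K. grad (elem_poly v\<^sub>h K)) F) (face_laplacian \<T> v\<^sub>h F)"
      unfolding inner_L2_face_def set_lebesgue_integral_def jump
    proof (rule Bochner_Integration.integral_cong[OF refl])
      fix x
      show "indicator F x * ((grad (P K) x \<bullet> outward_normal K F + grad (P K') x \<bullet> outward_normal K' F) * tangential_laplacian F (P K) x)
        = indicator F x *\<^sub>R ((grad (P K) x \<bullet> outward_normal K F + grad (P K') x \<bullet> outward_normal K' F) * face_laplacian \<T> v\<^sub>h F x)"
        using fl[of x] by (cases "x \<in> F") simp_all
    qed
    finally show ?thesis .
  qed
  have "(\<Sum>K\<in>\<T>. (norm_L2 K (laplacian (P K)))\<^sup>2) - (\<Sum>K\<in>\<T>. (norm_L2 K (hessian (P K)))\<^sup>2) = (\<Sum>K\<in>\<T>. \<Sum>F | F facet_of K. B K F)"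
    unfolding sum_subtractf[symmetric] B_def by (intro sum.cong refl element_boundary_sum s P)
  also have "\<dots> = (\<Sum>K\<in>\<T>. \<Sum>F | F \<in> \<F> \<and> F facet_of K. B K F)"
    by (intro sum.cong refl) (auto simp: \<F>_def)
  also have "\<dots> = (\<Sum>F\<in>\<F>. \<Sum>K | K \<in> \<T> \<and> F facet_of K. B K F)"
    by (rule sum.swap_restrict[OF fin fin\<F>])
  also have "\<dots> = (\<Sum>F\<in>interior_faces \<Omega> \<T>. \<Sum>K | K \<in> \<T> \<and> F facet_of K. B K F)"
    using bdry by (intro sum.mono_neutral_right fin\<F> iF) auto
  also have "\<dots> = 2 * (\<Sum>F\<in>interior_faces \<Omega> \<T>. inner_L2_face F (jump \<T> (\<lambda>K. grad (elem_poly v\<^sub>h K)) F) (face_laplacian \<T> v\<^sub>h F))"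
    unfolding sum_distrib_left by (intro sum.cong refl inter)
  finally show ?thesis unfolding P_def by simp
qed

end
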